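(* Let $p\ge3$ be a prime, and let $E_n$, $\pi_n$ ($n\ge 1$) be as in the context. Let $\boldsymbol{\mu}_{p-1}$ be the group of $(p-1)$-st roots of unity in $\mathbb{Q}_p$, and for $n\ge0$ put $$s_n=\frac1{p-1}\sum_{H\subseteq\boldsymbol{\mu}_{p-1}}(-1)^{\#H}\,\Big\{v_p\Big(\sum_{\xi\in H}\xi\Big)\ge n\Big\},$$ where the sum runs over all subsets $H$ of $\boldsymbol{\mu}_{p-1}$ and $\{A\}$ equals $1$ if the assertion $A$ is true and $0$ otherwise. Then for all $n\ge1$, $$\mathrm{Tr}_{E_n|\mathbb{Q}}(\pi_n)=p^ns_n-p^{n-1}s_{n-1}.$$ Moreover, $s_0=0$, and $s_n\in\mathbb{Z}$ for all $n\ge0$. The sequence $(s_n)_{n\ge 0}$ becomes stationary; if $N_0(p)$ denotes the minimal index from which on it is constant, then $$N_0(p)\le N(p):=\max_{H\subseteq\boldsymbol{\mu}_{p-1}}\Big\{v_p\Big(\sum_{\xi\in H}\xi\Big)\;:\;\sum_{\xi\in H}\xi\ne0\Big\}+1.$$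
   Context: $v_p$ is the $p$-adic valuation on $\mathbb{Q}_p$, with $v_p(0)=+\infty$. For $n\ge1$ let $\zeta_{p^n}$ be a primitive $p^n$-th root of unity over $\mathbb{Q}$, chosen so that $\zeta_{p^{n+1}}^p=\zeta_{p^n}$. Put $F_n=\mathbb{Q}(\zeta_{p^n})$, and let $E_n$ be the fixed field in $F_n$ of the unique subgroup of order $p-1$ of $\mathrm{Gal}(F_n|\mathbb{Q})\cong(\mathbb{Z}/p^n)^*$, so $[E_n:\mathbb{Q}]=p^{n-1}$. Put $\pi_n=\mathrm{N}_{F_n|E_n}(\zeta_{p^n}-1)=\prod_{j=1}^{p-1}\big(\zeta_{p^n}^{\,j^{p^{n-1}}}-1\big)\in E_n$. *)

theory Defs
  imports
    Complex_Main
    "HOL-Library.Extended"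
    "HOL-Algebra.Bij"
    "HOL-Algebra.QuotRing"
    "HOL-Algebra.Embedded_Algebras"
    "HOL-Algebra.Generated_Fields"
    "HOL-Algebra.Algebraic_Closure_Type"
    "HOL-Computational_Algebra.Primes"
begin

section \<open>The field of p-adic numbers\<close>

definition rat_pval :: "nat \<Rightarrow> rat \<Rightarrow> int extended" where
  "rat_pval p x =
     (if x = 0 then Pinf
      else Fin (int (multiplicity (int p) (fst (quotient_of x)))
              - int (multiplicity (int p) (snd (quotient_of x)))))"

text \<open>
  The field of p-adic numbers is the completion of the rationals with respect to the p-adic
  valuation: the ring of p-adic Cauchy sequences of rationals, with pointwise operations,
  modulo the ideal of p-adic null sequences.
\<close>

definition padic_Cauchy :: "nat \<Rightarrow> (nat \<Rightarrow> rat) set" where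
  "padic_Cauchy p = {x. \<forall>N::int. \<exists>M. \<forall>i\<ge>M. \<forall>j\<ge>M. Fin N \<le> rat_pval p (x i - x j)}"

definition padic_null :: "nat \<Rightarrow> (nat \<Rightarrow> rat) set" where
  "padic_null p = {x. \<forall>N::int. \<exists>M. \<forall>i\<ge>M. Fin N \<le> rat_pval p (x i)}"

definition padic_Cauchy_ring :: "nat \<Rightarrow> (nat \<Rightarrow> rat) ring" where
  "padic_Cauchy_ring p =
     \<lparr> carrier = padic_Cauchy p,
       monoid.mult = (\<lambda>x y i. x i * y i), one = (\<lambda>_. 1),
       zero = (\<lambda>_. 0), add = (\<lambda>x y i. x i + y i) \<rparr>"

definition Qp :: "nat \<Rightarrow> (nat \<Rightarrow> rat) set ring" where
  "Qp p = padic_Cauchy_ring p Quot padic_null p"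

text \<open>
  The valuations of the terms of a p-adic Cauchy sequence that is not a null sequence are
  eventually constant, and the eventual value depends only on the class of the sequence.
\<close>

definition padic_val :: "nat \<Rightarrow> (nat \<Rightarrow> rat) set \<Rightarrow> int extended" where
  "padic_val p c =
     (if c = \<zero>\<^bsub>Qp p\<^esub> then Pinf
      else (THE w. \<exists>x\<in>c. \<forall>\<^sub>F k in sequentially. rat_pval p (x k) = w))"

definition mu_roots :: "nat \<Rightarrow> (nat \<Rightarrow> rat) set set" where
  "mu_roots p = {\<xi> \<in> carrier (Qp p). \<xi> [^]\<^bsub>Qp p\<^esub> (p - 1) = \<one>\<^bsub>Qp p\<^esub>}"

definition s_seq :: "nat \<Rightarrow> nat \<Rightarrow> rat" where
  "s_seq p n = 1 / of_nat (p - 1) *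
     (\<Sum>H \<in> Pow (mu_roots p).
        (- 1) ^ card H * of_bool (padic_val p (\<Oplus>\<^bsub>Qp p\<^esub>\<xi>\<in>H. \<xi>) \<ge> Fin (int n)))"

definition N0 :: "nat \<Rightarrow> nat" where
  "N0 p = (LEAST N. \<forall>n\<ge>N. s_seq p n = s_seq p N)"

definition Nbound :: "nat \<Rightarrow> int extended" where
  "Nbound p =
     Max {padic_val p (\<Oplus>\<^bsub>Qp p\<^esub>\<xi>\<in>H. \<xi>) | H.
            H \<subseteq> mu_roots p \<and> (\<Oplus>\<^bsub>Qp p\<^esub>\<xi>\<in>H. \<xi>) \<noteq> \<zero>\<^bsub>Qp p\<^esub>} + 1"


section \<open>Field extensions inside the complex numbers\<close>

text \<open>
  The trace of \<open>x\<close> in the extension \<open>E\<close> of \<open>K\<close>, both subfields of \<open>R\<close>, is the trace of the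
  \<open>K\<close>-linear endomorphism of \<open>E\<close> given by multiplication by \<open>x\<close>. Here \<open>Us\<close> is a \<open>K\<close>-basis of
  \<open>E\<close>, and \<open>M j\<close> is the \<open>j\<close>-th column of the matrix of that endomorphism.
\<close>

definition field_trace :: "('a, 'b) ring_scheme \<Rightarrow> 'a set \<Rightarrow> 'a set \<Rightarrow> 'a \<Rightarrow> 'a" where
  "field_trace R K E x =
     (THE t. \<exists>Us M. ring.independent R K Us \<and> ring.Span R K Us = E \<and>
        (\<forall>j<length Us. length (M j) = length Us \<and> set (M j) \<subseteq> K \<and>
           x \<otimes>\<^bsub>R\<^esub> Us ! j = ring.combine R (M j) Us) \<and>
        t = (\<Oplus>\<^bsub>R\<^esub>i\<in>{..<length Us}. M i ! i))"

definition Gal :: "('a, 'b) ring_scheme \<Rightarrow> 'a set \<Rightarrow> 'a set \<Rightarrow> ('a \<Rightarrow> 'a) monoid" where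
  "Gal R K F = (BijGroup F)
     \<lparr> carrier := {\<sigma> \<in> Bij F. \<sigma> \<in> ring_hom (R\<lparr>carrier := F\<rparr>) (R\<lparr>carrier := F\<rparr>) \<and>
                               (\<forall>x\<in>K. \<sigma> x = x)} \<rparr>"

abbreviation CC :: "complex ring" where
  "CC \<equiv> ring_of_type_algebra"

definition primitive_root_of_unity :: "nat \<Rightarrow> complex \<Rightarrow> bool" where
  "primitive_root_of_unity m z \<longleftrightarrow> z ^ m = 1 \<and> (\<forall>k. 0 < k \<and> k < m \<longrightarrow> z ^ k \<noteq> 1)"

text \<open>
  In the following, \<open>z\<close> stands for the chosen primitive root of unity of order \<open>p ^ n\<close>. The
  field generated by \<open>z\<close> in the complex numbers is the same as the one generated by \<open>z\<close> over
  the rationals.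
\<close>

definition F_field :: "complex \<Rightarrow> complex set" where
  "F_field z = generate_field CC {z}"

definition E_field :: "nat \<Rightarrow> complex \<Rightarrow> complex set" where
  "E_field p z =
     {x \<in> F_field z.
        \<forall>\<sigma> \<in> (THE H. subgroup H (Gal CC \<rat> (F_field z)) \<and> card H = p - 1). \<sigma> x = x}"

text \<open>
  The norm of \<open>z - 1\<close> from \<open>F_field z\<close> to \<open>E_field p z\<close>, written out: the subgroup of order
  \<open>p - 1\<close> of the units modulo \<open>p ^ n\<close> consists of the residues of \<open>j ^ (p ^ (n - 1))\<close> for
  \<open>0 < j < p\<close>.
\<close>

definition pi_elt :: "nat \<Rightarrow> nat \<Rightarrow> complex \<Rightarrow> complex" where
  "pi_elt p n z = (\<Prod>j = 1..p - 1. (z ^ (j ^ (p ^ (n - 1))) - 1))"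

end

theory Submission
  imports
    Defs
    "HOL-Number_Theory.Number_Theory"
    "Jordan_Normal_Form.Char_Poly"
begin

unbundle no fps_syntax

text \<open>
  Let \<open>z\<close> be a primitive \<open>p ^ n\<close>-th root of unity and \<open>T\<close> the subgroup of order \<open>p - 1\<close> of the units
  modulo \<open>p ^ n\<close>. Multiplying the trace of the norm of \<open>z - 1\<close> by \<open>p - 1\<close> gives the sum, over all units
  \<open>a\<close>, of the product of the \<open>z ^ (a * t) - 1\<close> with \<open>t \<in> T\<close>. The product expands into a sum over the subsets
  of \<open>T\<close>; summing over the units, that is, over all residues except the multiples of \<open>p\<close>, leaves the
  signed number of subsets whose sum vanishes modulo \<open>p ^ n\<close>, weighted by \<open>p ^ n\<close>, minus the one
  for \<open>p ^ (n - 1)\<close>. As the \<open>(p - 1)\<close>-st roots of unity in the \<open>p\<close>-adic numbers are the limits of the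
  sequences \<open>j ^ (p ^ i)\<close>, these signed numbers are \<open>(p - 1) * s_n\<close> and \<open>(p - 1) * s_(n - 1)\<close>.

  The trace is rational and lies in the ring generated by \<open>z\<close>, hence is an integer. By induction
  \<open>p ^ n * s_n\<close> is an integer, and so is \<open>(p - 1) * s_n\<close>; therefore \<open>s_n\<close> is one.
\<close>

section \<open>Integral relations between the powers of a root of unity\<close>

text \<open>\<open>field_trace\<close> is a description ranging over all rational bases of
  \<open>E\<close>, so it can only be evaluated through a quantity that mentions no basis: the sum
  over the embeddings of \<open>E\<close>. These arise from substituting \<open>z ^ a\<close> for
  \<open>z\<close>, which is well defined because \<open>z\<close> satisfies no rational relation of
  degree below \<open>(p - 1) * p ^ (n - 1)\<close>. That bound comes from total ramification:
  \<open>p\<close> is a unit of Z[z] times a power of \<open>1 - z\<close>.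

  The factor \<open>1 / (p - 1)\<close> in \<open>s_n\<close> appears because each embedding of
  \<open>E\<close> is induced by \<open>p - 1\<close> units. The exponent \<open>p ^ (n - 1)\<close>
  in \<open>pi_n\<close> is that of the term with index \<open>n - 1\<close> of the sequences
  \<open>j ^ (p ^ i)\<close>; at this index the residue modulo \<open>p ^ n\<close> is already
  final, so one and the same subset sum decides divisibility by \<open>p ^ n\<close> and by
  \<open>p ^ (n - 1)\<close>.\<close>

lemma power_mod_exponent:
  fixes z :: "'a :: monoid_mult"
  assumes "z ^ N = 1"
  shows "z ^ (i mod N) = z ^ i"
proof -
  have "z ^ i = z ^ (N * (i div N) + i mod N)" by simp
  also have "\<dots> = z ^ (i mod N)" by (simp only: power_add power_mult assms power_one mult_1)
  finally show ?thesis by simp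
qed

text \<open>The ring Z[z]. It stands in for a ring of algebraic integers: what is used are closure
  under the ring operations and the integrality of its rational elements.\<close>

definition ipoly_ring :: "complex \<Rightarrow> complex set" where
  "ipoly_ring z = range (\<lambda>f::int poly. poly (of_int_poly f) z)"

lemma ipoly_ring_add: "x \<in> ipoly_ring z \<Longrightarrow> y \<in> ipoly_ring z \<Longrightarrow> x + y \<in> ipoly_ring z"
  unfolding ipoly_ring_def by (auto simp: image_iff) (metis of_int_poly_hom.hom_add poly_add)

lemma ipoly_ring_mult: "x \<in> ipoly_ring z \<Longrightarrow> y \<in> ipoly_ring z \<Longrightarrow> x * y \<in> ipoly_ring z"
  unfolding ipoly_ring_def by (auto simp: image_iff) (metis of_int_poly_hom.hom_mult poly_mult)

lemma ipoly_ring_of_int: "of_int k \<in> ipoly_ring z"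
  unfolding ipoly_ring_def by (rule range_eqI[of _ _ "[:k:]"]) (simp add: of_int_hom.map_poly_pCons_hom)

lemma ipoly_ring_gen: "z \<in> ipoly_ring z"
  unfolding ipoly_ring_def by (rule range_eqI[of _ _ "[:0, 1:]"]) (simp add: of_int_hom.map_poly_pCons_hom)

lemma ipoly_ring_0: "0 \<in> ipoly_ring z" and ipoly_ring_1: "1 \<in> ipoly_ring z"
  using ipoly_ring_of_int[of 0 z] ipoly_ring_of_int[of 1 z] by simp_all

lemma ipoly_ring_uminus: "x \<in> ipoly_ring z \<Longrightarrow> - x \<in> ipoly_ring z"
  using ipoly_ring_mult[OF ipoly_ring_of_int[of "-1"]] by fastforce

lemma ipoly_ring_diff: "x \<in> ipoly_ring z \<Longrightarrow> y \<in> ipoly_ring z \<Longrightarrow> x - y \<in> ipoly_ring z"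
  using ipoly_ring_add[OF _ ipoly_ring_uminus] by fastforce

lemma ipoly_ring_power: "x \<in> ipoly_ring z \<Longrightarrow> x ^ k \<in> ipoly_ring z"
  by (induction k) (auto intro: ipoly_ring_1 ipoly_ring_mult)

lemma ipoly_ring_sum: "(\<And>i. i \<in> A \<Longrightarrow> f i \<in> ipoly_ring z) \<Longrightarrow> sum f A \<in> ipoly_ring z"
  by (induction A rule: infinite_finite_induct) (auto intro: ipoly_ring_0 ipoly_ring_add)

lemma ipoly_ring_prod: "(\<And>i. i \<in> A \<Longrightarrow> f i \<in> ipoly_ring z) \<Longrightarrow> prod f A \<in> ipoly_ring z"
  by (induction A rule: infinite_finite_induct) (auto intro: ipoly_ring_1 ipoly_ring_mult)

text \<open>
  Multiplication by \<open>x\<close> acts on the vector of the powers of \<open>z\<close> by an integer matrix, so \<open>x\<close> is a root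
  of its characteristic polynomial.
\<close>

lemma ipoly_ring_rational_is_int:
  assumes N: "N > 0" "z ^ N = (1::complex)" and x: "x \<in> ipoly_ring z" "x \<in> \<rat>"
  shows "x \<in> \<int>"
proof -
  obtain f :: "int poly" where f: "x = poly (of_int_poly f) z"
    using x(1) unfolding ipoly_ring_def by auto
  define d where "d = Polynomial.degree f"
  \<comment> \<open>Row \<open>j\<close> holds the coefficients of \<open>x * z ^ j\<close> after
    reducing the exponents modulo \<open>N\<close>. The powers of \<open>z\<close> may be linearly
    dependent; an eigenvector equation is enough.\<close>
  define A :: "int mat" where
    "A = mat N N (\<lambda>(j,k). \<Sum>i\<in>{i\<in>{..d}. (i + j) mod N = k}. Polynomial.coeff f i)"
  define v :: "complex vec" where "v = vec N (\<lambda>i. z ^ i)"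
  let ?A = "of_int_hom.mat_hom A :: complex mat"
  have A: "A \<in> carrier_mat N N" "?A \<in> carrier_mat N N" by (auto simp: A_def)
  note zmod = power_mod_exponent[OF N(2)]
  have fx: "x = (\<Sum>i\<le>d. of_int (Polynomial.coeff f i) * z ^ i)"
    by (simp add: f poly_altdef d_def)
  have "?A *\<^sub>v v = x \<cdot>\<^sub>v v"
  proof (rule eq_vecI)
    fix j assume "j < dim_vec (x \<cdot>\<^sub>v v)"
    then have j: "j < N" by (simp add: v_def)
    have "(?A *\<^sub>v v) $ j = (\<Sum>k<N. of_int (A $$ (j,k)) * z ^ k)"
      using A j by (auto simp: scalar_prod_def v_def lessThan_atLeast0 intro!: sum.cong)
    also have "\<dots> = (\<Sum>k<N. \<Sum>i\<in>{i\<in>{..d}. (i + j) mod N = k}. of_int (Polynomial.coeff f i) * z ^ (i + j))"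
      by (intro sum.cong refl) (auto simp: A_def j sum_distrib_right zmod[of "_ + j", symmetric] intro!: sum.cong)
    also have "\<dots> = (\<Sum>i\<le>d. of_int (Polynomial.coeff f i) * z ^ (i + j))"
      by (rule sum.group) (use N in auto)
    also have "\<dots> = x * z ^ j"
      by (simp add: fx sum_distrib_right power_add mult.assoc)
    finally show "(?A *\<^sub>v v) $ j = (x \<cdot>\<^sub>v v) $ j" by (simp add: v_def j)
  qed (use A in \<open>auto simp: v_def\<close>)
  moreover have "v \<in> carrier_vec N" "v \<noteq> 0\<^sub>v N"
  proof -
    have "v $ 0 = 1" using N by (simp add: v_def)
    then show "v \<noteq> 0\<^sub>v N" using N by auto
  qed (simp add: v_def)
  ultimately have "eigenvalue ?A x"
    unfolding eigenvalue_def eigenvector_def using A by auto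
  then have "poly (char_poly ?A) x = 0" using eigenvalue_root_char_poly[OF A(2)] by simp
  then have "poly (of_int_poly (char_poly A)) x = 0"
    unfolding of_int_hom.char_poly_hom[OF A(1)] .
  moreover have "monic (char_poly A)" using degree_monic_char_poly[OF A(1)] by simp
  ultimately have "algebraic_int x" unfolding algebraic_int_altdef_ipoly by blast
  then show ?thesis using x(2) by (rule rational_algebraic_int_is_int)
qed

text \<open>The polynomial X^N - 1 factors into the X - z^i and also into X - 1 times a geometric
  sum; cancel X - 1 and evaluate at 1.\<close>

lemma prod_one_minus_roots_of_unity:
  assumes "primitive_root_of_unity N z" "N > 0"
  shows "(\<Prod>i\<in>{1..<N}. (1 - z ^ i)) = of_nat N"
proof -
  have zN: "z ^ N = 1" and prim: "\<And>k. 0 < k \<Longrightarrow> k < N \<Longrightarrow> z ^ k \<noteq> 1"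
    using assms by (auto simp: primitive_root_of_unity_def)
  have z0: "z \<noteq> 0" using zN assms(2) by (metis power_0_left zero_neq_one less_numeral_extra(3))
  have inj: "inj_on (\<lambda>i. z ^ i) {..<N}"
  proof (rule linorder_inj_onI)
    fix i j assume ij: "i < j" "i \<in> {..<N}" "j \<in> {..<N}"
    have "z ^ j = z ^ i * z ^ (j - i)" using ij by (simp flip: power_add)
    then show "z ^ i \<noteq> z ^ j" using prim[of "j - i"] ij z0 by auto
  qed auto
  define P where "P = Polynomial.monom (1::complex) N - 1"
  define Q where "Q = (\<Prod>i<N. [:- (z ^ i), 1:])"
  have Q: "Polynomial.degree Q = N" "monic Q"
    unfolding Q_def by (subst degree_prod_eq_sum_degree, simp_all)[1] (rule monic_prod, simp)
  have P: "Polynomial.degree P = N" "monic P"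
  proof -
    have *: "Polynomial.degree (1::complex poly) < Polynomial.degree (Polynomial.monom (1::complex) N)"
      using assms(2) by (simp add: degree_monom_eq)
    show "Polynomial.degree P = N"
      unfolding P_def diff_conv_add_uminus
      using degree_add_eq_left[of "- 1 :: complex poly" "Polynomial.monom 1 N"] * by (simp add: degree_monom_eq)
    then show "monic P" using assms(2) by (simp add: P_def)
  qed
  \<comment> \<open>Two monic polynomials of degree \<open>N\<close> differ by one of smaller
    degree, which must be zero if it has the \<open>N\<close> distinct powers of \<open>z\<close> as
    roots.\<close>
  have "P - Q = 0"
  proof (rule ccontr)
    assume ne: "P - Q \<noteq> 0"
    have "Polynomial.degree (P - Q) < N"
    proof -
      have "Polynomial.degree (P - Q) \<le> N" using P Q by (simp add: degree_diff_le)
      moreover have "Polynomial.coeff (P - Q) N = 0" using P Q by simp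
      ultimately show ?thesis using ne leading_coeff_0_iff[of "P - Q"] by (cases "Polynomial.degree (P - Q) = N") auto
    qed
    moreover have "(\<lambda>i. z ^ i) ` {..<N} \<subseteq> {x. poly (P - Q) x = 0}"
    proof (rule image_subsetI, rule CollectI)
      fix i assume "i \<in> {..<N}"
      then have "poly Q (z ^ i) = 0" by (auto simp: Q_def poly_prod prod_zero_iff)
      moreover have "poly P (z ^ i) = 0"
        using power_mult[of z N i] by (simp add: P_def poly_monom zN mult.commute flip: power_mult)
      ultimately show "poly (P - Q) (z ^ i) = 0" by simp
    qed
    then have "N \<le> card {x. poly (P - Q) x = 0}"
      using card_mono[OF poly_roots_finite[OF ne]] card_image[OF inj] by (metis card_lessThan)
    ultimately show False using poly_roots_degree[OF ne] by linarith
  qed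
  then have PQ: "P = Q" by simp
  define G where "G = (\<Sum>i<N. Polynomial.monom (1::complex) i)"
  have GP: "[:- 1, 1:] * G = P"
  proof -
    have m: "Polynomial.monom (1::complex) i = [:0, 1:] ^ i" for i by (simp add: monom_altdef)
    have "[:- 1, 1:] * G = - ((1 - [:0, 1:]) * (\<Sum>i<N. [:0, 1:] ^ i))"
      by (simp add: G_def m one_pCons)
    also have "\<dots> = P" unfolding P_def m one_diff_power_eq[symmetric] by simp
    finally show ?thesis .
  qed
  have QP: "Q = [:- 1, 1:] * (\<Prod>i\<in>{1..<N}. [:- (z ^ i), 1:])"
    using assms(2) prod.atLeast_Suc_lessThan[of 0 N "\<lambda>i. [:- (z ^ i), 1:]"] by (simp add: Q_def lessThan_atLeast0)
  have "[:- 1, 1:] * G = [:- 1, 1:] * (\<Prod>i\<in>{1..<N}. [:- (z ^ i), 1:])"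
    unfolding GP PQ QP ..
  then have "G = (\<Prod>i\<in>{1..<N}. [:- (z ^ i), 1:])"
    by (subst (asm) mult_left_cancel) auto
  then have "poly G 1 = (\<Prod>i\<in>{1..<N}. (1 - z ^ i))"
    by (simp add: poly_prod)
  moreover have "poly G 1 = of_nat N"
    by (simp add: G_def poly_sum poly_monom)
  ultimately show ?thesis by simp
qed

text \<open>Each of \<open>z\<close> and \<open>z ^ a\<close> is a power of the other when
  \<open>a\<close> is invertible modulo \<open>N\<close>, so both quotients are finite geometric
  sums. These quotients are the cyclotomic units.\<close>

lemma ipoly_ring_root_of_unity_ratio:
  assumes "z ^ N = (1::complex)" "coprime a N"
  shows "\<exists>g\<in>ipoly_ring z. 1 - z = (1 - z ^ a) * g" "\<exists>h\<in>ipoly_ring z. 1 - z ^ a = (1 - z) * h"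
proof -
  have geo: "1 - w ^ k = (1 - w) * (\<Sum>i<k. w ^ i)" for w :: complex and k
    by (rule one_diff_power_eq)
  have "(\<Sum>i<a. z ^ i) \<in> ipoly_ring z"
    by (intro ipoly_ring_sum ipoly_ring_power ipoly_ring_gen)
  then show "\<exists>h\<in>ipoly_ring z. 1 - z ^ a = (1 - z) * h" using geo by blast
  obtain b where b: "[a * b = 1] (mod N)" using assms(2) cong_solve_coprime_nat by auto
  have "z ^ (a * b) = z"
    using power_mod_exponent[OF assms(1), of "a * b"] power_mod_exponent[OF assms(1), of 1] b
    unfolding cong_def by simp
  moreover have "(\<Sum>i<b. (z ^ a) ^ i) \<in> ipoly_ring z"
    by (intro ipoly_ring_sum ipoly_ring_power ipoly_ring_gen)
  ultimately show "\<exists>g\<in>ipoly_ring z. 1 - z = (1 - z ^ a) * g"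
    using geo[of "z ^ a" b] by (metis power_mult)
qed

section \<open>Residues modulo p^n and sums of powers of z\<close>

locale prime_power_root =
  fixes p n :: nat and z :: complex
  assumes prime: "prime p" and n_pos: "n \<ge> 1" and prim: "primitive_root_of_unity (p ^ n) z"
begin

abbreviation N where "N \<equiv> p ^ n"

definition units :: "nat set" where "units = {a. a < N \<and> \<not> p dvd a}"

lemma p_gt_1: "p > 1" using prime prime_gt_1_nat by blast

lemma N_pos: "N > 0" using p_gt_1 by simp

lemma N_gt_1: "N > 1" using p_gt_1 n_pos one_less_power[of p n] by simp

lemma coprime_N: "coprime a N \<longleftrightarrow> \<not> p dvd a"
proof -
  have "coprime a N \<longleftrightarrow> coprime a p" using n_pos by (simp add: coprime_power_right_iff)
  also have "\<dots> \<longleftrightarrow> \<not> p dvd a"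
    using prime_imp_coprime[OF prime, of a] p_gt_1 by (auto simp: coprime_commute coprime_absorb_left)
  finally show ?thesis .
qed

lemma z_pow_N: "z ^ N = 1" using prim by (simp add: primitive_root_of_unity_def)

lemma z_ne_1: "z \<noteq> 1"
  using prim N_gt_1 unfolding primitive_root_of_unity_def by (auto dest!: spec[of _ 1])

lemma z_pow_mod: "z ^ (k mod N) = z ^ k"
  by (rule power_mod_exponent[OF z_pow_N])

lemma z_pow_eq_1_iff: "z ^ k = 1 \<longleftrightarrow> N dvd k"
proof
  assume "z ^ k = 1"
  then have "z ^ (k mod N) = 1" by (simp add: z_pow_mod)
  moreover have "k mod N < N" using N_pos by (rule mod_less_divisor)
  ultimately have "k mod N = 0" using prim unfolding primitive_root_of_unity_def by auto
  then show "N dvd k" by (rule mod_0_imp_dvd)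
next
  assume "N dvd k"
  then have "k mod N = 0" by simp
  then show "z ^ k = 1" using z_pow_mod[of k] by simp
qed

lemma z_nonzero: "z \<noteq> 0"
  using z_pow_N N_pos by (auto simp: power_0_left)

lemma z_pow_cong: "[i = j] (mod N) \<Longrightarrow> z ^ i = z ^ j"
  unfolding cong_def by (metis z_pow_mod)

lemma z_pow_inj: "z ^ i = z ^ j \<longleftrightarrow> [i = j] (mod N)"
proof
  show "[i = j] (mod N)" if "z ^ i = z ^ j"
    using that
  proof (induction i j rule: linorder_wlog)
    case (le i j)
    have "z ^ j = z ^ i * z ^ (j - i)" using le(1) by (simp flip: power_add)
    then have "z ^ (j - i) = 1" using le z_nonzero by simp
    then show ?case using le unfolding z_pow_eq_1_iff
      using cong_altdef_nat[of i j N] cong_sym by blast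
  next
    case (sym i j)
    from sym(1)[OF sym(2)[symmetric]] show ?case by (rule cong_sym)
  qed
qed (rule z_pow_cong)

lemma sum_pow: "(\<Sum>a<N. z ^ (a * k)) = (if N dvd k then of_nat N else 0)"
proof (cases "N dvd k")
  case True
  then have "z ^ (a * k) = 1" for a by (simp add: z_pow_eq_1_iff)
  then show ?thesis using True by simp
next
  case False
  have "(1 - z ^ k) * (\<Sum>a<N. (z ^ k) ^ a) = 1 - (z ^ k) ^ N" by (rule one_diff_power_eq[symmetric])
  also have "\<dots> = 0" by (metis diff_self mult.commute power_mult power_one z_pow_N)
  finally show ?thesis using False by (simp add: z_pow_eq_1_iff mult.commute flip: power_mult)
qed

lemma N_split: "N = p * p ^ (n - 1)"
  using n_pos by (cases n) auto

lemma non_units: "{..<N} - units = (\<lambda>b. p * b) ` {..<p ^ (n - 1)}"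
proof (intro equalityI subsetI)
  fix a assume "a \<in> {..<N} - units"
  then obtain b where b: "a < N" "a = p * b" by (auto simp: units_def elim!: dvdE)
  then have "b < p ^ (n - 1)" unfolding N_split by simp
  then show "a \<in> (*) p ` {..<p ^ (n - 1)}" using b by blast
next
  fix a assume "a \<in> (*) p ` {..<p ^ (n - 1)}"
  then obtain b where "b < p ^ (n - 1)" "a = p * b" by auto
  then show "a \<in> {..<N} - units" using p_gt_1 unfolding N_split units_def by simp
qed

lemma sum_non_units: "(\<Sum>a\<in>{..<N} - units. f a) = (\<Sum>b<p ^ (n - 1). f (p * b))"
  unfolding non_units by (subst sum.reindex) (use p_gt_1 in \<open>auto simp: inj_on_def\<close>)

lemma sum_pow_p: "(\<Sum>b<p ^ (n - 1). z ^ (p * b * k)) = (if p ^ (n - 1) dvd k then of_nat (p ^ (n - 1)) else 0)"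
proof -
  have iff: "z ^ (p * k) = 1 \<longleftrightarrow> p ^ (n - 1) dvd k"
    unfolding z_pow_eq_1_iff N_split using p_gt_1 by simp
  show ?thesis
  proof (cases "p ^ (n - 1) dvd k")
    case True
    then have "z ^ (p * b * k) = 1" for b unfolding z_pow_eq_1_iff N_split by (simp add: mult.assoc)
    then show ?thesis using True by simp
  next
    case False
    have "(1 - z ^ (p * k)) * (\<Sum>b<p ^ (n - 1). (z ^ (p * k)) ^ b) = 1 - (z ^ (p * k)) ^ (p ^ (n - 1))"
      by (rule one_diff_power_eq[symmetric])
    also have "(z ^ (p * k)) ^ (p ^ (n - 1)) = 1"
      unfolding power_mult[symmetric] z_pow_eq_1_iff N_split by simp
    finally show ?thesis using False iff by (simp add: ac_simps flip: power_mult)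
  qed
qed

lemma finite_units: "finite units" and units_sub: "units \<subseteq> {..<N}"
  by (auto simp: units_def)

text \<open>The Ramanujan sum of the modulus \<open>p ^ n\<close>.\<close>

lemma sum_units_pow: "(\<Sum>a\<in>units. z ^ (a * k)) =
    of_nat (N * of_bool (N dvd k)) - of_nat (p ^ (n - 1) * of_bool (p ^ (n - 1) dvd k))"
proof -
  have "(\<Sum>a<N. z ^ (a * k)) = (\<Sum>a\<in>{..<N} - units. z ^ (a * k)) + (\<Sum>a\<in>units. z ^ (a * k))"
    using units_sub by (rule sum.subset_diff) simp
  then have "(\<Sum>a\<in>units. z ^ (a * k)) =
      (if N dvd k then of_nat N else 0) - (if p ^ (n - 1) dvd k then of_nat (p ^ (n - 1)) else 0)"
    unfolding sum_non_units sum_pow sum_pow_p by (simp only: add_diff_cancel_left')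
  then show ?thesis by (simp only: of_bool_def split: if_split) simp
qed

lemma card_units: "card units = (p - 1) * p ^ (n - 1)"
proof -
  have "card ({..<N} - units) = p ^ (n - 1)"
    unfolding non_units by (subst card_image) (use p_gt_1 in \<open>auto simp: inj_on_def\<close>)
  then have "card units = N - p ^ (n - 1)"
    using card_Diff_subset[OF finite_units units_sub] card_mono[OF _ units_sub] by simp
  then show ?thesis by (simp add: N_split diff_mult_distrib)
qed

lemma card_units_pos: "card units > 0" using p_gt_1 by (simp add: card_units)

section \<open>Total ramification of p and the degree of z\<close>

text \<open>The full products of the \<open>1 - z ^ i\<close> belonging to \<open>p ^ n\<close> and
  to \<open>p ^ (n - 1)\<close> have these numbers as values, and their quotient runs over the
  units. Equivalently, the cyclotomic polynomial takes the value \<open>p\<close> at 1.\<close>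

lemma prod_units_one_minus: "(\<Prod>a\<in>units. (1 - z ^ a)) = of_nat p"
proof -
  let ?m = "p ^ (n - 1)"
  \<comment> \<open>For \<open>n = 1\<close> this is the trivial root \<open>z ^ p = 1\<close> of
    order 1, and the product over the nonzero non-units is empty.\<close>
  have prim': "primitive_root_of_unity ?m (z ^ p)"
    unfolding primitive_root_of_unity_def power_mult[symmetric] z_pow_eq_1_iff N_split
    using p_gt_1 by (auto dest: dvd_imp_le)
  have z0: "0 \<notin> units" by (simp add: units_def)
  have set: "{1..<N} - units = (\<lambda>b. p * b) ` {1..<?m}"
  proof -
    have "{1..<N} - units = ({..<N} - units) - {0}" by auto
    then show ?thesis unfolding non_units using p_gt_1 by (auto simp: image_iff Bex_def)
  qed
  have "(\<Prod>i\<in>{1..<N} - units. (1 - z ^ i)) = (\<Prod>b\<in>{1..<?m}. (1 - (z ^ p) ^ b))"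
    unfolding set by (subst prod.reindex) (use p_gt_1 in \<open>auto simp: inj_on_def power_mult\<close>)
  also have "\<dots> = of_nat ?m"
    using prod_one_minus_roots_of_unity[OF prim'] p_gt_1 by simp
  finally have quot: "(\<Prod>i\<in>{1..<N} - units. (1 - z ^ i)) = of_nat ?m" .
  have "units \<subseteq> {1..<N}" by (auto simp: units_def Suc_le_eq intro!: Nat.gr0I)
  then have "of_nat N = of_nat ?m * (\<Prod>a\<in>units. (1 - z ^ a))"
    using prod.subset_diff[of units "{1..<N}" "\<lambda>i. 1 - z ^ i"]
    unfolding prod_one_minus_roots_of_unity[OF prim N_pos] quot by simp
  then show ?thesis unfolding N_split using p_gt_1 by simp
qed

text \<open>In the product over the units with value \<open>p\<close>, every factor
  \<open>1 - z ^ a\<close> agrees with \<open>1 - z\<close> up to a unit of Z[z]; each direction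
  uses one of the two quotients.\<close>

lemma p_associated:
  "\<exists>w\<in>ipoly_ring z. of_nat p = (1 - z) ^ card units * w"
  "\<exists>w\<in>ipoly_ring z. (1 - z) ^ card units = of_nat p * w"
proof -
  have "\<forall>a\<in>units. \<exists>g\<in>ipoly_ring z. 1 - z = (1 - z ^ a) * g"
    using ipoly_ring_root_of_unity_ratio(1)[OF z_pow_N] coprime_N unfolding units_def by blast
  then obtain g where g: "\<And>a. a \<in> units \<Longrightarrow> g a \<in> ipoly_ring z" "\<And>a. a \<in> units \<Longrightarrow> 1 - z = (1 - z ^ a) * g a"
    by metis
  have "(1 - z) ^ card units = (\<Prod>a\<in>units. (1 - z ^ a) * g a)"
    using g(2) by (simp flip: prod_constant)
  also have "\<dots> = of_nat p * (\<Prod>a\<in>units. g a)"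
    by (simp add: prod.distrib prod_units_one_minus)
  finally show "\<exists>w\<in>ipoly_ring z. (1 - z) ^ card units = of_nat p * w"
    using ipoly_ring_prod[of units g z] g(1) by blast
  have "\<forall>a\<in>units. \<exists>h\<in>ipoly_ring z. 1 - z ^ a = (1 - z) * h"
    using ipoly_ring_root_of_unity_ratio(2)[OF z_pow_N] coprime_N unfolding units_def by blast
  then obtain h where h: "\<And>a. a \<in> units \<Longrightarrow> h a \<in> ipoly_ring z" "\<And>a. a \<in> units \<Longrightarrow> 1 - z ^ a = (1 - z) * h a"
    by metis
  have "of_nat p = (\<Prod>a\<in>units. (1 - z) * h a)"
    unfolding prod_units_one_minus[symmetric] using h(2) by (intro prod.cong) auto
  also have "\<dots> = (1 - z) ^ card units * (\<Prod>a\<in>units. h a)"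
    by (simp add: prod.distrib)
  finally show "\<exists>w\<in>ipoly_ring z. of_nat p = (1 - z) ^ card units * w"
    using ipoly_ring_prod[of units h z] h(1) by blast
qed

text \<open>The power of \<open>d\<close> with exponent \<open>card units\<close> is divisible by
  \<open>p\<close> in Z[z]; the quotient is rational, hence an integer, and \<open>p\<close> is
  prime. So the ideal of \<open>1 - z\<close> meets the integers only in multiples of
  \<open>p\<close>.\<close>

lemma dvd_of_one_minus_factor:
  assumes "of_int d = (1 - z) * y" "y \<in> ipoly_ring z"
  shows "int p dvd d"
proof -
  obtain w where w: "w \<in> ipoly_ring z" "(1 - z) ^ card units = of_nat p * w"
    using p_associated(2) by blast
  have eq: "(of_int (d ^ card units) :: complex) = of_nat p * (w * y ^ card units)"
    by (simp add: assms(1) power_mult_distrib w(2))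
  have r: "w * y ^ card units \<in> ipoly_ring z"
    by (intro ipoly_ring_mult ipoly_ring_power w assms)
  have "w * y ^ card units = of_int (d ^ card units) / of_nat p"
    using eq p_gt_1 by (simp add: field_simps)
  then have "w * y ^ card units \<in> \<rat>" by (metis Rats_divide Rats_of_int Rats_of_nat)
  then have "w * y ^ card units \<in> \<int>"
    using ipoly_ring_rational_is_int[OF N_pos z_pow_N r] by blast
  then obtain k where "w * y ^ card units = of_int k" by (auto elim: Ints_cases)
  then have "(of_int (d ^ card units) :: complex) = of_int (int p * k)" using eq by simp
  then have "d ^ card units = int p * k" by (simp only: of_int_eq_iff)
  then have "int p dvd d ^ card units" by simp
  then show ?thesis using prime prime_dvd_power[of "int p"] by simp
qed

text \<open>
  Since \<open>p\<close> is associated to \<open>(1 - z) ^ card units\<close>, the first coefficient \<open>d i\<close> not divisible by \<open>p\<close>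
  would be divisible by \<open>1 - z\<close>, and hence by \<open>p\<close> after all.
\<close>

lemma int_relation_coeffs_dvd:
  fixes d :: "nat \<Rightarrow> int"
  assumes rel: "(\<Sum>i<card units. of_int (d i) * (1 - z) ^ i) = 0"
  shows "i < card units \<Longrightarrow> int p dvd d i"
proof (induction i rule: less_induct)
  case (less i)
  let ?c = "card units" and ?x = "1 - z"
  obtain w where w: "w \<in> ipoly_ring z" "of_nat p = ?x ^ ?c * w"
    using p_associated(1) by blast
  have x: "?x \<in> ipoly_ring z" by (intro ipoly_ring_diff ipoly_ring_1 ipoly_ring_gen)
  \<comment> \<open>Terms with \<open>j < i\<close> obtain enough factors \<open>1 - z\<close> from
    \<open>p\<close>, by the induction hypothesis and \<open>i < card units\<close>; terms with
    \<open>j > i\<close> carry them already.\<close>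
  have "\<exists>y\<in>ipoly_ring z. of_int (d j) * ?x ^ j = ?x ^ Suc i * y" if "j \<in> {..<?c} - {i}" for j
  proof (cases "j < i")
    case True
    then obtain e where e: "d j = int p * e" using less by auto
    have "of_int (d j) * ?x ^ j = ?x ^ ?c * (w * of_int e * ?x ^ j)"
      by (simp add: e w(2))
    also have "\<dots> = ?x ^ Suc i * (?x ^ (?c - Suc i) * (w * of_int e * ?x ^ j))"
      using less.prems power_add[of ?x "Suc i" "?c - Suc i"] by simp
    finally show ?thesis
      by (rule bexI) (intro ipoly_ring_mult ipoly_ring_power x w ipoly_ring_of_int)
  next
    case False
    then have "Suc i \<le> j" using that by auto
    then have "of_int (d j) * ?x ^ j = ?x ^ Suc i * (of_int (d j) * ?x ^ (j - Suc i))"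
      using power_add[of ?x "Suc i" "j - Suc i"] by simp
    then show ?thesis
      by (rule bexI) (intro ipoly_ring_mult ipoly_ring_power x ipoly_ring_of_int)
  qed
  then obtain y where y: "\<And>j. j \<in> {..<?c} - {i} \<Longrightarrow> y j \<in> ipoly_ring z"
     "\<And>j. j \<in> {..<?c} - {i} \<Longrightarrow> of_int (d j) * ?x ^ j = ?x ^ Suc i * y j"
    by metis
  have "0 = of_int (d i) * ?x ^ i + (\<Sum>j\<in>{..<?c} - {i}. of_int (d j) * ?x ^ j)"
    using rel less.prems by (subst (asm) sum.remove[of _ i]) auto
  also have "(\<Sum>j\<in>{..<?c} - {i}. of_int (d j) * ?x ^ j) = ?x ^ Suc i * (\<Sum>j\<in>{..<?c} - {i}. y j)"
    unfolding sum_distrib_left by (intro sum.cong refl y)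
  finally have "?x ^ i * (of_int (d i) + ?x * (\<Sum>j\<in>{..<?c} - {i}. y j)) = 0"
    by (simp add: algebra_simps)
  then have "of_int (d i) = ?x * (- (\<Sum>j\<in>{..<?c} - {i}. y j))"
    using z_ne_1 by (simp add: eq_neg_iff_add_eq_0)
  then show ?case
    by (rule dvd_of_one_minus_factor) (intro ipoly_ring_uminus ipoly_ring_sum y)
qed

text \<open>This lower bound for the degree of \<open>z\<close> amounts to irreducibility of the
  cyclotomic polynomial. A primitive polynomial of small degree with root \<open>z\<close>, expanded
  in powers of \<open>1 - X\<close>, would have all coefficients divisible by \<open>p\<close>,
  against primitivity.\<close>

lemma int_poly_root_eq_0:
  fixes f :: "int poly"
  assumes "Polynomial.degree f < card units" "poly (of_int_poly f) z = 0"
  shows "f = 0"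
proof (rule ccontr)
  assume f: "f \<noteq> 0"
  define g where "g = primitive_part f"
  have fg: "f = Polynomial.smult (content f) g" by (simp add: g_def)
  have g0: "poly (of_int_poly g) z = 0"
    using assms(2) f by (subst (asm) fg) (simp add: hom_distribs)
  have deg: "Polynomial.degree g < card units" using assms(1) by (simp add: g_def)
  \<comment> \<open>Substituting \<open>1 - X\<close> is an involution preserving the degree. It
    turns a relation between powers of \<open>z\<close> into one between powers of
    \<open>1 - z\<close>, and divisibility by \<open>p\<close> is carried back to
    \<open>g\<close>.\<close>
  define h where "h = pcompose g [:1, -1:]"
  have gh: "g = pcompose h [:1, -1:]"
    by (simp add: h_def pcompose_assoc[symmetric] pcompose_pCons)
  have deg_h: "Polynomial.degree h < card units"
    using deg by (simp add: h_def)
  have "poly (of_int_poly h) (1 - z) = 0"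
    using g0 by (simp add: h_def of_int_hom.map_poly_pcompose poly_pcompose of_int_hom.map_poly_pCons_hom)
  then have "(\<Sum>i<card units. of_int (Polynomial.coeff h i) * (1 - z) ^ i) = 0"
    unfolding poly_altdef using deg_h
    by (subst sum.mono_neutral_right[of "{..<card units}" "{..Polynomial.degree h}"]) (auto simp: coeff_eq_0)
  then have "int p dvd Polynomial.coeff h i" for i
    using int_relation_coeffs_dvd[of "Polynomial.coeff h" i] deg_h coeff_eq_0[of h i] by force
  then have "[:int p:] dvd h" by (simp add: const_poly_dvd_iff)
  then obtain k where "h = [:int p:] * k" by (elim dvdE)
  then have "g = [:int p:] * pcompose k [:1, -1:]" by (simp add: gh pcompose_smult)
  then have "int p dvd content g" by (simp add: const_poly_dvd_iff_dvd_content)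
  then show False using f p_gt_1 prime by (simp add: g_def)
qed

end

section \<open>Automorphisms of the cyclotomic field\<close>

interpretation of_rat_poly_hom: map_poly_idom_hom "of_rat :: rat \<Rightarrow> complex" ..

definition reval :: "rat poly \<Rightarrow> complex \<Rightarrow> complex" where
  "reval f w = poly (map_poly of_rat f) w"

lemma reval_altdef: "reval f w = (\<Sum>i\<le>Polynomial.degree f. of_rat (Polynomial.coeff f i) * w ^ i)"
  unfolding reval_def poly_altdef by simp

lemma reval_add: "reval (f + g) w = reval f w + reval g w"
  by (simp add: reval_def of_rat_poly_hom.hom_add)

lemma reval_diff: "reval (f - g) w = reval f w - reval g w"
  by (simp add: reval_def of_rat_poly_hom.hom_minus)

lemma reval_mult: "reval (f * g) w = reval f w * reval g w"
  by (simp add: reval_def of_rat_poly_hom.hom_mult)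

lemma reval_const: "reval [:c:] w = of_rat c"
  by (simp add: reval_def of_rat_hom.map_poly_pCons_hom)

lemma reval_0: "reval 0 w = 0"
  by (simp add: reval_def)

lemma reval_X: "reval [:0, 1:] w = w"
  by (simp add: reval_def of_rat_hom.map_poly_pCons_hom)

lemma reval_monom: "reval (Polynomial.monom c k) w = of_rat c * w ^ k"
  by (simp add: reval_def map_poly_monom poly_monom)

lemma reval_sum: "reval (sum f A) w = (\<Sum>i\<in>A. reval (f i) w)"
  by (induction A rule: infinite_finite_induct) (simp_all add: reval_0 reval_add)

lemma reval_pcompose: "reval (pcompose f g) w = reval f (reval g w)"
  by (simp add: reval_def of_rat_hom.map_poly_pcompose poly_pcompose)

lemma common_denominator:
  assumes "finite (A :: rat set)"
  shows "\<exists>d::int. d > 0 \<and> (\<forall>x\<in>A. of_int d * x \<in> \<int>)"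
  using assms
proof induction
  case (insert x A)
  then obtain d :: int where d: "d > 0" "\<forall>x\<in>A. of_int d * x \<in> \<int>" by blast
  obtain a b where ab: "quotient_of x = (a, b)" by fastforce
  then have b: "b > 0" "x = of_int a / of_int b"
    using quotient_of_denom_pos quotient_of_div by blast+
  have "of_int (b * d) * y \<in> \<int>" if "y \<in> insert x A" for y
  proof (cases "y = x")
    case True
    then have "of_int (b * d) * y = of_int (d * a)" using b by simp
    then show ?thesis by (metis Ints_of_int)
  next
    case False
    then have "of_int d * y \<in> \<int>" using that d by blast
    then show ?thesis by (simp add: mult.assoc)
  qed
  then show ?case using d b by (intro exI[of _ "b * d"]) simp
qed (auto intro: exI[of _ 1])

section \<open>The cyclotomic polynomial and conjugates of z\<close>

context prime_power_root
begin

lemma rat_poly_root_eq_0: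
  assumes "Polynomial.degree f < card units" "reval f z = 0"
  shows "f = 0"
proof -
  obtain d :: int where d: "d > 0" "\<And>i. i \<le> Polynomial.degree f \<Longrightarrow> of_int d * Polynomial.coeff f i \<in> \<int>"
    using common_denominator[of "Polynomial.coeff f ` {..Polynomial.degree f}"] by auto
  have d': "of_int d * Polynomial.coeff f i \<in> \<int>" for i
    using d(2)[of i] coeff_eq_0[of f i] by (cases "i \<le> Polynomial.degree f") auto
  \<comment> \<open>After scaling by \<open>d\<close> the coefficients are integral rationals, so
    \<open>floor\<close> merely changes their type.\<close>
  define g where "g = map_poly floor (Polynomial.smult (of_int d) f)"
  have cg: "of_int (Polynomial.coeff g i) = of_int d * Polynomial.coeff f i" for i
    using d'[of i] by (auto simp: g_def coeff_map_poly elim!: Ints_cases)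
  have "Polynomial.degree g \<le> Polynomial.degree f"
    unfolding g_def by (rule order_trans[OF map_poly_degree_leq]) (use d in auto)
  have "of_int_poly g = Polynomial.smult (of_int d) (map_poly of_rat f :: complex poly)"
  proof (rule poly_eqI)
    fix i
    have "(of_int (Polynomial.coeff g i) :: complex) = of_rat (of_int (Polynomial.coeff g i))" by simp
    also have "\<dots> = of_int d * of_rat (Polynomial.coeff f i)" unfolding cg by (simp add: of_rat_mult)
    finally show "Polynomial.coeff (of_int_poly g) i = Polynomial.coeff (Polynomial.smult (of_int d) (map_poly of_rat f :: complex poly)) i"
      by simp
  qed
  then have "poly (of_int_poly g) z = 0" using assms(2) by (simp add: reval_def)
  then have "g = 0"
    using int_poly_root_eq_0[of g] assms(1) \<open>Polynomial.degree g \<le> Polynomial.degree f\<close> by simp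
  then show ?thesis using cg d by (auto intro!: poly_eqI)
qed

text \<open>The quotient of X^(p^n) - 1 by X^(p^(n-1)) - 1, written as a geometric sum.\<close>

definition cyclotomic :: "rat poly" where
  "cyclotomic = (\<Sum>k<p. Polynomial.monom 1 (k * p ^ (n - 1)))"

lemma degree_cyclotomic: "Polynomial.degree cyclotomic = card units"
proof -
  let ?m = "p ^ (n - 1)"
  obtain q where q: "p = Suc q" using p_gt_1 by (cases p) auto
  have mono: "k * ?m \<le> q * ?m" if "k < p" for k using that q by simp
  have "Polynomial.degree cyclotomic \<le> q * ?m"
    unfolding cyclotomic_def
    by (rule degree_sum_le) (use mono in \<open>auto intro: order_trans[OF degree_monom_le]\<close>)
  moreover have "Polynomial.coeff cyclotomic (q * ?m) = (\<Sum>k<p. of_bool (k = q))"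
    unfolding cyclotomic_def Polynomial.coeff_sum using p_gt_1 by (intro sum.cong) auto
  then have "Polynomial.coeff cyclotomic (q * ?m) = 1" using q by (simp add: of_bool_def)
  ultimately have "Polynomial.degree cyclotomic = q * ?m"
    by (metis le_antisym le_degree zero_neq_one)
  also have "\<dots> = card units" unfolding card_units using q by simp
  finally show ?thesis .
qed

lemma reval_cyclotomic: "\<not> p dvd a \<Longrightarrow> reval cyclotomic (z ^ a) = 0"
proof -
  assume a: "\<not> p dvd a"
  let ?w = "z ^ (a * p ^ (n - 1))"
  have "?w \<noteq> 1" unfolding z_pow_eq_1_iff N_split using a p_gt_1 by simp
  have "reval cyclotomic (z ^ a) = (\<Sum>k<p. ?w ^ k)"
    by (simp add: cyclotomic_def reval_sum reval_monom mult_ac flip: power_mult)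
  moreover have "(1 - ?w) * (\<Sum>k<p. ?w ^ k) = 1 - ?w ^ p" by (rule one_diff_power_eq[symmetric])
  moreover have "?w ^ p = 1"
    unfolding power_mult[symmetric] z_pow_eq_1_iff N_split by simp
  ultimately show ?thesis using \<open>?w \<noteq> 1\<close> by simp
qed

text \<open>The remainder of \<open>f\<close> modulo \<open>cyclotomic\<close> has degree below
  \<open>card units\<close> and still vanishes at \<open>z\<close>, so it is zero. Thus
  \<open>f\<close> is a multiple of \<open>cyclotomic\<close>, which has every \<open>z ^ a\<close>
  with \<open>a\<close> prime to \<open>p\<close> as a root.\<close>

lemma reval_conjugate_eq_0:
  assumes "reval f z = 0" "\<not> p dvd a"
  shows "reval f (z ^ a) = 0"
proof -
  have split: "reval f w = reval cyclotomic w * reval (f div cyclotomic) w + reval (f mod cyclotomic) w" for w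
    unfolding reval_mult[symmetric] reval_add[symmetric] by simp
  have "\<not> p dvd 1" using p_gt_1 by simp
  then have "reval (f mod cyclotomic) z = 0"
    using split[of z] assms(1) reval_cyclotomic[of 1] by simp
  moreover have "cyclotomic \<noteq> 0" using degree_cyclotomic card_units_pos by auto
  then have "Polynomial.degree (f mod cyclotomic) < card units"
    using degree_mod_less'[of cyclotomic f] degree_cyclotomic card_units_pos
    by (cases "f mod cyclotomic = 0") auto
  ultimately have "f mod cyclotomic = 0" by (rule rat_poly_root_eq_0[rotated])
  then show ?thesis using split[of "z ^ a"] reval_cyclotomic[OF assms(2)] by (simp add: reval_0)
qed

lemma reval_conjugate_cong:
  assumes "reval f z = reval g z" "\<not> p dvd a"
  shows "reval f (z ^ a) = reval g (z ^ a)"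
  using reval_conjugate_eq_0[of "f - g" a] assms by (simp add: reval_diff)

section \<open>The field Q(z) and the substitutions of z^a for z\<close>

definition K :: "complex set" where "K = range (\<lambda>f. reval f z)"

text \<open>On \<open>K\<close>, and for \<open>a\<close> prime to \<open>p\<close>, the choice of
  the representing polynomial is immaterial by \<open>reval_conjugate_cong\<close>; nothing is
  claimed elsewhere.\<close>

definition aut :: "nat \<Rightarrow> complex \<Rightarrow> complex" where
  "aut a x = reval (SOME f. reval f z = x) (z ^ a)"

lemma K_cases: "x \<in> K \<Longrightarrow> (\<And>f. x = reval f z \<Longrightarrow> P) \<Longrightarrow> P"
  by (auto simp: K_def)

lemma reval_in_K [simp]: "reval f z \<in> K" by (auto simp: K_def)

lemma aut_reval: "\<not> p dvd a \<Longrightarrow> aut a (reval f z) = reval f (z ^ a)"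
  unfolding aut_def
  by (rule reval_conjugate_cong) (rule someI[of "\<lambda>g. reval g z = reval f z" f], simp_all)

lemma aut_cong: "[a = b] (mod N) \<Longrightarrow> aut a x = aut b x"
  unfolding aut_def using z_pow_cong by simp

lemma K_add: "x \<in> K \<Longrightarrow> y \<in> K \<Longrightarrow> x + y \<in> K"
  by (auto elim!: K_cases simp flip: reval_add)

lemma K_diff: "x \<in> K \<Longrightarrow> y \<in> K \<Longrightarrow> x - y \<in> K"
  by (auto elim!: K_cases simp flip: reval_diff)

lemma K_mult: "x \<in> K \<Longrightarrow> y \<in> K \<Longrightarrow> x * y \<in> K"
  by (auto elim!: K_cases simp flip: reval_mult)

lemma K_of_rat: "of_rat q \<in> K"
  using reval_in_K[of "[:q:]"] by (simp only: reval_const)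

lemma K_0: "0 \<in> K" and K_1: "1 \<in> K"
  using K_of_rat[of 0] K_of_rat[of 1] by simp_all

lemma K_power: "x \<in> K \<Longrightarrow> x ^ k \<in> K"
  by (induction k) (auto intro: K_1 K_mult)

lemma K_sum: "(\<And>i. i \<in> A \<Longrightarrow> f i \<in> K) \<Longrightarrow> sum f A \<in> K"
  by (induction A rule: infinite_finite_induct) (auto intro: K_0 K_add)

lemma K_prod: "(\<And>i. i \<in> A \<Longrightarrow> f i \<in> K) \<Longrightarrow> prod f A \<in> K"
  by (induction A rule: infinite_finite_induct) (auto intro: K_1 K_mult)

lemma K_z: "z \<in> K" using reval_in_K[of "[:0, 1:]"] by (simp only: reval_X)

lemma reval_pow_eq: "reval f (w ^ a) = reval (pcompose f (Polynomial.monom 1 a)) w"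
  by (simp add: reval_pcompose reval_monom)

lemma aut_in_K: "x \<in> K \<Longrightarrow> \<not> p dvd a \<Longrightarrow> aut a x \<in> K"
  by (auto elim!: K_cases simp: aut_reval reval_pow_eq)

lemma aut_add: "x \<in> K \<Longrightarrow> y \<in> K \<Longrightarrow> \<not> p dvd a \<Longrightarrow> aut a (x + y) = aut a x + aut a y"
  by (auto elim!: K_cases simp: aut_reval simp flip: reval_add)

lemma aut_mult: "x \<in> K \<Longrightarrow> y \<in> K \<Longrightarrow> \<not> p dvd a \<Longrightarrow> aut a (x * y) = aut a x * aut a y"
  by (auto elim!: K_cases simp: aut_reval simp flip: reval_mult)

lemma aut_of_rat: "\<not> p dvd a \<Longrightarrow> aut a (of_rat q) = of_rat q"
  using aut_reval[of a "[:q:]"] unfolding reval_const .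

lemma aut_0: "\<not> p dvd a \<Longrightarrow> aut a 0 = 0" and aut_1: "\<not> p dvd a \<Longrightarrow> aut a 1 = 1"
  using aut_of_rat[of a 0] aut_of_rat[of a 1] by simp_all

lemma aut_z: "\<not> p dvd a \<Longrightarrow> aut a z = z ^ a"
  using aut_reval[of a "[:0, 1:]"] unfolding reval_X .

lemma aut_power: "x \<in> K \<Longrightarrow> \<not> p dvd a \<Longrightarrow> aut a (x ^ k) = aut a x ^ k"
  by (induction k) (simp_all add: aut_1 aut_mult K_power)

lemma aut_sum: "(\<And>i. i \<in> A \<Longrightarrow> f i \<in> K) \<Longrightarrow> \<not> p dvd a \<Longrightarrow> aut a (sum f A) = (\<Sum>i\<in>A. aut a (f i))"
  by (induction A rule: infinite_finite_induct) (simp_all add: aut_0 aut_add K_sum)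

lemma aut_prod: "(\<And>i. i \<in> A \<Longrightarrow> f i \<in> K) \<Longrightarrow> \<not> p dvd a \<Longrightarrow> aut a (prod f A) = (\<Prod>i\<in>A. aut a (f i))"
  by (induction A rule: infinite_finite_induct) (simp_all add: aut_1 aut_mult K_prod)

lemma not_dvd_mult: "\<not> p dvd a \<Longrightarrow> \<not> p dvd b \<Longrightarrow> \<not> p dvd a * b"
  using prime prime_dvd_mult_iff by blast

lemma not_dvd_mod_N: "\<not> p dvd a mod N \<longleftrightarrow> \<not> p dvd a"
  by (simp add: N_split dvd_mod_iff)

lemma aut_conj: "x \<in> K \<Longrightarrow> \<not> p dvd a \<Longrightarrow> \<not> p dvd b \<Longrightarrow> aut a (aut b x) = aut (a * b) x"
proof (elim K_cases)
  fix f assume ab: "\<not> p dvd a" "\<not> p dvd b" and x: "x = reval f z"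
  have "aut a (aut b x) = reval (pcompose f (Polynomial.monom 1 b)) (z ^ a)"
    unfolding x aut_reval[OF ab(2)] reval_pow_eq[of f z b] by (rule aut_reval[OF ab(1)])
  also have "\<dots> = reval f (z ^ (a * b))"
    by (simp add: reval_pcompose reval_monom power_mult)
  also have "\<dots> = aut (a * b) x"
    unfolding x aut_reval[OF not_dvd_mult[OF ab]] ..
  finally show ?thesis .
qed

lemma aut_one: "x \<in> K \<Longrightarrow> aut 1 x = x"
proof (elim K_cases)
  fix f assume "x = reval f z"
  moreover have "\<not> p dvd 1" using p_gt_1 by simp
  ultimately show "aut 1 x = x" by (simp only: aut_reval power_one_right not_False_eq_True)
qed

lemma units_inverse:
  assumes "\<not> p dvd a"
  obtains b where "b \<in> units" "[a * b = 1] (mod N)"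
proof -
  obtain b where b: "[a * b = 1] (mod N)"
    using cong_solve_coprime_nat[OF iffD2[OF coprime_N assms]] unfolding One_nat_def by blast
  then have ab: "[a * (b mod N) = 1] (mod N)" unfolding cong_def mod_mult_right_eq .
  have "\<not> p dvd b mod N"
  proof
    assume "p dvd b mod N"
    then have "p dvd a * (b mod N)" by simp
    moreover have "[a * (b mod N) = 1] (mod p)"
      using cong_dvd_modulus_nat[OF ab, of p] unfolding N_split by simp
    ultimately have "p dvd 1" using cong_dvd_iff by blast
    then show False using p_gt_1 by simp
  qed
  then have "b mod N \<in> units" unfolding units_def using N_pos mod_less_divisor by blast
  then show ?thesis using that ab by blast
qed

lemma aut_inverse: "x \<in> K \<Longrightarrow> \<not> p dvd a \<Longrightarrow> \<not> p dvd b \<Longrightarrow> [a * b = 1] (mod N) \<Longrightarrow> aut a (aut b x) = x"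
  by (simp only: aut_conj aut_cong[of "a * b" 1 x] aut_one not_False_eq_True)

lemma units_not_dvd: "a \<in> units \<Longrightarrow> \<not> p dvd a" by (simp add: units_def)

lemma one_in_units: "1 \<in> units"
proof -
  have "\<not> p dvd 1" using p_gt_1 by simp
  then show ?thesis unfolding units_def using N_gt_1 by blast
qed

lemma bij_units:
  assumes "\<not> p dvd b"
  shows "bij_betw (\<lambda>a. b * a mod N) units units"
proof (rule bij_betw_imageI)
  show inj: "inj_on (\<lambda>a. b * a mod N) units"
  proof (rule inj_onI)
    fix x y assume xy: "x \<in> units" "y \<in> units" "b * x mod N = b * y mod N"
    then have "[b * x = b * y] (mod N)" by (simp add: cong_def)
    moreover have "coprime b N" using assms coprime_N by blast
    ultimately have "[x = y] (mod N)" using cong_mult_lcancel_nat[of b N x y] by blast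
    then show "x = y" using xy by (auto simp: units_def cong_def)
  qed
  have "(\<lambda>a. b * a mod N) ` units \<subseteq> units"
  proof (rule image_subsetI)
    fix a assume "a \<in> units"
    then have "\<not> p dvd b * a mod N"
      unfolding not_dvd_mod_N using not_dvd_mult[OF assms units_not_dvd] by blast
    then show "b * a mod N \<in> units" using N_pos unfolding units_def by simp
  qed
  then show "(\<lambda>a. b * a mod N) ` units = units"
    using endo_inj_surj[OF finite_units _ inj] by blast
qed

text \<open>By linearity it suffices to sum the conjugates of powers of \<open>z\<close>, and these
  sums are Ramanujan sums.\<close>

lemma sum_aut_rational:
  assumes "x \<in> K"
  shows "(\<Sum>a\<in>units. aut a x) \<in> \<rat>"
proof -
  obtain f where f: "x = reval f z" using assms by (rule K_cases)
  have "(\<Sum>a\<in>units. aut a x) = (\<Sum>a\<in>units. \<Sum>i\<le>Polynomial.degree f. of_rat (Polynomial.coeff f i) * z ^ (a * i))"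
    unfolding f
    by (intro sum.cong refl, subst aut_reval) (simp_all add: units_not_dvd reval_altdef power_mult)
  also have "\<dots> = (\<Sum>i\<le>Polynomial.degree f. of_rat (Polynomial.coeff f i) * (\<Sum>a\<in>units. z ^ (a * i)))"
    by (subst sum.swap) (simp add: sum_distrib_left)
  also have "\<dots> \<in> \<rat>"
    unfolding sum_units_pow by (intro Rats_sum Rats_mult Rats_diff Rats_of_nat Rats_of_rat)
  finally show ?thesis .
qed

text \<open>Such an \<open>x\<close> is the average of its conjugates.\<close>

lemma fixed_rational:
  assumes "x \<in> K" "\<And>a. a \<in> units \<Longrightarrow> aut a x = x"
  shows "x \<in> \<rat>"
proof -
  have "(\<Sum>a\<in>units. aut a x) = of_nat (card units) * x" using assms(2) by simp
  then have "x = (\<Sum>a\<in>units. aut a x) / of_nat (card units)" using card_units_pos by simp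
  also have "\<dots> \<in> \<rat>" by (intro Rats_divide Rats_of_nat sum_aut_rational assms)
  finally show ?thesis .
qed

lemma aut_eq_0_iff: "x \<in> K \<Longrightarrow> \<not> p dvd a \<Longrightarrow> aut a x = 0 \<longleftrightarrow> x = 0"
proof
  assume x: "x \<in> K" "\<not> p dvd a" "aut a x = 0"
  obtain b where b: "b \<in> units" "[a * b = 1] (mod N)" using units_inverse[OF x(2)] .
  then have "aut b (aut a x) = x"
    using aut_inverse[OF x(1) units_not_dvd[OF b(1)] x(2)] by (simp add: mult.commute)
  then show "x = 0" unfolding x(3) aut_0[OF units_not_dvd[OF b(1)]] by simp
qed (simp add: aut_0)

text \<open>The product of all conjugates of \<open>x\<close> is rational, and \<open>x\<close> divides it in \<open>K\<close>.\<close>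

lemma K_inverse:
  assumes "x \<in> K" "x \<noteq> 0"
  shows "inverse x \<in> K"
proof -
  define P where "P = (\<Prod>a\<in>units. aut a x)"
  define Q where "Q = (\<Prod>a\<in>units - {1}. aut a x)"
  have PQ: "P = x * Q" unfolding P_def Q_def
    unfolding prod.remove[OF finite_units one_in_units, of "\<lambda>a. aut a x"] aut_one[OF assms(1)] ..
  have K: "P \<in> K" "Q \<in> K" unfolding P_def Q_def
    by (intro K_prod aut_in_K assms; simp add: units_not_dvd)+
  have "P \<in> \<rat>"
  proof (rule fixed_rational[OF K(1)])
    fix b assume b: "b \<in> units"
    have "aut b P = (\<Prod>a\<in>units. aut b (aut a x))"
      unfolding P_def by (rule aut_prod; intro aut_in_K assms units_not_dvd b)
    also have "\<dots> = (\<Prod>a\<in>units. aut (b * a mod N) x)"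
    proof (rule prod.cong[OF refl])
      fix a assume "a \<in> units"
      then have "aut b (aut a x) = aut (b * a) x"
        using aut_conj[OF assms(1) units_not_dvd[OF b] units_not_dvd] by blast
      also have "\<dots> = aut (b * a mod N) x" by (rule aut_cong) (simp add: cong_def)
      finally show "aut b (aut a x) = aut (b * a mod N) x" .
    qed
    also have "\<dots> = P" unfolding P_def
      using prod.reindex_bij_betw[OF bij_units[OF units_not_dvd[OF b]], of "\<lambda>a. aut a x"] by simp
    finally show "aut b P = P" .
  qed
  then obtain q where q: "P = of_rat q" by (rule Rats_cases)
  have "P \<noteq> 0" unfolding P_def prod_zero_iff[OF finite_units]
    using aut_eq_0_iff[OF assms(1) units_not_dvd] assms(2) by blast
  have "inverse x = Q * inverse P" using PQ \<open>P \<noteq> 0\<close> by simp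
  also have "\<dots> = Q * of_rat (inverse q)" using q by (simp add: of_rat_inverse)
  also have "\<dots> \<in> K" by (intro K_mult K K_of_rat)
  finally show ?thesis .
qed

end

section \<open>The Galois group and its subgroup of order p - 1\<close>

text \<open>In \<open>a ^ p - b ^ p = (a - b) * S\<close> the cofactor \<open>S\<close> is congruent
  to \<open>p * b ^ (p - 1)\<close>, hence to 0, modulo \<open>p\<close>. This yields the additional
  factor \<open>p\<close>.\<close>

lemma cong_prime_power_lift:
  fixes a b :: int
  assumes "[a = b] (mod int p ^ k)" "k \<ge> 1"
  shows "[a ^ p = b ^ p] (mod int p ^ Suc k)"
proof -
  have ab: "[a = b] (mod int p)"
    using assms dvd_trans[of "int p" "int p ^ k" "a - b"] by (simp add: cong_iff_dvd_diff dvd_power)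
  have "[(\<Sum>i<p. b ^ (p - Suc i) * a ^ i) = (\<Sum>i<p. b ^ (p - Suc i) * b ^ i)] (mod int p)"
    by (intro cong_sum cong_mult cong_pow ab cong_refl)
  also have "(\<Sum>i<p. b ^ (p - Suc i) * b ^ i) = (\<Sum>i<p. b ^ (p - 1))"
    by (intro sum.cong refl) (simp flip: power_add)
  also have "[\<dots> = 0] (mod int p)" by (simp add: cong_0_iff)
  finally have "int p dvd (\<Sum>i<p. b ^ (p - Suc i) * a ^ i)" by (simp add: cong_0_iff)
  moreover have "int p ^ k dvd a - b" using assms(1) by (simp add: cong_iff_dvd_diff)
  ultimately have "int p ^ k * int p dvd (a - b) * (\<Sum>i<p. b ^ (p - Suc i) * a ^ i)"
    by (intro mult_dvd_mono)
  also have "\<dots> = a ^ p - b ^ p" by (rule power_diff_sumr2[symmetric])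
  finally show ?thesis by (simp add: cong_iff_dvd_diff mult.commute)
qed

text \<open>The residue of \<open>a\<close> modulo \<open>p\<close> thus determines
  \<open>a ^ (p ^ k)\<close> modulo \<open>p ^ (k + 1)\<close>. Both the Teichmueller
  representatives modulo \<open>p ^ n\<close> and the p-adic convergence of
  \<open>j ^ (p ^ i)\<close> rest on this.\<close>

lemma cong_pow_prime_power:
  fixes a b :: int
  assumes "[a = b] (mod int p)"
  shows "[a ^ (p ^ k) = b ^ (p ^ k)] (mod int p ^ Suc k)"
proof (induction k)
  case (Suc k)
  then have "[(a ^ (p ^ k)) ^ p = (b ^ (p ^ k)) ^ p] (mod int p ^ Suc (Suc k))"
    by (rule cong_prime_power_lift) simp
  then show ?case by (simp add: power_mult[symmetric] mult.commute)
qed (use assms in simp)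

lemma cong_pow_prime_power_nat:
  fixes a b :: nat
  assumes "[a = b] (mod p)"
  shows "[a ^ (p ^ k) = b ^ (p ^ k)] (mod p ^ Suc k)"
  using cong_pow_prime_power[of "int a" "int b" p k] assms
  by (simp only: cong_int_iff flip: of_nat_power)

lemma cong_pow_p_power_self:
  fixes a :: nat
  assumes "prime p"
  shows "[a ^ (p ^ k) = a] (mod p)"
proof (induction k)
  case (Suc k)
  have "[(a ^ (p ^ k)) ^ p = a ^ (p ^ k)] (mod p)"
  proof (cases "p dvd a ^ (p ^ k)")
    case True
    moreover have "p dvd (a ^ (p ^ k)) ^ p"
      using dvd_power[of p "a ^ (p ^ k)"] True prime_gt_0_nat[OF assms] dvd_trans by blast
    ultimately show ?thesis unfolding cong_def dvd_eq_mod_eq_0 by simp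
  next
    case False
    have "[(a ^ (p ^ k)) ^ (p - 1) * a ^ (p ^ k) = 1 * a ^ (p ^ k)] (mod p)"
      by (intro cong_mult fermat_theorem assms False cong_refl)
    then show ?thesis using prime_gt_0_nat[OF assms] by (cases p) (simp_all add: mult.commute)
  qed
  then have "[a ^ (p ^ k * p) = a] (mod p)" unfolding power_mult using Suc by (rule cong_trans)
  then show ?case by (simp add: mult.commute)
qed simp

section \<open>The complex numbers as a ring structure\<close>

interpretation CC: Ring.cring CC by (rule cring_from_type_algebra)

lemma CC_simps: "\<zero>\<^bsub>CC\<^esub> = 0" "\<one>\<^bsub>CC\<^esub> = 1" "x \<otimes>\<^bsub>CC\<^esub> y = x * y" "x \<oplus>\<^bsub>CC\<^esub> y = x + y"
    "carrier CC = UNIV"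
  by (auto simp: ring_of_type_algebra_def)

lemma CC_uminus: "\<ominus>\<^bsub>CC\<^esub> x = - x"
  using CC.minus_equality[of "- x" x] by (simp add: CC_simps)

lemma CC_inv: "x \<noteq> 0 \<Longrightarrow> inv\<^bsub>CC\<^esub> x = inverse x"
  using CC.comm_inv_char[of x "inverse x"] by (simp add: CC_simps)

lemma CC_finsum: "finite A \<Longrightarrow> finsum CC f A = sum f A"
  by (induction A rule: finite_induct) (simp_all add: CC_simps)

lemma CC_combine: "length Ks = length Us \<Longrightarrow> CC.combine Ks Us = (\<Sum>i<length Us. Ks ! i * Us ! i)"
  by (induction Ks Us rule: list_induct2) (simp_all add: CC_simps sum.lessThan_Suc_shift del: sum.lessThan_Suc)

lemma subfield_Rats: "subfield \<rat> CC"
proof (rule field.subfieldI'[OF field_from_type_algebra])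
  show "subring \<rat> CC"
    by (rule CC.subringI) (auto simp: CC_simps CC_uminus)
  show "inv\<^bsub>CC\<^esub> k \<in> \<rat>" if "k \<in> \<rat> - {\<zero>\<^bsub>CC\<^esub>}" for k
    using that by (auto simp: CC_simps CC_inv)
qed

section \<open>Teichmueller representatives modulo p^n\<close>

context prime_power_root
begin

text \<open>The subgroup of order \<open>p - 1\<close>, described as the kernel of the power map
  with exponent \<open>p - 1\<close>; its order follows from \<open>bij_teich\<close>.\<close>

definition teich :: "nat set" where "teich = {a \<in> units. [a ^ (p - 1) = 1] (mod N)}"

lemma teich_units: "a \<in> teich \<Longrightarrow> a \<in> units" by (simp add: teich_def)

lemma teich_not_dvd: "a \<in> teich \<Longrightarrow> \<not> p dvd a" by (simp add: teich_def units_def)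

text \<open>The image of \<open>j\<close> is congruent to \<open>j\<close> modulo \<open>p\<close>,
  which gives injectivity. That it lies in \<open>teich\<close> is Euler's theorem, as
  \<open>totient N = p ^ (n - 1) * (p - 1)\<close>.\<close>

lemma bij_teich: "bij_betw (\<lambda>j. j ^ (p ^ (n - 1)) mod N) {1..p - 1} teich"
proof (rule bij_betw_imageI)
  let ?e = "p ^ (n - 1)"
  have modp: "[j ^ ?e mod N = j] (mod p)" for j
  proof -
    have "j ^ ?e mod N mod p = j ^ ?e mod p" unfolding N_split by (rule mod_mod_cancel) simp
    then show ?thesis using cong_pow_p_power_self[OF prime, of j "n - 1"] by (simp only: cong_def)
  qed
  show "inj_on (\<lambda>j. j ^ ?e mod N) {1..p - 1}"
  proof (rule inj_onI)
    fix i j assume ij: "i \<in> {1..p - 1}" "j \<in> {1..p - 1}" "i ^ ?e mod N = j ^ ?e mod N"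
    then have "[i = j] (mod p)" using modp[of i] modp[of j] unfolding cong_def by simp
    then show "i = j" using ij p_gt_1 by (auto simp: cong_def)
  qed
  show "(\<lambda>j. j ^ ?e mod N) ` {1..p - 1} = teich"
  proof (intro equalityI subsetI)
    fix a assume "a \<in> (\<lambda>j. j ^ ?e mod N) ` {1..p - 1}"
    then obtain j where j: "j \<in> {1..p - 1}" "a = j ^ ?e mod N" by blast
    have "\<not> p dvd j" using j p_gt_1 by (auto dest: dvd_imp_le)
    then have "\<not> p dvd a" unfolding j(2) using modp[of j] cong_dvd_iff by blast
    moreover have "a < N" unfolding j(2) using N_pos by simp
    moreover have "[a ^ (p - 1) = 1] (mod N)"
    proof -
      have "totient N = ?e * (p - 1)" using totient_prime_power[OF prime, of n] n_pos by simp
      then have "[(j ^ ?e) ^ (p - 1) = 1] (mod N)"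
        using euler_theorem[OF iffD2[OF coprime_N \<open>\<not> p dvd j\<close>]] by (simp only: power_mult)
      moreover have "[a ^ (p - 1) = (j ^ ?e) ^ (p - 1)] (mod N)"
        unfolding j(2) by (rule cong_pow) (simp only: cong_def mod_mod_trivial)
      ultimately show ?thesis using cong_trans by blast
    qed
    ultimately show "a \<in> teich" by (simp add: teich_def units_def)
  next
    fix a assume a: "a \<in> teich"
    define j where "j = a mod p"
    have "\<not> p dvd a" using a teich_not_dvd by blast
    then have "j \<noteq> 0" "j < p" using p_gt_1 by (simp_all add: j_def dvd_eq_mod_eq_0)
    then have j: "j \<in> {1..p - 1}" by simp
    have "[a ^ ?e = j ^ ?e] (mod p ^ Suc (n - 1))"
      by (rule cong_pow_prime_power_nat) (simp add: j_def cong_def)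
    then have 1: "[a ^ ?e = j ^ ?e] (mod N)" using n_pos by simp
    \<comment> \<open>As \<open>p\<close> is 1 modulo \<open>p - 1\<close>, so is its power
      \<open>?e\<close>. Raising to the power \<open>?e\<close> therefore fixes every element of
      \<open>teich\<close> modulo \<open>N\<close>, and \<open>a\<close> is the image of its own
      residue \<open>j\<close>.\<close>
    have "[?e = 1] (mod (p - 1))"
    proof -
      have "[p = 1] (mod (p - 1))" using p_gt_1 by (simp add: cong_altdef_nat)
      then show ?thesis using cong_pow[of p 1 "p - 1" "n - 1"] by simp
    qed
    then have "p - 1 dvd ?e - 1" using p_gt_1 by (simp add: cong_altdef_nat)
    then obtain k where "?e - 1 = (p - 1) * k" by (elim dvdE)
    then have e: "?e = Suc ((p - 1) * k)" using p_gt_1 by (cases ?e) auto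
    have "[a ^ ?e = a * 1 ^ k] (mod N)"
      unfolding e power_Suc power_mult
      by (intro cong_mult cong_pow cong_refl) (use a in \<open>simp add: teich_def\<close>)
    then have "[a ^ ?e = a] (mod N)" by simp
    then have "[a = j ^ ?e] (mod N)" using 1 cong_sym cong_trans by blast
    then have "a = j ^ ?e mod N" using a by (simp add: teich_def units_def cong_def)
    then show "a \<in> (\<lambda>j. j ^ ?e mod N) ` {1..p - 1}" using j by blast
  qed
qed

lemma card_teich: "card teich = p - 1" using bij_betw_same_card[OF bij_teich] by simp

lemma finite_teich: "finite teich" by (rule finite_subset[OF _ finite_units]) (auto simp: teich_def)

lemma one_in_teich: "1 \<in> teich" using one_in_units by (simp add: teich_def)

lemma teich_mult: "a \<in> teich \<Longrightarrow> b \<in> teich \<Longrightarrow> a * b mod N \<in> teich"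
proof -
  assume ab: "a \<in> teich" "b \<in> teich"
  have "\<not> p dvd a * b mod N"
    unfolding not_dvd_mod_N by (intro not_dvd_mult teich_not_dvd ab)
  moreover have "[(a * b mod N) ^ (p - 1) = a ^ (p - 1) * b ^ (p - 1)] (mod N)"
    unfolding power_mult_distrib[symmetric] by (rule cong_pow) (simp add: cong_def)
  moreover have "[a ^ (p - 1) * b ^ (p - 1) = 1 * 1] (mod N)"
    using ab by (intro cong_mult) (auto simp: teich_def)
  ultimately show ?thesis
    unfolding teich_def units_def using N_pos cong_trans by simp blast
qed

lemma bij_teich_mult:
  assumes "b \<in> teich"
  shows "bij_betw (\<lambda>a. b * a mod N) teich teich"
proof -
  have inj: "inj_on (\<lambda>a. b * a mod N) teich"
    by (rule inj_on_subset[OF bij_betw_imp_inj_on[OF bij_units[OF teich_not_dvd[OF assms]]]])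
      (auto simp: teich_def)
  have "(\<lambda>a. b * a mod N) ` teich \<subseteq> teich" using teich_mult[OF assms] by blast
  then show ?thesis using endo_inj_surj[OF finite_teich _ inj] inj by (simp add: bij_betw_def)
qed

section \<open>The Galois group as the units modulo p^n\<close>

text \<open>Restricted to \<open>K\<close> because the elements of \<open>Bij K\<close> are
  extensional functions.\<close>

definition gal :: "nat \<Rightarrow> complex \<Rightarrow> complex" where "gal a = restrict (aut a) K"

lemma gal_apply: "x \<in> K \<Longrightarrow> gal a x = aut a x" by (simp add: gal_def)

lemma gal_cong: "[a = b] (mod N) \<Longrightarrow> gal a = gal b"
  unfolding gal_def using aut_cong by presburger

lemma gal_eq_iff:
  assumes "\<not> p dvd a" "\<not> p dvd b"
  shows "gal a = gal b \<longleftrightarrow> [a = b] (mod N)"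
proof
  assume "gal a = gal b"
  then have "gal a z = gal b z" by simp
  then have "z ^ a = z ^ b" by (simp add: gal_apply K_z aut_z assms)
  then show "[a = b] (mod N)" by (simp only: z_pow_inj)
qed (rule gal_cong)

lemma inj_gal_units: "inj_on gal units"
proof (rule inj_onI)
  fix a b assume ab: "a \<in> units" "b \<in> units" "gal a = gal b"
  then have "[a = b] (mod N)" using gal_eq_iff units_not_dvd by blast
  then show "a = b" using ab by (simp add: units_def cong_def)
qed

lemma compose_gal: "\<not> p dvd a \<Longrightarrow> \<not> p dvd b \<Longrightarrow> compose K (gal a) (gal b) = gal (a * b)"
  by (rule ext) (simp add: compose_def gal_def aut_in_K aut_conj)

lemma gal_one: "gal 1 = restrict id K"
  unfolding gal_def by (rule restrict_ext) (simp add: aut_one del: One_nat_def)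

lemma gal_in_Bij:
  assumes "\<not> p dvd a"
  shows "gal a \<in> Bij K"
proof -
  obtain b where b: "b \<in> units" "[a * b = 1] (mod N)" using units_inverse[OF assms] .
  have b': "\<not> p dvd b" "[b * a = 1] (mod N)" using b units_not_dvd by (blast, simp only: mult.commute)
  have "bij_betw (aut a) K K"
  proof (rule bij_betw_byWitness[of _ "aut b"])
    show "\<forall>x\<in>K. aut b (aut a x) = x" using aut_inverse[OF _ b'(1) assms b'(2)] by blast
    show "\<forall>x\<in>K. aut a (aut b x) = x" using aut_inverse[OF _ assms b'(1) b(2)] by blast
    show "aut a ` K \<subseteq> K" "aut b ` K \<subseteq> K" using aut_in_K assms b'(1) by blast+
  qed
  then show ?thesis by (simp add: Bij_def gal_def bij_betw_restrict_eq)
qed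

lemma F_field_eq: "F_field z = K"
proof (intro equalityI subsetI)
  show "x \<in> K" if "x \<in> F_field z" for x
    using that unfolding F_field_def
  proof induction
    case (a_inv h)
    then show ?case using K_diff[OF K_0] by (simp add: CC_uminus)
  next
    case (m_inv h)
    then show ?case by (simp add: CC_inv CC_simps K_inverse)
  qed (auto simp: CC_simps K_1 K_add K_mult K_z)
  let ?G = "generate_field CC {z}"
  have z: "z \<in> ?G" by (rule generate_field.incl) simp
  have one: "1 \<in> ?G" using generate_field.one[of CC] by (simp add: CC_simps)
  have add: "x \<in> ?G \<Longrightarrow> y \<in> ?G \<Longrightarrow> x + y \<in> ?G" for x y
    using generate_field.eng_add[of x CC] by (simp add: CC_simps)
  have mult: "x \<in> ?G \<Longrightarrow> y \<in> ?G \<Longrightarrow> x * y \<in> ?G" for x y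
    using generate_field.eng_mult[of x CC] by (simp add: CC_simps)
  have uminus: "x \<in> ?G \<Longrightarrow> - x \<in> ?G" for x
    using generate_field.a_inv[of x CC] by (simp add: CC_uminus)
  have inv: "x \<in> ?G \<Longrightarrow> x \<noteq> 0 \<Longrightarrow> inverse x \<in> ?G" for x
    using generate_field.m_inv[of x CC] by (simp add: CC_inv CC_simps)
  have zero: "0 \<in> ?G" using add[OF one uminus[OF one]] by simp
  have nat: "of_nat k \<in> ?G" for k by (induction k) (use zero one add in auto)
  have int: "of_int k \<in> ?G" for k by (cases k rule: int_cases2) (use nat uminus in auto)
  have rat: "of_rat q \<in> ?G" for q
  proof -
    obtain a b where "quotient_of q = (a, b)" by fastforce
    then have "q = of_int a / of_int b" "b > 0" using quotient_of_div quotient_of_denom_pos by blast+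
    then have "of_rat q = of_rat (of_int a) / (of_rat (of_int b) :: complex)"
      by (simp only: of_rat_divide)
    then have "of_rat q = of_int a * inverse (of_int b :: complex)"
      by (simp add: divide_inverse)
    moreover have "inverse (of_int b) \<in> ?G" using \<open>b > 0\<close> by (intro inv int) simp
    ultimately show ?thesis using mult int by simp
  qed
  fix x assume "x \<in> K"
  then obtain f where "x = reval f z" by (rule K_cases)
  moreover have "reval f z \<in> ?G"
    by (induction f) (auto simp: reval_def of_rat_hom.map_poly_pCons_hom zero intro!: add mult z rat)
  ultimately show "x \<in> F_field z" by (simp add: F_field_def)
qed

text \<open>There are exactly \<open>N\<close> complex solutions of \<open>w ^ N = 1\<close>, and
  the powers of \<open>z\<close> already account for \<open>N\<close> of them.\<close>

lemma roots_of_unity_powers: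
  assumes "w ^ N = 1"
  obtains k where "k < N" "w = z ^ k"
proof -
  have inj: "inj_on (\<lambda>k. z ^ k) {..<N}"
    by (rule inj_onI) (simp add: z_pow_inj cong_def)
  have "(\<lambda>k. z ^ k) ` {..<N} \<subseteq> {w. w ^ N = 1}"
  proof (rule image_subsetI, rule CollectI)
    fix k show "(z ^ k) ^ N = 1"
      unfolding power_mult[symmetric] z_pow_eq_1_iff by simp
  qed
  moreover have "card {w :: complex. w ^ N = 1} = N" using N_pos by (rule card_roots_unity_eq)
  moreover have "finite {w :: complex. w ^ N = 1}"
    using finite_roots_unity[of N] Suc_leI[OF N_pos] unfolding One_nat_def by blast
  ultimately have "(\<lambda>k. z ^ k) ` {..<N} = {w. w ^ N = 1}"
    by (intro card_subset_eq) (simp_all only: card_image[OF inj] card_lessThan)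
  then show ?thesis using assms that by blast
qed

abbreviation G where "G \<equiv> Gal CC \<rat> K"

lemma Gal_mult: "\<sigma> \<in> Bij K \<Longrightarrow> \<tau> \<in> Bij K \<Longrightarrow> \<sigma> \<otimes>\<^bsub>G\<^esub> \<tau> = compose K \<sigma> \<tau>"
  by (simp add: Gal_def BijGroup_def)

lemma Gal_one: "\<one>\<^bsub>G\<^esub> = gal 1"
  unfolding gal_one by (simp add: Gal_def BijGroup_def restrict_def id_def)

lemma gal_mult: "\<not> p dvd a \<Longrightarrow> \<not> p dvd b \<Longrightarrow> gal a \<otimes>\<^bsub>G\<^esub> gal b = gal (a * b)"
  by (simp add: Gal_mult gal_in_Bij compose_gal)

lemma gal_mod: "gal (a mod N) = gal a"
  by (rule gal_cong) (simp only: cong_def mod_mod_trivial)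

lemma gal_in_gal_units: "\<not> p dvd a \<Longrightarrow> gal a \<in> gal ` units"
proof -
  assume "\<not> p dvd a"
  then have "a mod N \<in> units" using N_pos by (simp add: units_def not_dvd_mod_N)
  then show ?thesis using gal_mod by (metis imageI)
qed

text \<open>An automorphism is determined by the image of \<open>z\<close>, which is again an
  \<open>N\<close>-th root of unity and so a power \<open>z ^ k\<close>.\<close>

lemma carrier_Gal: "carrier G = gal ` units"
proof (intro equalityI subsetI)
  fix \<sigma> assume "\<sigma> \<in> gal ` units"
  then obtain a where a: "\<sigma> = gal a" "\<not> p dvd a" using units_not_dvd by blast
  have "gal a \<in> Ring.ring_hom (CC\<lparr>carrier := K\<rparr>) (CC\<lparr>carrier := K\<rparr>)"
    using a(2) by (intro ring_hom_memI)
      (simp_all add: gal_apply ring_of_type_algebra_def aut_in_K aut_add aut_mult aut_1 K_add K_mult K_1)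
  moreover have "\<forall>x\<in>\<rat>. gal a x = x"
    using a(2) by (auto elim!: Rats_cases simp: gal_apply K_of_rat aut_of_rat)
  ultimately show "\<sigma> \<in> carrier G"
    using gal_in_Bij[OF a(2)] by (simp add: Gal_def a)
next
  fix \<sigma> assume "\<sigma> \<in> carrier G"
  then have \<sigma>: "\<sigma> \<in> Bij K" "\<sigma> \<in> Ring.ring_hom (CC\<lparr>carrier := K\<rparr>) (CC\<lparr>carrier := K\<rparr>)"
      "\<And>x. x \<in> \<rat> \<Longrightarrow> \<sigma> x = x"
    by (simp_all add: Gal_def)
  have hom: "\<sigma> (x + y) = \<sigma> x + \<sigma> y" "\<sigma> (x * y) = \<sigma> x * \<sigma> y" if "x \<in> K" "y \<in> K" for x y
    using ring_hom_add[OF \<sigma>(2)] ring_hom_mult[OF \<sigma>(2)] that by (simp_all add: ring_of_type_algebra_def)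
  have pow: "\<sigma> (x ^ k) = \<sigma> x ^ k" if "x \<in> K" for x k
  proof (induction k)
    case 0 show ?case using \<sigma>(3)[of 1] by simp
  next
    case (Suc k) then show ?case using that by (simp add: hom K_power)
  qed
  have inj: "inj_on \<sigma> K" using \<sigma>(1) by (simp add: Bij_def bij_betw_def)
  have "\<sigma> z ^ N = 1" using pow[OF K_z, of N] \<sigma>(3)[of 1] by (simp add: z_pow_N)
  then obtain k where k: "k < N" "\<sigma> z = z ^ k" by (rule roots_of_unity_powers)
  \<comment> \<open>Otherwise \<open>z ^ (p ^ (n - 1))\<close>, which is not 1, would be mapped to
    1, against injectivity.\<close>
  have "\<not> p dvd k"
  proof
    assume "p dvd k"
    then have "N dvd k * p ^ (n - 1)" unfolding N_split by (rule mult_dvd_mono) simp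
    then have "\<sigma> (z ^ (p ^ (n - 1))) = 1" unfolding pow[OF K_z] k(2) power_mult[symmetric] z_pow_eq_1_iff .
    also have "1 = \<sigma> 1" using \<sigma>(3)[of 1] by simp
    finally have "z ^ (p ^ (n - 1)) = 1" using inj by (auto simp: inj_on_def K_power K_z K_1)
    then have "N dvd p ^ (n - 1)" by (simp only: z_pow_eq_1_iff)
    then have "p ^ n \<le> p ^ (n - 1)" using p_gt_1 by (intro dvd_imp_le) simp_all
    then have "n \<le> n - 1" using p_gt_1 by (simp only: power_increasing_iff)
    then show False using n_pos by simp
  qed
  have "\<sigma> (reval f z) = reval f (z ^ k)" for f
  proof (induction f)
    case 0
    show ?case using \<sigma>(3)[of 0] by (simp add: reval_0)
  next
    case (pCons a f)
    have *: "reval (pCons a f) w = of_rat a + w * reval f w" for w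
      by (simp add: reval_def of_rat_hom.map_poly_pCons_hom)
    show ?case unfolding * using pCons by (simp add: hom K_of_rat K_mult K_z \<sigma>(3) k(2))
  qed
  then have "\<sigma> x = gal k x" if "x \<in> K" for x
    using that aut_reval[OF \<open>\<not> p dvd k\<close>] by (elim K_cases) (simp add: gal_apply)
  then have "\<sigma> = gal k"
    using extensionalityI[of \<sigma> K "gal k"] \<sigma>(1) by (simp add: Bij_def gal_def)
  then show "\<sigma> \<in> gal ` units" using k \<open>\<not> p dvd k\<close> by (simp add: units_def)
qed

lemma group_Gal: "group G"
proof (rule groupI)
  show "\<one>\<^bsub>G\<^esub> \<in> carrier G" unfolding Gal_one carrier_Gal using one_in_units by (rule imageI)
next
  fix x assume "x \<in> carrier G"
  then obtain a where a: "x = gal a" "\<not> p dvd a" unfolding carrier_Gal using units_not_dvd by blast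
  show "\<one>\<^bsub>G\<^esub> \<otimes>\<^bsub>G\<^esub> x = x"
    unfolding Gal_one a(1) using gal_mult[OF units_not_dvd[OF one_in_units] a(2)] by simp
  obtain b where b: "b \<in> units" "[a * b = 1] (mod N)" using units_inverse[OF a(2)] .
  then have "gal b \<otimes>\<^bsub>G\<^esub> x = \<one>\<^bsub>G\<^esub>"
    unfolding Gal_one a(1) gal_mult[OF units_not_dvd[OF b(1)] a(2)]
    by (intro gal_cong) (simp only: mult.commute)
  then show "\<exists>y\<in>carrier G. y \<otimes>\<^bsub>G\<^esub> x = \<one>\<^bsub>G\<^esub>" using b(1) unfolding carrier_Gal by blast
next
  fix x y assume "x \<in> carrier G" "y \<in> carrier G"
  then obtain a b where ab: "x = gal a" "\<not> p dvd a" "y = gal b" "\<not> p dvd b"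
    unfolding carrier_Gal using units_not_dvd by blast
  show "x \<otimes>\<^bsub>G\<^esub> y \<in> carrier G"
    unfolding ab(1,3) gal_mult[OF ab(2,4)] carrier_Gal by (intro gal_in_gal_units not_dvd_mult ab)
  fix w assume "w \<in> carrier G"
  then obtain c where c: "w = gal c" "\<not> p dvd c" unfolding carrier_Gal using units_not_dvd by blast
  show "x \<otimes>\<^bsub>G\<^esub> y \<otimes>\<^bsub>G\<^esub> w = x \<otimes>\<^bsub>G\<^esub> (y \<otimes>\<^bsub>G\<^esub> w)"
    unfolding ab(1,3) c(1) by (simp only: gal_mult ab c not_dvd_mult mult.assoc not_False_eq_True)
qed

lemma teich_inverse:
  assumes "a \<in> teich"
  obtains b where "b \<in> teich" "[a * b = 1] (mod N)"
proof -
  have "1 \<in> (\<lambda>b. a * b mod N) ` teich"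
    using bij_betw_imp_surj_on[OF bij_teich_mult[OF assms]] one_in_teich by blast
  then obtain b where "b \<in> teich" and b: "1 = a * b mod N" by blast
  have "[a * b = 1] (mod N)" unfolding cong_def mod_less[OF N_gt_1] by (rule b[symmetric])
  then show ?thesis using that \<open>b \<in> teich\<close> by blast
qed

lemma subgroup_gal_teich: "subgroup (gal ` teich) G"
proof -
  interpret G: group G by (rule group_Gal)
  show ?thesis
  proof (rule G.subgroupI)
    show "gal ` teich \<subseteq> carrier G" unfolding carrier_Gal using teich_units by blast
    show "gal ` teich \<noteq> {}" using one_in_teich by blast
  next
    fix x assume "x \<in> gal ` teich"
    then obtain a where a: "a \<in> teich" "x = gal a" by blast
    obtain b where b: "b \<in> teich" "[a * b = 1] (mod N)" using teich_inverse[OF a(1)] .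
    have "gal b \<otimes>\<^bsub>G\<^esub> gal a = \<one>\<^bsub>G\<^esub>"
      unfolding Gal_one gal_mult[OF teich_not_dvd[OF b(1)] teich_not_dvd[OF a(1)]]
      by (rule gal_cong) (use b(2) in \<open>simp only: mult.commute\<close>)
    moreover have "gal a \<in> carrier G" "gal b \<in> carrier G"
      unfolding carrier_Gal by (intro imageI teich_units a b)+
    ultimately have "inv\<^bsub>G\<^esub> x = gal b" unfolding a(2) by (rule G.inv_equality)
    then show "inv\<^bsub>G\<^esub> x \<in> gal ` teich" using b(1) by blast
  next
    fix x y assume "x \<in> gal ` teich" "y \<in> gal ` teich"
    then obtain a b where ab: "a \<in> teich" "x = gal a" "b \<in> teich" "y = gal b" by blast
    have "x \<otimes>\<^bsub>G\<^esub> y = gal (a * b mod N)"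
      unfolding ab(2,4) gal_mult[OF teich_not_dvd[OF ab(1)] teich_not_dvd[OF ab(3)]] gal_mod ..
    then show "x \<otimes>\<^bsub>G\<^esub> y \<in> gal ` teich" using teich_mult[OF ab(1,3)] by blast
  qed
qed

lemma card_gal_teich: "card (gal ` teich) = p - 1"
proof -
  have "inj_on gal teich" by (rule inj_on_subset[OF inj_gal_units]) (rule subsetI, rule teich_units)
  then show ?thesis by (simp only: card_image card_teich)
qed

text \<open>By Lagrange every element of \<open>H\<close> has trivial (p - 1)-st power and so comes
  from \<open>teich\<close>; equal cardinalities do the rest. This uniqueness is what evaluates the
  description in \<open>E_field\<close>.\<close>

lemma subgroup_card_unique:
  assumes "subgroup H G" "card H = p - 1"
  shows "H = gal ` teich"
proof -
  interpret G: group G by (rule group_Gal)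
  interpret H: group "G\<lparr>carrier := H\<rparr>" by (rule G.subgroup_imp_group[OF assms(1)])
  have "H \<subseteq> gal ` teich"
  proof
    fix h assume h: "h \<in> H"
    then have "h \<in> gal ` units" using subgroup.subset[OF assms(1)] unfolding carrier_Gal by blast
    then obtain a where a: "a \<in> units" "h = gal a" by blast
    have nd: "\<not> p dvd a ^ k" for k
      using units_not_dvd[OF a(1)] prime_dvd_power[OF prime, of a k] by blast
    have pow: "h [^]\<^bsub>G\<lparr>carrier := H\<rparr>\<^esub> k = gal (a ^ k)" for k :: nat
    proof (induction k)
      case 0
      show ?case using Gal_one by simp
    next
      case (Suc k)
      have "h [^]\<^bsub>G\<lparr>carrier := H\<rparr>\<^esub> Suc k = gal (a ^ k) \<otimes>\<^bsub>G\<^esub> gal a"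
        unfolding H.nat_pow_Suc Suc by (simp add: a(2))
      also have "\<dots> = gal (a ^ k * a)" by (rule gal_mult[OF nd units_not_dvd[OF a(1)]])
      finally show ?case by (simp only: power_Suc2)
    qed
    have "h [^]\<^bsub>G\<lparr>carrier := H\<rparr>\<^esub> Coset.order (G\<lparr>carrier := H\<rparr>) = \<one>\<^bsub>G\<lparr>carrier := H\<rparr>\<^esub>"
      by (rule H.pow_order_eq_1) (use h in simp)
    then have "gal (a ^ (p - 1)) = gal 1"
      using assms(2) Gal_one by (simp add: pow Coset.order_def)
    then have "[a ^ (p - 1) = 1] (mod N)"
      using gal_eq_iff[OF nd units_not_dvd[OF one_in_units]] by blast
    then have "a \<in> teich" unfolding teich_def using a(1) by blast
    then show "h \<in> gal ` teich" unfolding a(2) by (rule imageI)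
  qed
  then show ?thesis using card_subset_eq[of "gal ` teich" H] finite_teich card_gal_teich assms(2) by simp
qed

lemma E_field_eq: "E_field p z = {x \<in> K. \<forall>a\<in>teich. aut a x = x}"
proof -
  have THE: "(THE H. subgroup H G \<and> card H = p - 1) = gal ` teich"
    by (rule the_equality) (use subgroup_gal_teich card_gal_teich subgroup_card_unique in blast)+
  show ?thesis unfolding E_field_def F_field_eq THE by (auto simp: gal_apply)
qed

end

section \<open>The trace as a sum over embeddings\<close>

text \<open>Dedekind's elimination argument, by induction on the set of characters.\<close>

lemma characters_independent:
  fixes S :: "('a :: field \<Rightarrow> 'a) set"
  assumes "finite S"
    and one: "1 \<in> E" "\<And>s. s \<in> S \<Longrightarrow> s 1 = 1"
    and mult: "\<And>x y. x \<in> E \<Longrightarrow> y \<in> E \<Longrightarrow> x * y \<in> E"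
      "\<And>s x y. s \<in> S \<Longrightarrow> x \<in> E \<Longrightarrow> y \<in> E \<Longrightarrow> s (x * y) = s x * s y"
    and dist: "\<And>s t. s \<in> S \<Longrightarrow> t \<in> S \<Longrightarrow> s \<noteq> t \<Longrightarrow> \<exists>x\<in>E. s x \<noteq> t x"
    and rel: "\<And>x. x \<in> E \<Longrightarrow> (\<Sum>s\<in>S. c s * s x) = 0"
    and "s \<in> S"
  shows "c s = 0"
proof -
  have "\<forall>c. (\<forall>x\<in>E. (\<Sum>s\<in>T. c s * s x) = 0) \<longrightarrow> (\<forall>s\<in>T. c s = 0)" if "T \<subseteq> S" for T
    using finite_subset[OF that \<open>finite S\<close>] that
  proof (induction T rule: finite_induct)
    case (insert t T)
    then have tT: "t \<in> S" "T \<subseteq> S" by auto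
    show ?case
    proof (intro allI impI)
      fix c assume "\<forall>x\<in>E. (\<Sum>s\<in>insert t T. c s * s x) = 0"
      then have c: "c t * t x + (\<Sum>s\<in>T. c s * s x) = 0" if "x \<in> E" for x
        using that insert.hyps by simp
      have T: "c s = 0" if s: "s \<in> T" for s
      proof -
        \<comment> \<open>\<open>y\<close> separates \<open>s\<close> from \<open>t\<close>. The
          relation at \<open>y * x\<close> minus \<open>t y\<close> times the relation at
          \<open>x\<close> no longer contains \<open>t\<close>, and its coefficient at
          \<open>s\<close> is \<open>c s * (s y - t y)\<close>.\<close>
        obtain y where y: "y \<in> E" "s y \<noteq> t y"
          using dist[of s t] s tT insert.hyps(2) by blast
        have "(\<Sum>s\<in>T. c s * (s y - t y) * s x) = 0" if x: "x \<in> E" for x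
        proof -
          have "0 = (c t * t (y * x) + (\<Sum>s\<in>T. c s * s (y * x))) - t y * (c t * t x + (\<Sum>s\<in>T. c s * s x))"
            using c[OF x] c[OF mult(1)[OF y(1) x]] by simp
          also have "(\<Sum>s\<in>T. c s * s (y * x)) = (\<Sum>s\<in>T. c s * (s y * s x))"
            using tT by (intro sum.cong refl, subst mult(2)[OF _ y(1) x]) auto
          also have "t (y * x) = t y * t x" by (rule mult(2)[OF tT(1) y(1) x])
          finally show ?thesis
            by (simp add: algebra_simps sum_distrib_left sum_subtractf)
        qed
        then have "c s * (s y - t y) = 0"
          using insert.IH[OF tT(2)] s by (auto dest!: spec[of _ "\<lambda>s. c s * (s y - t y)"])
        then show ?thesis using y by simp
      qed
      have "c t * t 1 = 0"
        using c[OF one(1)] T by simp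
      then have "c t = 0" using one(2)[OF tT(1)] by simp
      then show "\<forall>s\<in>insert t T. c s = 0" using T by simp
    qed
  qed simp
  then show ?thesis using rel \<open>s \<in> S\<close> by (metis order_refl)
qed

text \<open>A trivial kernel makes the determinant nonzero, and the adjugate divided by it is the
  inverse. Kernel vectors and \<open>W\<close> stay in the field of the entries, which will be the
  rationals although the embeddings take values in a larger field.\<close>

lemma nonsingular_inverse:
  fixes \<Gamma> :: "nat \<Rightarrow> nat \<Rightarrow> 'a :: field"
  assumes "\<And>v. (\<And>i. i < r \<Longrightarrow> (\<Sum>j<r. \<Gamma> i j * v j) = 0) \<Longrightarrow> (\<And>j. j < r \<Longrightarrow> v j = 0)"
  obtains W where "\<And>i k. i < r \<Longrightarrow> k < r \<Longrightarrow> (\<Sum>j<r. W i j * \<Gamma> j k) = of_bool (i = k)"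
proof -
  define A where "A = mat r r (\<lambda>(i, j). \<Gamma> i j)"
  have A: "A \<in> carrier_mat r r" by (simp add: A_def)
  have "det A \<noteq> 0"
  proof
    assume "det A = 0"
    then obtain v where v: "v \<in> carrier_vec r" "v \<noteq> 0\<^sub>v r" "A *\<^sub>v v = 0\<^sub>v r"
      using det_0_iff_vec_prod_zero_field[OF A] by blast
    have "(\<Sum>j<r. \<Gamma> i j * v $ j) = 0" if i: "i < r" for i
    proof -
      have "(\<Sum>j<r. \<Gamma> i j * v $ j) = (A *\<^sub>v v) $ i"
        using i v(1) by (auto simp: A_def scalar_prod_def lessThan_atLeast0 intro!: sum.cong)
      then show ?thesis using v i by simp
    qed
    then have "v $ j = 0" if "j < r" for j using assms[of "\<lambda>j. v $ j"] that by blast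
    then show False using v by auto
  qed
  define W where "W i j = adj_mat A $$ (i, j) / det A" for i j
  show ?thesis
  proof (rule that[of W])
    fix i k assume ik: "i < r" "k < r"
    have "(\<Sum>j<r. adj_mat A $$ (i, j) * \<Gamma> j k) = (adj_mat A * A) $$ (i, k)"
      using ik A adj_mat(1)[OF A] by (auto simp: A_def scalar_prod_def lessThan_atLeast0 intro!: sum.cong)
    also have "\<dots> = det A * of_bool (i = k)"
      unfolding adj_mat(3)[OF A] using ik by simp
    finally show "(\<Sum>j<r. W i j * \<Gamma> j k) = of_bool (i = k)"
      using \<open>det A \<noteq> 0\<close> by (simp add: W_def field_simps flip: sum_divide_distrib)
  qed
qed

text \<open>
  With \<open>A\<close> the matrix of the \<open>s (u i)\<close>, the Gram matrix \<open>A\<^sup>T A\<close> is rational and nonsingular, which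
  gives a left inverse \<open>L\<close> of \<open>A\<close>; the independence of characters shows that \<open>L\<close> is also a right
  inverse.
\<close>

lemma trace_eq_sum_embeddings:
  fixes E :: "'a :: field_char_0 set" and S :: "('a \<Rightarrow> 'a) set"
    and u :: "nat \<Rightarrow> 'a" and M :: "nat \<Rightarrow> nat \<Rightarrow> rat"
  assumes fin: "finite S" "S \<noteq> {}"
    and E_add: "\<And>x y. x \<in> E \<Longrightarrow> y \<in> E \<Longrightarrow> x + y \<in> E"
    and E_mult: "\<And>x y. x \<in> E \<Longrightarrow> y \<in> E \<Longrightarrow> x * y \<in> E"
    and E_rat: "\<And>q. of_rat q \<in> E"
    and E_inv: "\<And>x. x \<in> E \<Longrightarrow> x \<noteq> 0 \<Longrightarrow> inverse x \<in> E"
    and S_add: "\<And>s x y. s \<in> S \<Longrightarrow> x \<in> E \<Longrightarrow> y \<in> E \<Longrightarrow> s (x + y) = s x + s y"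
    and S_mult: "\<And>s x y. s \<in> S \<Longrightarrow> x \<in> E \<Longrightarrow> y \<in> E \<Longrightarrow> s (x * y) = s x * s y"
    and S_rat: "\<And>s q. s \<in> S \<Longrightarrow> s (of_rat q) = of_rat q"
    and S_dist: "\<And>s t. s \<in> S \<Longrightarrow> t \<in> S \<Longrightarrow> s \<noteq> t \<Longrightarrow> \<exists>x\<in>E. s x \<noteq> t x"
    and S_sum: "\<And>x. x \<in> E \<Longrightarrow> (\<Sum>s\<in>S. s x) \<in> \<rat>"
    and u: "\<And>i. i < r \<Longrightarrow> u i \<in> E"
    and indep: "\<And>c i. (\<Sum>i<r. of_rat (c i) * u i) = 0 \<Longrightarrow> i < r \<Longrightarrow> c i = 0"
    and span: "\<And>x. x \<in> E \<Longrightarrow> \<exists>c. x = (\<Sum>i<r. of_rat (c i) * u i)"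
    and x: "x \<in> E" and M: "\<And>j. j < r \<Longrightarrow> x * u j = (\<Sum>i<r. of_rat (M i j) * u i)"
  shows "(\<Sum>i<r. of_rat (M i i)) = (\<Sum>s\<in>S. s x)"
proof -
  have E0: "0 \<in> E" and E1: "1 \<in> E" using E_rat[of 0] E_rat[of 1] by simp_all
  have S0: "s 0 = 0" and S1: "s 1 = 1" if "s \<in> S" for s
    using S_rat[OF that, of 0] S_rat[OF that, of 1] by simp_all
  have E_sum: "sum f A \<in> E" if "\<And>i. i \<in> A \<Longrightarrow> f i \<in> E" for f :: "nat \<Rightarrow> 'a" and A
    using that by (induction A rule: infinite_finite_induct) (auto intro: E0 E_add)
  have S_lin: "s (\<Sum>i\<in>A. of_rat (c i) * f i) = (\<Sum>i\<in>A. of_rat (c i) * s (f i))"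
    if "s \<in> S" "\<And>i. i \<in> A \<Longrightarrow> f i \<in> E" for s c f and A :: "nat set"
    using that(2)
  proof (induction A rule: infinite_finite_induct)
    case (insert i A)
    have "s (of_rat (c i) * f i + (\<Sum>i\<in>A. of_rat (c i) * f i)) =
        of_rat (c i) * s (f i) + s (\<Sum>i\<in>A. of_rat (c i) * f i)"
      using insert.prems by (subst S_add[OF that(1)]) (use insert.prems[of i] in \<open>auto intro!: E_mult E_rat E_sum simp: S_mult[OF that(1)] S_rat[OF that(1)] E_rat\<close>)
    then show ?case using insert by simp
  qed (use S0[OF that(1)] in auto)
  \<comment> \<open>The values of the trace form on the basis. Having them as rationals makes kernel
    vectors rational, so that a kernel vector defines an element of \<open>E\<close>.\<close>
  define \<Gamma> where "\<Gamma> i j = (SOME q. (\<Sum>s\<in>S. s (u i * u j)) = of_rat q)" for i j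
  have \<Gamma>: "of_rat (\<Gamma> i j) = (\<Sum>s\<in>S. s (u i) * s (u j))" if ij: "i < r" "j < r" for i j
  proof -
    have "\<exists>q. (\<Sum>s\<in>S. s (u i * u j)) = of_rat q"
      using S_sum[of "u i * u j"] u E_mult ij by (auto elim: Rats_cases)
    then have "(\<Sum>s\<in>S. s (u i * u j)) = of_rat (\<Gamma> i j)" unfolding \<Gamma>_def by (rule someI_ex)
    moreover have "(\<Sum>s\<in>S. s (u i * u j)) = (\<Sum>s\<in>S. s (u i) * s (u j))"
      by (intro sum.cong refl S_mult u ij)
    ultimately show ?thesis by simp
  qed
  obtain W where W: "\<And>i k. i < r \<Longrightarrow> k < r \<Longrightarrow> (\<Sum>j<r. W i j * \<Gamma> j k) = of_bool (i = k)"
  proof (rule nonsingular_inverse[of r \<Gamma>])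
    fix v j assume v: "\<And>i. i < r \<Longrightarrow> (\<Sum>j<r. \<Gamma> i j * v j) = 0" and j: "j < r"
    define y where "y = (\<Sum>j<r. of_rat (v j) * u j)"
    have y: "y \<in> E" unfolding y_def by (intro E_sum E_mult E_rat u) simp
    have sy: "s y = (\<Sum>j<r. of_rat (v j) * s (u j))" if "s \<in> S" for s
      unfolding y_def by (rule S_lin[OF that]) (simp add: u)
    have uy: "(\<Sum>s\<in>S. s (u i) * s y) = 0" if i: "i < r" for i
    proof -
      have "(\<Sum>s\<in>S. s (u i) * s y) = (\<Sum>s\<in>S. \<Sum>j<r. of_rat (v j) * (s (u i) * s (u j)))"
        by (intro sum.cong refl) (simp add: sy sum_distrib_left mult_ac)
      also have "\<dots> = (\<Sum>j<r. of_rat (v j) * of_rat (\<Gamma> i j))"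
        by (subst sum.swap) (intro sum.cong refl, simp add: sum_distrib_left \<Gamma> i)
      also have "\<dots> = of_rat (\<Sum>j<r. \<Gamma> i j * v j)"
        by (simp add: of_rat_sum of_rat_mult mult.commute)
      finally show ?thesis using v[OF i] by simp
    qed
    have wy: "(\<Sum>s\<in>S. s w * s y) = 0" if w: "w \<in> E" for w
    proof -
      obtain c where c: "w = (\<Sum>i<r. of_rat (c i) * u i)" using span[OF w] by blast
      have "(\<Sum>s\<in>S. s w * s y) = (\<Sum>s\<in>S. \<Sum>i<r. of_rat (c i) * (s (u i) * s y))"
        unfolding c by (intro sum.cong refl, subst S_lin) (auto simp: u sum_distrib_right mult.assoc)
      also have "\<dots> = (\<Sum>i<r. of_rat (c i) * (\<Sum>s\<in>S. s (u i) * s y))"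
        by (subst sum.swap) (simp add: sum_distrib_left)
      finally show ?thesis by (simp add: uy)
    qed
    \<comment> \<open>\<open>y\<close> is orthogonal to all of \<open>E\<close>; paired with
      \<open>inverse y\<close> this would give \<open>card S = 0\<close>.\<close>
    have "y = 0"
    proof (rule ccontr)
      assume "y \<noteq> 0"
      then have "(\<Sum>s\<in>S. s (inverse y) * s y) = (\<Sum>s\<in>S. 1)"
        using E_inv[OF y] y by (intro sum.cong refl) (simp add: S1 flip: S_mult)
      then show False using wy[OF E_inv[OF y \<open>y \<noteq> 0\<close>]] fin by simp
    qed
    then show "v j = 0" using indep[of v j] j unfolding y_def by blast
  qed blast
  define L where "L i s = (\<Sum>j<r. of_rat (W i j) * s (u j))" for i and s :: "'a \<Rightarrow> 'a"
  have L: "(\<Sum>s\<in>S. L i s * s (u k)) = of_bool (i = k)" if ik: "i < r" "k < r" for i k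
  proof -
    have "(\<Sum>s\<in>S. L i s * s (u k)) = (\<Sum>s\<in>S. \<Sum>j<r. of_rat (W i j) * (s (u j) * s (u k)))"
      by (simp add: L_def sum_distrib_right mult.assoc)
    also have "\<dots> = (\<Sum>j<r. of_rat (W i j) * of_rat (\<Gamma> j k))"
      by (subst sum.swap) (intro sum.cong refl, simp add: sum_distrib_left \<Gamma> ik)
    also have "\<dots> = of_rat (\<Sum>j<r. W i j * \<Gamma> j k)"
      by (simp add: of_rat_sum of_rat_mult)
    finally show ?thesis using W[OF ik] by simp
  qed
  have P: "(\<Sum>i<r. s (u i) * L i t) = of_bool (s = t)" if st: "s \<in> S" "t \<in> S" for s t
  proof -
    \<comment> \<open>For fixed \<open>s\<close> this is row \<open>s\<close> of
      \<open>A L - 1\<close>. It is a linear relation between the embeddings: it kills the basis,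
      hence all of \<open>E\<close>.\<close>
    define c where "c t = (\<Sum>i<r. s (u i) * L i t) - of_bool (s = t)" for t
    have cu: "(\<Sum>t\<in>S. c t * t (u k)) = 0" if k: "k < r" for k
    proof -
      have "(\<Sum>t\<in>S. c t * t (u k)) =
          (\<Sum>t\<in>S. \<Sum>i<r. s (u i) * (L i t * t (u k))) - (\<Sum>t\<in>S. of_bool (s = t) * t (u k))"
        by (simp add: c_def sum_distrib_right left_diff_distrib sum_subtractf mult.assoc)
      also have "(\<Sum>t\<in>S. \<Sum>i<r. s (u i) * (L i t * t (u k))) = (\<Sum>i<r. s (u i) * of_bool (i = k))"
        by (subst sum.swap) (intro sum.cong refl, simp add: L k flip: sum_distrib_left)
      also have "\<dots> = s (u k)" using k by (simp add: of_bool_def if_distrib cong: if_cong)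
      also have "(\<Sum>t\<in>S. of_bool (s = t) * t (u k)) = s (u k)"
        using st fin by (simp add: of_bool_def if_distrib if_distribR cong: if_cong)
      finally show ?thesis by simp
    qed
    have "c t = 0"
    proof (rule characters_independent[of S E c t])
      fix y assume y: "y \<in> E"
      obtain d where d: "y = (\<Sum>i<r. of_rat (d i) * u i)" using span[OF y] by blast
      have "(\<Sum>t\<in>S. c t * t y) = (\<Sum>t\<in>S. \<Sum>i<r. of_rat (d i) * (c t * t (u i)))"
        unfolding d by (intro sum.cong refl, subst S_lin) (auto simp: u sum_distrib_left mult_ac)
      also have "\<dots> = (\<Sum>i<r. of_rat (d i) * (\<Sum>t\<in>S. c t * t (u i)))"
        by (subst sum.swap) (simp add: sum_distrib_left)
      finally show "(\<Sum>t\<in>S. c t * t y) = 0" by (simp add: cu)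
    qed (use fin E1 S1 E_mult S_mult S_dist st in blast)+
    then show ?thesis by (simp add: c_def)
  qed
  \<comment> \<open>Cyclicity of the trace: with \<open>D\<close> the diagonal matrix of the
    \<open>s x\<close>, one has \<open>A M = D A\<close>, so \<open>M = L D A\<close>, and
    \<open>A L = 1\<close> gives \<open>M\<close> the trace of \<open>D\<close>.\<close>
  have "(\<Sum>i<r. of_rat (M i i)) = (\<Sum>i<r. \<Sum>k<r. of_rat (M k i) * (\<Sum>s\<in>S. L i s * s (u k)))"
    by (intro sum.cong refl) (simp add: L of_bool_def if_distrib cong: if_cong)
  also have "\<dots> = (\<Sum>i<r. \<Sum>s\<in>S. L i s * (\<Sum>k<r. of_rat (M k i) * s (u k)))"
    by (intro sum.cong refl, unfold sum_distrib_left, subst sum.swap) (simp add: mult_ac)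
  also have "\<dots> = (\<Sum>i<r. \<Sum>s\<in>S. s x * (s (u i) * L i s))"
  proof (intro sum.cong refl)
    fix i s assume i: "i \<in> {..<r}" and s: "s \<in> S"
    have "(\<Sum>k<r. of_rat (M k i) * s (u k)) = s (x * u i)"
      using i M[of i] S_lin[OF s, of "{..<r}" u "\<lambda>k. M k i"] u by simp
    also have "\<dots> = s x * s (u i)" using i u x s by (simp add: S_mult)
    finally show "L i s * (\<Sum>k<r. of_rat (M k i) * s (u k)) = s x * (s (u i) * L i s)" by simp
  qed
  also have "\<dots> = (\<Sum>s\<in>S. s x * (\<Sum>i<r. s (u i) * L i s))"
    by (subst sum.swap) (simp add: sum_distrib_left)
  also have "\<dots> = (\<Sum>s\<in>S. s x)" by (simp add: P)
  finally show ?thesis .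
qed

lemma field_trace_eq_sum_embeddings:
  fixes E :: "complex set" and S :: "(complex \<Rightarrow> complex) set"
  assumes fin: "finite S" "S \<noteq> {}"
    and E_add: "\<And>x y. x \<in> E \<Longrightarrow> y \<in> E \<Longrightarrow> x + y \<in> E"
    and E_mult: "\<And>x y. x \<in> E \<Longrightarrow> y \<in> E \<Longrightarrow> x * y \<in> E"
    and E_rat: "\<And>q. of_rat q \<in> E"
    and E_inv: "\<And>x. x \<in> E \<Longrightarrow> x \<noteq> 0 \<Longrightarrow> inverse x \<in> E"
    and S_add: "\<And>s x y. s \<in> S \<Longrightarrow> x \<in> E \<Longrightarrow> y \<in> E \<Longrightarrow> s (x + y) = s x + s y"
    and S_mult: "\<And>s x y. s \<in> S \<Longrightarrow> x \<in> E \<Longrightarrow> y \<in> E \<Longrightarrow> s (x * y) = s x * s y"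
    and S_rat: "\<And>s q. s \<in> S \<Longrightarrow> s (of_rat q) = of_rat q"
    and S_dist: "\<And>s t. s \<in> S \<Longrightarrow> t \<in> S \<Longrightarrow> s \<noteq> t \<Longrightarrow> \<exists>x\<in>E. s x \<noteq> t x"
    and S_sum: "\<And>x. x \<in> E \<Longrightarrow> (\<Sum>s\<in>S. s x) \<in> \<rat>"
    and Vs: "CC.Span \<rat> Vs = E"
    and x: "x \<in> E"
  shows "field_trace CC \<rat> E x = (\<Sum>s\<in>S. s x)"
proof -
  define Q where "Q Us M \<longleftrightarrow> CC.independent \<rat> Us \<and> CC.Span \<rat> Us = E \<and>
        (\<forall>j<length Us. length (M j) = length Us \<and> set (M j) \<subseteq> \<rat> \<and>
           x \<otimes>\<^bsub>CC\<^esub> Us ! j = CC.combine (M j) Us)" for Us M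
  have carr: "set Us \<subseteq> carrier CC" for Us by (simp add: CC_simps)
  have trace: "(\<Oplus>\<^bsub>CC\<^esub>i\<in>{..<length Us}. M i ! i) = (\<Sum>s\<in>S. s x)" if "Q Us M" for Us M
  proof -
    let ?r = "length Us"
    have ind: "CC.independent \<rat> Us" and sp: "CC.Span \<rat> Us = E"
      and M: "\<And>j. j < ?r \<Longrightarrow> length (M j) = ?r" "\<And>j. j < ?r \<Longrightarrow> set (M j) \<subseteq> \<rat>"
        "\<And>j. j < ?r \<Longrightarrow> x * Us ! j = CC.combine (M j) Us"
      using that by (auto simp: Q_def CC_simps)
    have "\<exists>q. M j ! i = of_rat q" if "i < ?r" "j < ?r" for i j
    proof -
      have "M j ! i \<in> \<rat>" using M(1,2)[OF that(2)] that(1) by (simp add: subset_iff)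
      then show ?thesis by (rule Rats_cases) blast
    qed
    \<comment> \<open>The list \<open>M j\<close> is a column of the matrix, hence the exchanged
      indices in \<open>q i j\<close>.\<close>
    then obtain q where q: "\<And>i j. i < ?r \<Longrightarrow> j < ?r \<Longrightarrow> M j ! i = of_rat (q i j)" by metis
    have "(\<Sum>i<?r. of_rat (q i i)) = (\<Sum>s\<in>S. s x)"
    proof (rule trace_eq_sum_embeddings[where u = "\<lambda>i. Us ! i" and E = E and M = q and S = S and x = x])
      show "Us ! i \<in> E" if "i < ?r" for i
        using CC.Span_base_incl[OF subfield_Rats carr, of Us] nth_mem[OF that] unfolding sp by (rule subsetD)
      show "c i = 0" if "(\<Sum>i<?r. of_rat (c i) * Us ! i) = 0" "i < ?r" for c i
      proof -
        define Ks where "Ks = map (\<lambda>i. of_rat (c i) :: complex) [0..<?r]"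
        have "CC.combine Ks Us = (\<Sum>i<?r. Ks ! i * Us ! i)" by (rule CC_combine) (simp add: Ks_def)
        also have "\<dots> = 0" using that(1) by (simp add: Ks_def)
        finally have "CC.combine Ks Us = \<zero>\<^bsub>CC\<^esub>" by (simp add: CC_simps)
        moreover have "set Ks \<subseteq> \<rat>" by (auto simp: Ks_def)
        ultimately have "set (take ?r Ks) \<subseteq> {\<zero>\<^bsub>CC\<^esub>}"
          by (intro CC.independent_imp_trivial_combine[OF subfield_Rats ind])
        moreover have "of_rat (c i) \<in> set (take ?r Ks)" using that(2) by (simp add: Ks_def)
        ultimately show ?thesis by (auto simp: CC_simps)
      qed
      show "\<exists>c. y = (\<Sum>i<?r. of_rat (c i) * Us ! i)" if y: "y \<in> E" for y
      proof -
        obtain Ks where Ks: "set Ks \<subseteq> \<rat>" "length Ks = ?r" "y = CC.combine Ks Us"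
          using CC.Span_mem_iff_length_version[OF subfield_Rats carr, of y Us] y unfolding sp by blast
        have "\<exists>c. i < ?r \<longrightarrow> Ks ! i = of_rat c" for i
        proof (cases "i < ?r")
          case True
          then have "Ks ! i \<in> \<rat>" using Ks(1,2) by (simp add: subset_iff)
          then show ?thesis by (rule Rats_cases) blast
        qed blast
        then obtain c where "\<And>i. i < ?r \<Longrightarrow> Ks ! i = of_rat (c i)" by metis
        then show ?thesis unfolding Ks(3) CC_combine[OF Ks(2)] by (intro exI[of _ c] sum.cong refl) simp
      qed
      show "x * Us ! j = (\<Sum>i<?r. of_rat (q i j) * Us ! i)" if "j < ?r" for j
        unfolding M(3)[OF that] CC_combine[OF M(1)[OF that]] by (rule sum.cong[OF refl]) (simp only: lessThan_iff q[OF _ that])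
    qed (fact fin(1), fact fin(2), fact E_add, fact E_mult, fact E_rat, fact E_inv, fact S_add, fact S_mult,
        fact S_rat, fact S_dist, fact S_sum, fact x)
    moreover have "(\<Sum>i<?r. M i ! i) = (\<Sum>i<?r. of_rat (q i i))"
      by (rule sum.cong[OF refl]) (simp only: lessThan_iff q)
    ultimately show ?thesis unfolding CC_finsum[OF finite_lessThan] by (simp only:)
  qed
  obtain Us where "set Us \<subseteq> carrier CC" "CC.independent \<rat> Us" "CC.Span \<rat> Us = CC.Span \<rat> Vs"
    by (rule CC.filter_base[OF subfield_Rats carr])
  then have Us: "CC.independent \<rat> Us" "CC.Span \<rat> Us = E" unfolding Vs by blast+
  have "\<exists>Ks. j < length Us \<longrightarrow> length Ks = length Us \<and> set Ks \<subseteq> \<rat> \<and> x \<otimes>\<^bsub>CC\<^esub> Us ! j = CC.combine Ks Us" for j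
  proof (cases "j < length Us")
    case True
    have "Us ! j \<in> E"
      using CC.Span_base_incl[OF subfield_Rats carr, of Us] nth_mem[OF True] unfolding Us(2) by (rule subsetD)
    then have "x \<otimes>\<^bsub>CC\<^esub> Us ! j \<in> CC.Span \<rat> Us" unfolding CC_simps Us(2) by (rule E_mult[OF x])
    then show ?thesis
      unfolding CC.Span_mem_iff_length_version[OF subfield_Rats carr] by blast
  qed blast
  then obtain M where "\<And>j. j < length Us \<Longrightarrow> length (M j) = length Us \<and> set (M j) \<subseteq> \<rat> \<and>
      x \<otimes>\<^bsub>CC\<^esub> Us ! j = CC.combine (M j) Us" by metis
  then have "Q Us M" using Us by (simp add: Q_def)
  have "field_trace CC \<rat> E x = (THE t. \<exists>Us M. Q Us M \<and> t = (\<Oplus>\<^bsub>CC\<^esub>i\<in>{..<length Us}. M i ! i))"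
    unfolding field_trace_def Q_def by (simp only: conj_assoc)
  also have "\<dots> = (\<Sum>s\<in>S. s x)"
  proof (rule the_equality)
    show "\<exists>Us M. Q Us M \<and> (\<Sum>s\<in>S. s x) = (\<Oplus>\<^bsub>CC\<^esub>i\<in>{..<length Us}. M i ! i)"
      using \<open>Q Us M\<close> trace[OF \<open>Q Us M\<close>] by (intro exI conjI) (assumption, rule sym)
    fix t assume "\<exists>Us M. Q Us M \<and> t = (\<Oplus>\<^bsub>CC\<^esub>i\<in>{..<length Us}. M i ! i)"
    then obtain Us M where "Q Us M" "t = (\<Oplus>\<^bsub>CC\<^esub>i\<in>{..<length Us}. M i ! i)" by blast
    then show "t = (\<Sum>s\<in>S. s x)" using trace[of Us M] by simp
  qed
  finally show ?thesis .
qed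

section \<open>The trace of the norm of z - 1\<close>

lemma prod_add_Pow:
  fixes f g :: "'a \<Rightarrow> 'b :: comm_semiring_1"
  assumes "finite A"
  shows "(\<Prod>x\<in>A. f x + g x) = (\<Sum>B\<in>Pow A. prod f B * prod g (A - B))"
  using assms
proof (induction A rule: finite_induct)
  case (insert a A)
  have inj: "inj_on (insert a) (Pow A)" using insert.hyps(2) by (auto simp: inj_on_def)
  have disj: "Pow A \<inter> insert a ` Pow A = {}" using insert.hyps(2) by auto
  have 1: "prod f (insert a B) * prod g (insert a A - insert a B) = f a * (prod f B * prod g (A - B))"
    if "B \<in> Pow A" for B
  proof -
    have "insert a A - insert a B = A - B" "a \<notin> B" "finite B"
      using insert.hyps that finite_subset by auto
    then show ?thesis by (simp add: mult.assoc)
  qed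
  have 2: "prod f B * prod g (insert a A - B) = g a * (prod f B * prod g (A - B))"
    if "B \<in> Pow A" for B
  proof -
    have "insert a A - B = insert a (A - B)" "a \<notin> A - B" "finite (A - B)"
      using insert.hyps that by auto
    then show ?thesis by (simp add: mult_ac)
  qed
  have "(\<Sum>B\<in>Pow (insert a A). prod f B * prod g (insert a A - B)) =
      (\<Sum>B\<in>Pow A. prod f B * prod g (insert a A - B)) +
      (\<Sum>B\<in>Pow A. prod f (insert a B) * prod g (insert a A - insert a B))"
    unfolding Pow_insert using insert.hyps(1) disj
    by (subst sum.union_disjoint) (simp_all add: sum.reindex[OF inj])
  also have "(\<Sum>B\<in>Pow A. prod f B * prod g (insert a A - B)) = g a * (\<Sum>B\<in>Pow A. prod f B * prod g (A - B))"
    unfolding sum_distrib_left by (intro sum.cong refl 2)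
  also have "(\<Sum>B\<in>Pow A. prod f (insert a B) * prod g (insert a A - insert a B)) =
      f a * (\<Sum>B\<in>Pow A. prod f B * prod g (A - B))"
    unfolding sum_distrib_left by (intro sum.cong refl 1)
  finally show ?case using insert by (simp add: distrib_right add.commute)
qed simp

section \<open>The fixed field E\<close>

context prime_power_root
begin

abbreviation E where "E \<equiv> E_field p z"

lemma E_in_K: "x \<in> E \<Longrightarrow> x \<in> K" by (simp add: E_field_eq)

lemma aut_teich: "x \<in> E \<Longrightarrow> a \<in> teich \<Longrightarrow> aut a x = x" by (simp add: E_field_eq)

lemma E_I: "x \<in> K \<Longrightarrow> (\<And>a. a \<in> teich \<Longrightarrow> aut a x = x) \<Longrightarrow> x \<in> E"
  by (simp add: E_field_eq)

lemma E_add: "x \<in> E \<Longrightarrow> y \<in> E \<Longrightarrow> x + y \<in> E"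
  by (rule E_I) (simp_all add: E_in_K K_add aut_add teich_not_dvd aut_teich)

lemma E_mult: "x \<in> E \<Longrightarrow> y \<in> E \<Longrightarrow> x * y \<in> E"
  by (rule E_I) (simp_all add: E_in_K K_mult aut_mult teich_not_dvd aut_teich)

lemma E_of_rat: "of_rat q \<in> E"
  by (rule E_I) (simp_all add: K_of_rat aut_of_rat teich_not_dvd)

lemma E_sum: "(\<And>i. i \<in> A \<Longrightarrow> f i \<in> E) \<Longrightarrow> sum f A \<in> E"
  using E_of_rat[of 0] by (induction A rule: infinite_finite_induct) (auto intro: E_add)

lemma E_inverse:
  assumes "x \<in> E" "x \<noteq> 0"
  shows "inverse x \<in> E"
proof (rule E_I)
  show K: "inverse x \<in> K" using assms K_inverse E_in_K by blast
  fix a assume a: "a \<in> teich"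
  have "x * aut a (inverse x) = aut a (x * inverse x)"
    using aut_mult[OF E_in_K[OF assms(1)] K teich_not_dvd[OF a]] aut_teich[OF assms(1) a] by simp
  also have "\<dots> = 1" using assms(2) aut_1[OF teich_not_dvd[OF a]] by simp
  finally show "aut a (inverse x) = inverse x" using assms(2) by (simp add: field_simps)
qed

text \<open>Applying \<open>aut a\<close> with \<open>a\<close> in \<open>teich\<close> multiplies
  the exponents by \<open>a\<close>, which permutes \<open>teich\<close>. A general \<open>f\<close>
  covers \<open>w - 1\<close>, which gives \<open>pi_elt\<close>, as well as \<open>k - w\<close>
  for natural numbers \<open>k\<close>.\<close>

lemma prod_teich_in_E:
  fixes f :: "complex \<Rightarrow> complex"
  assumes K: "\<And>t. f (z ^ t) \<in> K"
    and f: "\<And>a t. \<not> p dvd a \<Longrightarrow> aut a (f (z ^ t)) = f (z ^ (a * t))"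
  shows "(\<Prod>t\<in>teich. f (z ^ t)) \<in> E"
proof (rule E_I)
  show "(\<Prod>t\<in>teich. f (z ^ t)) \<in> K" by (intro K_prod K)
  fix a assume a: "a \<in> teich"
  have "aut a (\<Prod>t\<in>teich. f (z ^ t)) = (\<Prod>t\<in>teich. aut a (f (z ^ t)))"
    by (rule aut_prod; intro K teich_not_dvd a)
  also have "\<dots> = (\<Prod>t\<in>teich. f (z ^ (a * t mod N)))"
    by (intro prod.cong refl) (simp only: f[OF teich_not_dvd[OF a]] z_pow_mod)
  also have "\<dots> = (\<Prod>t\<in>teich. f (z ^ t))"
    by (rule prod.reindex_bij_betw[OF bij_teich_mult[OF a], of "\<lambda>t. f (z ^ t)"])
  finally show "aut a (\<Prod>t\<in>teich. f (z ^ t)) = (\<Prod>t\<in>teich. f (z ^ t))" .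
qed

lemma K_z_pow: "z ^ k \<in> K" by (intro K_power K_z)

lemma aut_z_pow: "\<not> p dvd a \<Longrightarrow> aut a (z ^ k) = z ^ (a * k)"
  by (simp add: aut_power K_z aut_z power_mult)

lemma aut_diff: "x \<in> K \<Longrightarrow> y \<in> K \<Longrightarrow> \<not> p dvd a \<Longrightarrow> aut a (x - y) = aut a x - aut a y"
  using aut_add[of "x - y" y a] by (simp add: K_diff)

text \<open>
  The automorphism is recovered from its values on the products of \<open>q - z ^ t\<close> over
  \<open>t \<in> teich\<close> with \<open>q\<close> a natural number, that is, from a polynomial having these roots.
\<close>

lemma teich_if_fixes_E:
  assumes c: "\<not> p dvd c" and fix_E: "\<And>x. x \<in> E \<Longrightarrow> aut c x = x"
  shows "\<exists>t\<in>teich. [c = t] (mod N)"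
proof -
  define A where "A = (\<Prod>t\<in>teich. [:- (z ^ t), 1:])"
  define B where "B = (\<Prod>t\<in>teich. [:- (z ^ (c * t)), 1:])"
  have "poly A (of_nat k) = poly B (of_nat k)" for k
  proof -
    let ?f = "\<lambda>w. of_nat k - w :: complex"
    have k: "(of_nat k :: complex) = of_rat (of_nat k)" by simp
    have K: "?f (z ^ t) \<in> K" for t
      unfolding k by (intro K_diff K_of_rat K_z_pow)
    have aut: "aut a (?f (z ^ t)) = ?f (z ^ (a * t))" if "\<not> p dvd a" for a t
      unfolding k by (simp only: aut_diff[OF K_of_rat K_z_pow that] aut_of_rat[OF that] aut_z_pow[OF that])
    have "(\<Prod>t\<in>teich. ?f (z ^ t)) = aut c (\<Prod>t\<in>teich. ?f (z ^ t))"
      by (rule fix_E[symmetric]) (rule prod_teich_in_E[of ?f, OF K aut])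
    also have "\<dots> = (\<Prod>t\<in>teich. aut c (?f (z ^ t)))"
      by (rule aut_prod; intro K c)
    also have "\<dots> = (\<Prod>t\<in>teich. ?f (z ^ (c * t)))" by (simp only: aut[OF c])
    finally show ?thesis by (simp add: A_def B_def poly_prod)
  qed
  then have "range (of_nat :: nat \<Rightarrow> complex) \<subseteq> {x. poly (A - B) x = 0}" by auto
  moreover have "infinite (range (of_nat :: nat \<Rightarrow> complex))" by (rule range_inj_infinite) simp
  ultimately have "A - B = 0" using poly_roots_finite[of "A - B"] finite_subset by blast
  then have AB: "A = B" by simp
  have "poly B (z ^ c) = 0"
    unfolding B_def poly_prod prod_zero_iff[OF finite_teich] by (rule bexI[OF _ one_in_teich]) simp
  then have "\<exists>t\<in>teich. poly [:- (z ^ t), 1:] (z ^ c) = 0"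
    unfolding AB[symmetric] A_def poly_prod prod_zero_iff[OF finite_teich] .
  then obtain t where t: "t \<in> teich" "z ^ c = z ^ t" by auto
  then show ?thesis by (auto simp only: z_pow_inj)
qed

section \<open>The embeddings of E and the trace\<close>

definition emb :: "nat \<Rightarrow> complex \<Rightarrow> complex" where "emb a = restrict (aut a) E"

lemma emb_apply: "x \<in> E \<Longrightarrow> emb a x = aut a x" by (simp add: emb_def)

text \<open>If \<open>a\<close> and \<open>b\<close> agree on \<open>E\<close> and \<open>d\<close>
  is inverse to \<open>b\<close>, then \<open>d * a\<close> fixes \<open>E\<close> and is congruent
  to an element of \<open>teich\<close> by \<open>teich_if_fixes_E\<close>. Conversely
  \<open>teich\<close> acts trivially on \<open>E\<close>.\<close>

lemma emb_fibre:
  assumes b: "b \<in> units"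
  shows "{a \<in> units. emb a = emb b} = (\<lambda>t. b * t mod N) ` teich"
proof (intro equalityI subsetI)
  note b' = units_not_dvd[OF b]
  fix a assume "a \<in> (\<lambda>t. b * t mod N) ` teich"
  then obtain t where t: "t \<in> teich" "a = b * t mod N" by blast
  have "a \<in> units"
    unfolding t(2) by (rule bij_betw_apply[OF bij_units[OF b'] teich_units[OF t(1)]])
  moreover have "emb a = emb b"
    unfolding emb_def
  proof (rule restrict_ext)
    fix x assume x: "x \<in> E"
    have "aut a x = aut (b * t) x" unfolding t(2) by (rule aut_cong) (simp only: cong_def mod_mod_trivial)
    also have "\<dots> = aut b (aut t x)"
      by (rule aut_conj[OF E_in_K[OF x] b' teich_not_dvd[OF t(1)], symmetric])
    finally show "aut a x = aut b x" by (simp only: aut_teich[OF x t(1)])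
  qed
  ultimately show "a \<in> {a \<in> units. emb a = emb b}" by blast
next
  note b' = units_not_dvd[OF b]
  fix a assume "a \<in> {a \<in> units. emb a = emb b}"
  then have a: "a \<in> units" "emb a = emb b" by blast+
  note a' = units_not_dvd[OF a(1)]
  have eq: "aut a x = aut b x" if "x \<in> E" for x
    using emb_apply[OF that, of a] emb_apply[OF that, of b] a(2) by simp
  obtain d where d: "d \<in> units" "[b * d = 1] (mod N)" using units_inverse[OF b'] .
  note d' = units_not_dvd[OF d(1)]
  have d1: "[d * b = 1] (mod N)" using d(2) by (simp only: mult.commute)
  have "aut (d * a) x = x" if x: "x \<in> E" for x
  proof -
    have "aut (d * a) x = aut d (aut b x)"
      unfolding eq[OF x, symmetric] by (rule aut_conj[OF E_in_K[OF x] d' a', symmetric])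
    then show ?thesis using aut_inverse[OF E_in_K[OF x] d' b' d1] by simp
  qed
  then obtain t where t: "t \<in> teich" "[d * a = t] (mod N)"
    using teich_if_fixes_E[OF not_dvd_mult[OF d' a']] by blast
  have "[b * (d * a) = b * t] (mod N)" using t(2) by (rule cong_scalar_left)
  moreover have "[b * d * a = 1 * a] (mod N)" using d(2) by (rule cong_scalar_right)
  ultimately have "[a = b * t] (mod N)"
    by (simp only: mult.assoc mult_1) (rule cong_trans[OF cong_sym])
  then have "a = b * t mod N" using a(1) unfolding units_def cong_def by simp
  then show "a \<in> (\<lambda>t. b * t mod N) ` teich" using t(1) by blast
qed

lemma card_emb_fibre:
  assumes "b \<in> units"
  shows "card {a \<in> units. emb a = emb b} = p - 1"
proof -
  have "inj_on (\<lambda>t. b * t mod N) teich"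
    by (rule inj_on_subset[OF bij_betw_imp_inj_on[OF bij_units[OF units_not_dvd[OF assms]]]])
      (rule subsetI, rule teich_units)
  then show ?thesis unfolding emb_fibre[OF assms] by (simp only: card_image card_teich)
qed

lemma sum_units_eq_sum_emb:
  assumes "x \<in> E"
  shows "(\<Sum>a\<in>units. aut a x) = of_nat (p - 1) * (\<Sum>s\<in>emb ` units. s x)"
proof -
  have "(\<Sum>a\<in>units. aut a x) = (\<Sum>s\<in>emb ` units. \<Sum>a\<in>{a \<in> units. emb a = s}. aut a x)"
    by (rule sum.image_gen[OF finite_units])
  also have "\<dots> = (\<Sum>s\<in>emb ` units. of_nat (p - 1) * s x)"
  proof (rule sum.cong[OF refl])
    fix s assume "s \<in> emb ` units"
    then obtain b where b: "b \<in> units" "s = emb b" by blast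
    have "(\<Sum>a\<in>{a \<in> units. emb a = s}. aut a x) = (\<Sum>a\<in>{a \<in> units. emb a = s}. s x)"
      using emb_apply[OF assms] by (intro sum.cong refl) auto
    then show "(\<Sum>a\<in>{a \<in> units. emb a = s}. aut a x) = of_nat (p - 1) * s x"
      unfolding b(2) using card_emb_fibre[OF b(1)] by simp
  qed
  finally show ?thesis by (simp only: sum_distrib_left)
qed

text \<open>Averaging over \<open>teich\<close> leaves the elements of \<open>E\<close> unchanged
  and sends each power of \<open>z\<close> to a rational multiple of a Gaussian period
  \<open>y i\<close>. The periods depend on \<open>i\<close> only modulo \<open>N\<close>, so
  finitely many span \<open>E\<close>.\<close>

lemma E_eq_Span: "\<exists>Vs. CC.Span \<rat> Vs = E"
proof -
  define y where "y i = (\<Sum>t\<in>teich. z ^ (t * i))" for i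
  define Vs where "Vs = map y [0..<N]"
  have carr: "set Vs \<subseteq> carrier CC" by (simp add: CC_simps)
  note Span = CC.Span_subgroup_props[OF subfield_Rats carr, unfolded CC_simps]
    CC.Span_smult_closed[OF subfield_Rats carr, unfolded CC_simps]
  have y_E: "y i \<in> E" for i
  proof (rule E_I)
    show "y i \<in> K" unfolding y_def by (intro K_sum K_z_pow)
    fix a assume a: "a \<in> teich"
    have "aut a (y i) = (\<Sum>t\<in>teich. aut a (z ^ (t * i)))"
      unfolding y_def by (rule aut_sum; intro K_z_pow teich_not_dvd a)
    also have "\<dots> = (\<Sum>t\<in>teich. z ^ ((a * t mod N) * i))"
    proof (rule sum.cong[OF refl])
      fix t
      have "[a * t mod N * i = a * (t * i)] (mod N)"
        using cong_scalar_right[of "a * t mod N" "a * t" N i] by (simp add: cong_def mult.assoc)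
      then show "aut a (z ^ (t * i)) = z ^ ((a * t mod N) * i)"
        unfolding aut_z_pow[OF teich_not_dvd[OF a]] by (rule z_pow_cong[symmetric])
    qed
    also have "\<dots> = y i" unfolding y_def
      by (rule sum.reindex_bij_betw[OF bij_teich_mult[OF a], of "\<lambda>t. z ^ (t * i)"])
    finally show "aut a (y i) = y i" .
  qed
  have y_mod: "y (i mod N) = y i" for i
    unfolding y_def by (intro sum.cong refl z_pow_cong) (simp add: cong_def mod_mult_right_eq)
  have y_Span: "y i \<in> CC.Span \<rat> Vs" for i
  proof -
    have "y (i mod N) \<in> set Vs" unfolding Vs_def using N_pos by simp
    then show ?thesis unfolding y_mod using CC.Span_base_incl[OF subfield_Rats carr] by blast
  qed
  have sum_Span: "sum f A \<in> CC.Span \<rat> Vs" if "\<And>i. i \<in> A \<Longrightarrow> f i \<in> CC.Span \<rat> Vs" for f and A :: "nat set"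
    using that by (induction A rule: infinite_finite_induct) (simp_all add: Span del: CC.Span.simps)
  have "CC.Span \<rat> Vs = E"
  proof (intro equalityI subsetI)
    fix x assume "x \<in> CC.Span \<rat> Vs"
    then obtain Ks where Ks: "set Ks \<subseteq> \<rat>" "length Ks = length Vs" "x = CC.combine Ks Vs"
      using CC.Span_mem_iff_length_version[OF subfield_Rats carr] by blast
    have "x = (\<Sum>i<length Vs. Ks ! i * Vs ! i)" unfolding Ks(3) by (rule CC_combine[OF Ks(2)])
    also have "\<dots> \<in> E"
    proof (intro E_sum E_mult)
      fix i assume "i \<in> {..<length Vs}"
      then have i: "i < length Vs" by simp
      then have "Ks ! i \<in> \<rat>" using Ks(1,2) by (simp add: subset_iff)
      then show "Ks ! i \<in> E" by (rule Rats_cases) (simp only: E_of_rat)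
      show "Vs ! i \<in> E" using i y_E by (simp add: Vs_def)
    qed
    finally show "x \<in> E" .
  next
    fix x assume x: "x \<in> E"
    obtain f where f: "x = reval f z" using E_in_K[OF x] by (rule K_cases)
    have "of_nat (p - 1) * x = (\<Sum>t\<in>teich. aut t x)"
      using aut_teich[OF x] card_teich by simp
    also have "\<dots> = (\<Sum>t\<in>teich. \<Sum>i\<le>Polynomial.degree f. of_rat (Polynomial.coeff f i) * z ^ (t * i))"
      unfolding f by (intro sum.cong refl, subst aut_reval) (simp_all add: teich_not_dvd reval_altdef power_mult)
    also have "\<dots> = (\<Sum>i\<le>Polynomial.degree f. of_rat (Polynomial.coeff f i) * y i)"
      by (subst sum.swap) (simp add: sum_distrib_left y_def)
    also have "\<dots> \<in> CC.Span \<rat> Vs" by (intro sum_Span Span y_Span) simp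
    finally have "of_nat (p - 1) * x \<in> CC.Span \<rat> Vs" .
    moreover have "1 / of_nat (p - 1) \<in> (\<rat> :: complex set)" by (intro Rats_divide Rats_1 Rats_of_nat)
    ultimately have "1 / of_nat (p - 1) * (of_nat (p - 1) * x) \<in> CC.Span \<rat> Vs" by (rule Span(5)[rotated])
    then show "x \<in> CC.Span \<rat> Vs" using p_gt_1 by simp
  qed
  then show ?thesis by blast
qed

theorem field_trace_E:
  assumes x: "x \<in> E"
  shows "field_trace CC \<rat> E x = (\<Sum>a\<in>units. aut a x) / of_nat (p - 1)"
proof -
  obtain Vs where Vs: "CC.Span \<rat> Vs = E" using E_eq_Span by blast
  have ne: "of_nat (p - 1) \<noteq> (0 :: complex)" using p_gt_1 by simp
  have "field_trace CC \<rat> E x = (\<Sum>s\<in>emb ` units. s x)"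
  proof (rule field_trace_eq_sum_embeddings)
    show "finite (emb ` units)" "emb ` units \<noteq> {}" using finite_units one_in_units by blast+
    fix s assume "s \<in> emb ` units"
    then obtain a where a: "s = emb a" "\<not> p dvd a" using units_not_dvd by blast
    show "s (x + y) = s x + s y" "s (x * y) = s x * s y" if "x \<in> E" "y \<in> E" for x y
      using that a(2) by (simp_all add: a(1) emb_apply E_add E_mult aut_add aut_mult E_in_K)
    show "s (of_rat q) = of_rat q" for q
      using a(2) by (simp add: a(1) emb_apply E_of_rat aut_of_rat)
    fix t assume "t \<in> emb ` units" "s \<noteq> t"
    then obtain b where b: "t = emb b" by blast
    show "\<exists>x\<in>E. s x \<noteq> t x"
    proof (rule ccontr)
      assume "\<not> (\<exists>x\<in>E. s x \<noteq> t x)"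
      then have "s = t" unfolding a(1) b by (auto simp: emb_def fun_eq_iff)
      then show False using \<open>s \<noteq> t\<close> by blast
    qed
  next
    fix x assume x: "x \<in> E"
    have "(\<Sum>s\<in>emb ` units. s x) = (\<Sum>a\<in>units. aut a x) / of_nat (p - 1)"
      using sum_units_eq_sum_emb[OF x] ne by (simp add: field_simps)
    also have "\<dots> \<in> \<rat>" by (intro Rats_divide Rats_of_nat sum_aut_rational E_in_K x)
    finally show "(\<Sum>s\<in>emb ` units. s x) \<in> \<rat>" .
  qed (fact E_add, fact E_mult, fact E_of_rat, fact E_inverse, fact Vs, fact x)
  then show ?thesis using sum_units_eq_sum_emb[OF x] ne by (simp add: field_simps)
qed

section \<open>The element pi_n and its trace\<close>

lemma pi_elt_eq: "pi_elt p n z = (\<Prod>t\<in>teich. (z ^ t - 1))"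
proof -
  have "pi_elt p n z = (\<Prod>j = 1..p - 1. (z ^ (j ^ (p ^ (n - 1)) mod N) - 1))"
    unfolding pi_elt_def by (simp only: z_pow_mod)
  also have "\<dots> = (\<Prod>t\<in>teich. (z ^ t - 1))"
    by (rule prod.reindex_bij_betw[OF bij_teich, of "\<lambda>t. z ^ t - 1"])
  finally show ?thesis .
qed

lemma pi_elt_in_E: "pi_elt p n z \<in> E"
  unfolding pi_elt_eq
proof (rule prod_teich_in_E[of "\<lambda>w. w - 1"])
  show "z ^ t - 1 \<in> K" for t by (intro K_diff K_z_pow K_1)
  show "aut a (z ^ t - 1) = z ^ (a * t) - 1" if "\<not> p dvd a" for a t
    by (simp only: aut_diff[OF K_z_pow K_1 that] aut_1[OF that] aut_z_pow[OF that])
qed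

text \<open>The exponents \<open>j ^ (p ^ (n - 1))\<close> are left unreduced and the subsets are
  those of \<open>{1..p - 1}\<close>, so that the same sums occur for the p-adic roots of unity. For
  odd \<open>p\<close> the sign \<open>(- 1) ^ (p - 1 - card J)\<close> arising from the expansion
  equals \<open>(- 1) ^ card J\<close>.\<close>

lemma aut_pi_elt:
  assumes a: "\<not> p dvd a" and odd: "odd p"
  shows "aut a (pi_elt p n z) =
    (\<Sum>J\<in>Pow {1..p - 1}. (- 1) ^ card J * z ^ (a * (\<Sum>j\<in>J. j ^ (p ^ (n - 1)))))"
proof -
  let ?e = "p ^ (n - 1)"
  have "aut a (pi_elt p n z) = (\<Prod>j = 1..p - 1. aut a (z ^ (j ^ ?e) - 1))"
    unfolding pi_elt_def by (rule aut_prod; intro K_diff K_z_pow K_1 a)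
  also have "\<dots> = (\<Prod>j = 1..p - 1. (z ^ (a * j ^ ?e) + (- 1)))"
    by (intro prod.cong refl) (simp add: aut_diff[OF K_z_pow K_1 a] aut_1[OF a] aut_z_pow[OF a])
  also have "\<dots> = (\<Sum>J\<in>Pow {1..p - 1}. (\<Prod>j\<in>J. z ^ (a * j ^ ?e)) * (\<Prod>j\<in>{1..p - 1} - J. - 1))"
    by (rule prod_add_Pow) simp
  also have "\<dots> = (\<Sum>J\<in>Pow {1..p - 1}. (- 1) ^ card J * z ^ (a * (\<Sum>j\<in>J. j ^ ?e)))"
  proof (rule sum.cong[OF refl])
    fix J assume J: "J \<in> Pow {1..p - 1}"
    then have "finite J" using finite_subset by blast
    then have "card ({1..p - 1} - J) + card J = p - 1"
      using card_Diff_subset[of J "{1..p - 1}"] card_mono[of "{1..p - 1}" J] J by simp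
    then have "(- 1 :: complex) ^ card ({1..p - 1} - J) * (- 1) ^ card J = (- 1) ^ (p - 1)"
      by (simp flip: power_add)
    also have "\<dots> = 1" using odd by simp
    finally have prod: "(- 1 :: complex) ^ card ({1..p - 1} - J) * (- 1) ^ card J = 1" .
    have sq: "(- 1 :: complex) ^ card J * (- 1) ^ card J = 1" by (simp flip: power_mult_distrib)
    have "(- 1 :: complex) ^ card ({1..p - 1} - J) =
        (- 1) ^ card ({1..p - 1} - J) * ((- 1) ^ card J * (- 1) ^ card J)" by (simp only: sq mult_1_right)
    also have "\<dots> = (- 1) ^ card J" by (simp only: prod mult_1 mult.assoc[symmetric])
    finally have "(- 1 :: complex) ^ card ({1..p - 1} - J) = (- 1) ^ card J" .
    then show "(\<Prod>j\<in>J. z ^ (a * j ^ ?e)) * (\<Prod>j\<in>{1..p - 1} - J. - 1) = (- 1) ^ card J * z ^ (a * (\<Sum>j\<in>J. j ^ ?e))"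
      by (simp add: power_sum sum_distrib_left mult.commute)
  qed
  finally show ?thesis .
qed

theorem field_trace_pi_elt:
  assumes "odd p"
  shows "field_trace CC \<rat> E (pi_elt p n z) =
    (\<Sum>J\<in>Pow {1..p - 1}. (- 1) ^ card J *
       (of_nat (N * of_bool (N dvd (\<Sum>j\<in>J. j ^ (p ^ (n - 1))))) -
        of_nat (p ^ (n - 1) * of_bool (p ^ (n - 1) dvd (\<Sum>j\<in>J. j ^ (p ^ (n - 1))))))) / of_nat (p - 1)"
proof -
  have "(\<Sum>a\<in>units. aut a (pi_elt p n z)) =
      (\<Sum>a\<in>units. \<Sum>J\<in>Pow {1..p - 1}. (- 1) ^ card J * z ^ (a * (\<Sum>j\<in>J. j ^ (p ^ (n - 1)))))"
    by (intro sum.cong refl aut_pi_elt assms units_not_dvd)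
  also have "\<dots> = (\<Sum>J\<in>Pow {1..p - 1}. (- 1) ^ card J * (\<Sum>a\<in>units. z ^ (a * (\<Sum>j\<in>J. j ^ (p ^ (n - 1))))))"
    by (subst sum.swap) (simp only: sum_distrib_left)
  finally show ?thesis unfolding field_trace_E[OF pi_elt_in_E] sum_units_pow by (rule arg_cong)
qed

text \<open>Taken over the distinct embeddings, the sum involves no division by \<open>p - 1\<close>
  and stays in Z[z]; it is rational as well, hence an integer.\<close>

lemma field_trace_pi_elt_Ints: "field_trace CC \<rat> E (pi_elt p n z) \<in> \<int>"
proof -
  let ?t = "\<Sum>s\<in>emb ` units. s (pi_elt p n z)"
  have ne: "of_nat (p - 1) \<noteq> (0 :: complex)" using p_gt_1 by simp
  then have eq: "field_trace CC \<rat> E (pi_elt p n z) = ?t"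
    unfolding field_trace_E[OF pi_elt_in_E] sum_units_eq_sum_emb[OF pi_elt_in_E] by simp
  have "?t \<in> ipoly_ring z"
  proof (rule ipoly_ring_sum)
    fix s assume "s \<in> emb ` units"
    then obtain a where a: "s = emb a" "\<not> p dvd a" using units_not_dvd by blast
    have "s (pi_elt p n z) = aut a (pi_elt p n z)"
      unfolding a(1) by (rule emb_apply[OF pi_elt_in_E])
    also have "\<dots> = aut a (\<Prod>t\<in>teich. (z ^ t - 1))" by (simp only: pi_elt_eq)
    also have "\<dots> = (\<Prod>t\<in>teich. aut a (z ^ t - 1))"
      by (rule aut_prod; intro K_diff K_z_pow K_1 a)
    also have "\<dots> = (\<Prod>t\<in>teich. z ^ (a * t) - 1)"
      by (simp only: aut_diff[OF K_z_pow K_1 a(2)] aut_1[OF a(2)] aut_z_pow[OF a(2)])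
    also have "\<dots> \<in> ipoly_ring z"
      by (intro ipoly_ring_prod ipoly_ring_diff ipoly_ring_power ipoly_ring_gen ipoly_ring_1)
    finally show "s (pi_elt p n z) \<in> ipoly_ring z" .
  qed
  moreover have "?t \<in> \<rat>"
  proof -
    have "?t = (\<Sum>a\<in>units. aut a (pi_elt p n z)) / of_nat (p - 1)"
      unfolding sum_units_eq_sum_emb[OF pi_elt_in_E] using ne by simp
    also have "\<dots> \<in> \<rat>" by (intro Rats_divide Rats_of_nat sum_aut_rational E_in_K pi_elt_in_E)
    finally show ?thesis .
  qed
  ultimately show ?thesis
    unfolding eq by (rule ipoly_ring_rational_is_int[OF N_pos z_pow_N])
qed

end

section \<open>Roots of unity in the p-adic numbers\<close>

text \<open>The fraction need not be in lowest terms: cross-multiply with the reduced one and use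
  additivity of the multiplicity.\<close>

lemma rat_pval_fraction:
  assumes p: "prime p" and "a \<noteq> 0" "b \<noteq> 0"
  shows "rat_pval p (of_int a / of_int b) =
    Fin (int (multiplicity (int p) a) - int (multiplicity (int p) b))"
proof -
  define x :: rat where "x = of_int a / of_int b"
  obtain c d where cd: "quotient_of x = (c, d)" by fastforce
  have x: "x = of_int c / of_int d" "d > 0"
    using cd by (rule quotient_of_div, rule quotient_of_denom_pos)
  have "x \<noteq> 0" using assms by (simp add: x_def)
  have nz: "c \<noteq> 0" "d \<noteq> 0"
  proof
    assume "c = 0"
    then have "x = 0" unfolding x(1) by simp
    then show False using \<open>x \<noteq> 0\<close> by blast
  qed (use x(2) in simp)
  have "of_int a / of_int b = (of_int c / of_int d :: rat)" using x(1) unfolding x_def .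
  then have "of_int a * of_int d = (of_int c * of_int b :: rat)"
    using assms(3) nz(2) by (subst (asm) frac_eq_eq) simp_all
  then have "a * d = c * b" unfolding of_int_mult[symmetric] by (simp only: of_int_eq_iff)
  then have eq: "multiplicity (int p) (a * d) = multiplicity (int p) (c * b)" by (rule arg_cong)
  have "prime_elem (int p)" using p by simp
  note mult = prime_elem_multiplicity_mult_distrib[OF this]
  have "int (multiplicity (int p) c) - int (multiplicity (int p) d) =
      int (multiplicity (int p) a) - int (multiplicity (int p) b)"
    using eq unfolding mult[OF assms(2) nz(2)] mult[OF nz(1) assms(3)] by linarith
  moreover have "rat_pval p x = Fin (int (multiplicity (int p) c) - int (multiplicity (int p) d))"
    unfolding rat_pval_def cd using \<open>x \<noteq> 0\<close> by (simp only: if_False fst_conv snd_conv)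
  ultimately show ?thesis unfolding x_def by (simp only:)
qed

section \<open>The p-adic valuation on the rationals\<close>

locale padic =
  fixes p :: nat
  assumes prime: "prime p"
begin

text \<open>Lower bounds as a predicate: it holds of 0 for every \<open>k\<close>, which spares most
  arguments the infinite value.\<close>

definition val_ge :: "int \<Rightarrow> rat \<Rightarrow> bool" where "val_ge k x \<longleftrightarrow> Fin k \<le> rat_pval p x"

lemma p_gt_1: "p > 1" using prime prime_gt_1_nat by blast

lemma val_ge_0 [simp]: "val_ge k 0"
  by (simp add: val_ge_def rat_pval_def)

text \<open>Over a fixed denominator a lower bound is divisibility of the numerator, so the
  ultrametric inequality becomes \<open>dvd_add\<close>. Where the exponent would be negative,
  \<open>nat\<close> makes it 0 and both sides are true.\<close>

lemma val_ge_fraction: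
  assumes "c \<noteq> 0"
  shows "val_ge k (of_int a / of_int c) \<longleftrightarrow> int p ^ nat (k + int (multiplicity (int p) c)) dvd a"
proof (cases "a = 0")
  case False
  have "\<not> is_unit (int p)" using p_gt_1 by simp
  then have iff: "int p ^ m dvd a \<longleftrightarrow> m \<le> multiplicity (int p) a" for m
    using False by (intro power_dvd_iff_le_multiplicity) auto
  show ?thesis unfolding val_ge_def rat_pval_fraction[OF prime False assms] iff
    by (simp add: nat_le_iff le_diff_eq)
qed simp

lemma rat_common_denominator:
  fixes x y :: rat
  shows "\<exists>a b c :: int. c \<noteq> 0 \<and> x = of_int a / of_int c \<and> y = of_int b / of_int c"
proof -
  obtain a c where ac: "quotient_of x = (a, c)" by fastforce
  obtain b d where bd: "quotient_of y = (b, d)" by fastforce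
  have x: "x = of_int a / of_int c" "c > 0" using ac by (rule quotient_of_div, rule quotient_of_denom_pos)
  have y: "y = of_int b / of_int d" "d > 0" using bd by (rule quotient_of_div, rule quotient_of_denom_pos)
  have "c * d \<noteq> 0" using x(2) y(2) by simp
  moreover have "x = of_int (a * d) / of_int (c * d)" unfolding x(1) using y(2) by simp
  moreover have "y = of_int (b * c) / of_int (c * d)" unfolding y(1) using x(2) by simp
  ultimately show ?thesis by (intro exI conjI)
qed

lemma val_ge_add:
  assumes "val_ge k x" "val_ge k y"
  shows "val_ge k (x + y)"
proof -
  obtain a b c :: int where abc: "c \<noteq> 0" "x = of_int a / of_int c" "y = of_int b / of_int c"
    using rat_common_denominator[of x y] by (elim exE conjE) (rule that)
  have "x + y = of_int (a + b) / of_int c" unfolding abc(2,3) by (simp only: of_int_add add_divide_distrib)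
  moreover have "val_ge k (of_int (a + b) / of_int c)"
    using assms unfolding abc(2,3) val_ge_fraction[OF abc(1)] by (rule dvd_add)
  ultimately show ?thesis by (simp only:)
qed

lemma val_ge_uminus:
  assumes "val_ge k x"
  shows "val_ge k (- x)"
proof -
  obtain a b c :: int where ac: "c \<noteq> 0" "x = of_int a / of_int c" "x = of_int b / of_int c"
    using rat_common_denominator[of x x] by (elim exE conjE) (rule that)
  have "- x = of_int (- a) / of_int c" unfolding ac(2) by (simp only: of_int_minus minus_divide_left)
  moreover have "val_ge k (of_int (- a) / of_int c)"
    using assms unfolding ac(2) val_ge_fraction[OF ac(1)] by (simp only: dvd_minus_iff)
  ultimately show ?thesis by (simp only:)
qed

lemma val_ge_diff: "val_ge k x \<Longrightarrow> val_ge k y \<Longrightarrow> val_ge k (x - y)"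
  using val_ge_add[of k x "- y"] val_ge_uminus[of k y] by simp

lemma val_ge_of_int: "val_ge (int n) (of_int a) \<longleftrightarrow> int p ^ n dvd a"
  using val_ge_fraction[of 1 "int n" a] by simp

lemma val_ge_of_nat: "val_ge (int n) (of_nat a) \<longleftrightarrow> p ^ n dvd a"
  using val_ge_of_int[of n "int a"] by (simp flip: of_nat_power)

lemma val_ge_mono: "val_ge k x \<Longrightarrow> l \<le> k \<Longrightarrow> val_ge l x"
  unfolding val_ge_def using order_trans[of "Fin l" "Fin k"] by simp

lemma rat_pval_cases:
  obtains "x = 0" | w where "x \<noteq> 0" "rat_pval p x = Fin w"
  by (cases "x = 0") (auto simp: rat_pval_def)

lemma rat_pval_mult:
  assumes "rat_pval p x = Fin k" "rat_pval p y = Fin l"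
  shows "rat_pval p (x * y) = Fin (k + l)"
proof -
  obtain a b c where abc: "c \<noteq> 0" "x = of_int a / of_int c" "y = of_int b / of_int c"
    using rat_common_denominator[of x y] by (elim exE conjE) (rule that)
  have "x \<noteq> 0" "y \<noteq> 0" using assms by (auto simp: rat_pval_def)
  then have nz: "a \<noteq> 0" "b \<noteq> 0" using abc by auto
  have "prime_elem (int p)" using prime by simp
  then have m: "multiplicity (int p) (u * v) = multiplicity (int p) u + multiplicity (int p) v"
    if "u \<noteq> 0" "v \<noteq> 0" for u v
    using that by (rule prime_elem_multiplicity_mult_distrib)
  have "x * y = of_int (a * b) / of_int (c * c)" unfolding abc by simp
  then have "rat_pval p (x * y) = Fin (int (multiplicity (int p) (a * b)) - int (multiplicity (int p) (c * c)))"
    using rat_pval_fraction[OF prime, of "a * b" "c * c"] nz abc(1) by simp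
  then show ?thesis
    using assms rat_pval_fraction[OF prime nz(1) abc(1)] rat_pval_fraction[OF prime nz(2) abc(1)]
    unfolding abc by (simp add: m nz abc(1))
qed

lemma val_ge_mult:
  assumes "val_ge k x" "val_ge l y"
  shows "val_ge (k + l) (x * y)"
proof (cases x rule: rat_pval_cases)
  case x: (2 w)
  show ?thesis
  proof (cases y rule: rat_pval_cases)
    case y: (2 v)
    show ?thesis using assms unfolding val_ge_def rat_pval_mult[OF x(2) y(2)] by (simp add: x y)
  qed simp
qed simp

lemma val_ge_0_mult: "val_ge 0 x \<Longrightarrow> val_ge k y \<Longrightarrow> val_ge k (x * y)"
  using val_ge_mult[of 0 x k y] by simp

lemma val_ge_unit_cancel:
  assumes "val_ge 0 s" "\<not> val_ge 1 s" "val_ge k (x * s)"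
  shows "val_ge k x"
proof (cases x rule: rat_pval_cases)
  case x: (2 w)
  have s: "rat_pval p s = Fin 0"
    using assms(1,2) val_ge_0[of 1] by (cases s rule: rat_pval_cases) (auto simp: val_ge_def)
  show ?thesis using assms(3) unfolding val_ge_def rat_pval_mult[OF x(2) s] by (simp add: x)
qed simp

lemma val_ge_sum: "(\<And>i. i \<in> A \<Longrightarrow> val_ge k (f i)) \<Longrightarrow> val_ge k (sum f A)"
  by (induction A rule: infinite_finite_induct) (auto intro: val_ge_add)

lemma val_ge_power: "val_ge 0 x \<Longrightarrow> val_ge 0 (x ^ k)"
  using val_ge_of_int[of 0 1] by (induction k) (auto intro: val_ge_0_mult)

lemma val_ge_exists: "\<exists>k. val_ge k x"
proof (cases x rule: rat_pval_cases)
  case (2 w)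
  then show ?thesis by (intro exI[of _ w]) (simp add: val_ge_def)
qed simp

section \<open>Cauchy sequences and null sequences\<close>

lemma Cauchy_iff: "x \<in> padic_Cauchy p \<longleftrightarrow> (\<forall>k. \<exists>M. \<forall>i\<ge>M. \<forall>j\<ge>M. val_ge k (x i - x j))"
  by (simp add: padic_Cauchy_def val_ge_def)

lemma null_iff: "x \<in> padic_null p \<longleftrightarrow> (\<forall>k. \<exists>M. \<forall>i\<ge>M. val_ge k (x i))"
  by (simp add: padic_null_def val_ge_def)

lemma null_Cauchy:
  assumes "x \<in> padic_null p"
  shows "x \<in> padic_Cauchy p"
  unfolding Cauchy_iff
proof
  fix k
  obtain M where M: "\<forall>i\<ge>M. val_ge k (x i)" using assms unfolding null_iff by blast
  show "\<exists>M. \<forall>i\<ge>M. \<forall>j\<ge>M. val_ge k (x i - x j)"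
    by (intro exI[of _ M] allI impI val_ge_diff) (simp_all add: M)
qed

lemma null_add:
  assumes "x \<in> padic_null p" "y \<in> padic_null p"
  shows "(\<lambda>i. x i + y i) \<in> padic_null p"
  unfolding null_iff
proof
  fix k
  obtain M where M: "\<forall>i\<ge>M. val_ge k (x i)" using assms(1) unfolding null_iff by blast
  obtain L where L: "\<forall>i\<ge>L. val_ge k (y i)" using assms(2) unfolding null_iff by blast
  show "\<exists>M. \<forall>i\<ge>M. val_ge k (x i + y i)"
    by (intro exI[of _ "max M L"]) (simp add: val_ge_add M L)
qed

lemma null_uminus: "x \<in> padic_null p \<Longrightarrow> (\<lambda>i. - x i) \<in> padic_null p"
  unfolding null_iff using val_ge_uminus by blast

lemma null_zero: "(\<lambda>_. 0) \<in> padic_null p" by (simp add: null_iff)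

lemma Cauchy_const: "(\<lambda>_. c) \<in> padic_Cauchy p" by (simp add: Cauchy_iff)

lemma Cauchy_add:
  assumes "x \<in> padic_Cauchy p" "y \<in> padic_Cauchy p"
  shows "(\<lambda>i. x i + y i) \<in> padic_Cauchy p"
  unfolding Cauchy_iff
proof
  fix k
  obtain M where M: "\<forall>i\<ge>M. \<forall>j\<ge>M. val_ge k (x i - x j)" using assms(1) unfolding Cauchy_iff by blast
  obtain L where L: "\<forall>i\<ge>L. \<forall>j\<ge>L. val_ge k (y i - y j)" using assms(2) unfolding Cauchy_iff by blast
  have "val_ge k (x i + y i - (x j + y j))" if "i \<ge> max M L" "j \<ge> max M L" for i j
    using val_ge_add[of k "x i - x j" "y i - y j"] M L that by (simp add: algebra_simps)
  then show "\<exists>M. \<forall>i\<ge>M. \<forall>j\<ge>M. val_ge k (x i + y i - (x j + y j))" by blast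
qed

lemma Cauchy_uminus:
  assumes "x \<in> padic_Cauchy p"
  shows "(\<lambda>i. - x i) \<in> padic_Cauchy p"
  unfolding Cauchy_iff
proof
  fix k
  obtain M where M: "\<forall>i\<ge>M. \<forall>j\<ge>M. val_ge k (x i - x j)" using assms unfolding Cauchy_iff by blast
  have "val_ge k (- x i - - x j)" if "i \<ge> M" "j \<ge> M" for i j
    using M that by simp
  then show "\<exists>M. \<forall>i\<ge>M. \<forall>j\<ge>M. val_ge k (- x i - - x j)" by blast
qed

lemma Cauchy_bounded:
  assumes "x \<in> padic_Cauchy p"
  shows "\<exists>B M. \<forall>i\<ge>M. val_ge B (x i)"
proof -
  obtain M where M: "\<forall>i\<ge>M. \<forall>j\<ge>M. val_ge 0 (x i - x j)" using assms unfolding Cauchy_iff by blast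
  obtain k where k: "val_ge k (x M)" using val_ge_exists by blast
  have "val_ge (min 0 k) (x i)" if "i \<ge> M" for i
  proof -
    have "val_ge (min 0 k) (x i - x M)" by (rule val_ge_mono[of 0]) (use M that in simp_all)
    moreover have "val_ge (min 0 k) (x M)" by (rule val_ge_mono[OF k]) simp
    ultimately have "val_ge (min 0 k) ((x i - x M) + x M)" by (rule val_ge_add)
    then show ?thesis by simp
  qed
  then show ?thesis by blast
qed

lemma null_mult:
  assumes "x \<in> padic_Cauchy p" "y \<in> padic_null p"
  shows "(\<lambda>i. x i * y i) \<in> padic_null p"
  unfolding null_iff
proof
  fix k
  obtain B M where B: "\<And>i. i \<ge> M \<Longrightarrow> val_ge B (x i)" using Cauchy_bounded[OF assms(1)] by blast
  obtain L where L: "\<forall>i\<ge>L. val_ge (k - B) (y i)" using assms(2) unfolding null_iff by blast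
  have "val_ge k (x i * y i)" if "i \<ge> max M L" for i
    using val_ge_mult[of B "x i" "k - B" "y i"] B L that by simp
  then show "\<exists>M. \<forall>i\<ge>M. val_ge k (x i * y i)" by blast
qed

lemma Cauchy_mult:
  assumes "x \<in> padic_Cauchy p" "y \<in> padic_Cauchy p"
  shows "(\<lambda>i. x i * y i) \<in> padic_Cauchy p"
  unfolding Cauchy_iff
proof
  fix k
  obtain A M where A: "\<And>i. i \<ge> M \<Longrightarrow> val_ge A (x i)" using Cauchy_bounded[OF assms(1)] by blast
  obtain B L where B: "\<And>i. i \<ge> L \<Longrightarrow> val_ge B (y i)" using Cauchy_bounded[OF assms(2)] by blast
  obtain M' where M': "\<forall>i\<ge>M'. \<forall>j\<ge>M'. val_ge (k - B) (x i - x j)"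
    using assms(1) unfolding Cauchy_iff by blast
  obtain L' where L': "\<forall>i\<ge>L'. \<forall>j\<ge>L'. val_ge (k - A) (y i - y j)"
    using assms(2) unfolding Cauchy_iff by blast
  define m where "m = M + L + M' + L'"
  have m: "M \<le> m" "L \<le> m" "M' \<le> m" "L' \<le> m" by (simp_all add: m_def)
  have "val_ge k (x i * y i - x j * y j)" if ij: "i \<ge> m" "j \<ge> m" for i j
  proof -
    have "val_ge (A + (k - A)) (x i * (y i - y j))"
      by (rule val_ge_mult) (use m ij A L' in simp_all)
    moreover have "val_ge (B + (k - B)) (y j * (x i - x j))"
      by (rule val_ge_mult) (use m ij B M' in simp_all)
    moreover have "x i * y i - x j * y j = x i * (y i - y j) + y j * (x i - x j)"
      by (simp add: algebra_simps)
    ultimately show ?thesis by (simp add: val_ge_add)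
  qed
  then show "\<exists>M. \<forall>i\<ge>M. \<forall>j\<ge>M. val_ge k (x i * y i - x j * y j)" by blast
qed

section \<open>The quotient ring and the valuation of a class\<close>

abbreviation R where "R \<equiv> padic_Cauchy_ring p"

abbreviation Q where "Q \<equiv> Qp p"

lemma R_simps: "carrier R = padic_Cauchy p" "x \<otimes>\<^bsub>R\<^esub> y = (\<lambda>i. x i * y i)" "x \<oplus>\<^bsub>R\<^esub> y = (\<lambda>i. x i + y i)"
    "\<one>\<^bsub>R\<^esub> = (\<lambda>_. 1)" "\<zero>\<^bsub>R\<^esub> = (\<lambda>_. 0)"
  by (simp_all add: padic_Cauchy_ring_def)

lemma cring_R: "cring R"
proof (rule cringI)
  show "abelian_group R"
  proof (rule abelian_groupI)
    fix x assume "x \<in> carrier R"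
    then show "\<exists>y\<in>carrier R. y \<oplus>\<^bsub>R\<^esub> x = \<zero>\<^bsub>R\<^esub>"
      by (intro bexI[of _ "\<lambda>i. - x i"]) (simp_all add: R_simps Cauchy_uminus)
  qed (auto simp: R_simps Cauchy_add Cauchy_const add_ac)
  show "comm_monoid R"
    by (rule comm_monoidI) (auto simp: R_simps Cauchy_mult Cauchy_const mult_ac)
qed (auto simp: R_simps distrib_right)

sublocale R: cring R by (rule cring_R)

lemma R_uminus: "x \<in> padic_Cauchy p \<Longrightarrow> \<ominus>\<^bsub>R\<^esub> x = (\<lambda>i. - x i)"
  by (rule R.minus_equality) (simp_all add: R_simps Cauchy_uminus)

lemma ideal_null: "ideal (padic_null p) R"
proof (rule idealI)
  show "subgroup (padic_null p) (add_monoid R)"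
  proof (rule R.add.subgroupI)
    show "padic_null p \<subseteq> carrier R" using null_Cauchy by (auto simp: R_simps)
    show "padic_null p \<noteq> {}" using null_zero by blast
    show "\<ominus>\<^bsub>R\<^esub> x \<in> padic_null p" if "x \<in> padic_null p" for x
      using R_uminus[OF null_Cauchy[OF that]] null_uminus[OF that] by simp
    show "x \<oplus>\<^bsub>R\<^esub> y \<in> padic_null p" if "x \<in> padic_null p" "y \<in> padic_null p" for x y
      using null_add[OF that] by (simp add: R_simps)
  qed
  fix a x assume "a \<in> padic_null p" "x \<in> carrier R"
  then show "x \<otimes>\<^bsub>R\<^esub> a \<in> padic_null p" "a \<otimes>\<^bsub>R\<^esub> x \<in> padic_null p"
    using null_mult[of x a] by (simp_all add: R_simps mult.commute)
qed (rule R.ring_axioms)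

lemma cring_Q: "cring Q"
  unfolding Qp_def by (rule ideal.quotient_is_cring[OF ideal_null cring_R])

sublocale Q: cring Q by (rule cring_Q)

definition cls :: "(nat \<Rightarrow> rat) \<Rightarrow> (nat \<Rightarrow> rat) set" where "cls x = padic_null p +>\<^bsub>R\<^esub> x"

lemma cls_hom: "cls \<in> Ring.ring_hom R Q"
  using ideal.rcos_ring_hom[OF ideal_null] unfolding cls_def Qp_def .

lemma mem_cls_iff: "y \<in> cls x \<longleftrightarrow> (\<lambda>i. y i - x i) \<in> padic_null p"
proof
  assume "y \<in> cls x"
  then obtain h where "h \<in> padic_null p" "y = (\<lambda>i. h i + x i)"
    by (auto simp: cls_def a_r_coset_def' R_simps)
  then show "(\<lambda>i. y i - x i) \<in> padic_null p" by simp
next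
  assume h: "(\<lambda>i. y i - x i) \<in> padic_null p"
  show "y \<in> cls x" unfolding cls_def a_r_coset_def' R_simps by (rule UN_I[OF h]) simp
qed

lemma cls_eq_iff: "cls x = cls y \<longleftrightarrow> (\<lambda>i. x i - y i) \<in> padic_null p"
proof
  assume "cls x = cls y"
  moreover have "x \<in> cls x" by (simp add: mem_cls_iff null_zero)
  ultimately show "(\<lambda>i. x i - y i) \<in> padic_null p" by (simp add: mem_cls_iff)
next
  assume h: "(\<lambda>i. x i - y i) \<in> padic_null p"
  show "cls x = cls y"
  proof (rule Set.set_eqI, rule iffI)
    fix w assume "w \<in> cls x"
    then show "w \<in> cls y" using null_add[OF _ h, of "\<lambda>i. w i - x i"] by (simp add: mem_cls_iff)
  next
    fix w assume "w \<in> cls y"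
    then show "w \<in> cls x" using null_add[OF _ null_uminus[OF h], of "\<lambda>i. w i - y i"] by (simp add: mem_cls_iff)
  qed
qed

lemma Q_zero: "\<zero>\<^bsub>Q\<^esub> = cls (\<lambda>_. 0)"
  using ring_hom_zero[OF cls_hom R.ring_axioms Q.ring_axioms] by (simp add: R_simps)

lemma cls_eq_zero_iff: "cls x = \<zero>\<^bsub>Q\<^esub> \<longleftrightarrow> x \<in> padic_null p"
  unfolding Q_zero cls_eq_iff by simp

lemma Q_one: "\<one>\<^bsub>Q\<^esub> = cls (\<lambda>_. 1)"
  using ring_hom_one[OF cls_hom] by (simp add: R_simps)

lemma cls_in_carrier: "x \<in> padic_Cauchy p \<Longrightarrow> cls x \<in> carrier Q"
  using ring_hom_closed[OF cls_hom, of x] by (simp add: R_simps)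

lemma carrier_Q: "carrier Q = cls ` padic_Cauchy p"
  by (auto simp: Qp_def FactRing_def A_RCOSETS_def' cls_def R_simps)

lemma cls_mult: "x \<in> padic_Cauchy p \<Longrightarrow> y \<in> padic_Cauchy p \<Longrightarrow> cls x \<otimes>\<^bsub>Q\<^esub> cls y = cls (\<lambda>i. x i * y i)"
  using ring_hom_mult[OF cls_hom, of x y] by (simp add: R_simps)

lemma cls_add: "x \<in> padic_Cauchy p \<Longrightarrow> y \<in> padic_Cauchy p \<Longrightarrow> cls x \<oplus>\<^bsub>Q\<^esub> cls y = cls (\<lambda>i. x i + y i)"
  using ring_hom_add[OF cls_hom, of x y] by (simp add: R_simps)

lemma Cauchy_power: "x \<in> padic_Cauchy p \<Longrightarrow> (\<lambda>i. x i ^ k) \<in> padic_Cauchy p"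
  by (induction k) (simp_all add: Cauchy_const Cauchy_mult)

lemma cls_pow: "x \<in> padic_Cauchy p \<Longrightarrow> cls x [^]\<^bsub>Q\<^esub> (k :: nat) = cls (\<lambda>i. x i ^ k)"
  by (induction k) (simp_all add: Q_one cls_mult Cauchy_power mult.commute)

lemma Cauchy_sum: "(\<And>j. j \<in> A \<Longrightarrow> f j \<in> padic_Cauchy p) \<Longrightarrow> (\<lambda>i. \<Sum>j\<in>A. f j i) \<in> padic_Cauchy p"
  by (induction A rule: infinite_finite_induct) (simp_all add: Cauchy_const Cauchy_add)

lemma cls_finsum:
  assumes "finite A" "\<And>j. j \<in> A \<Longrightarrow> f j \<in> padic_Cauchy p"
  shows "(\<Oplus>\<^bsub>Q\<^esub>j\<in>A. cls (f j)) = cls (\<lambda>i. \<Sum>j\<in>A. f j i)"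
  using assms
proof (induction A rule: finite_induct)
  case (insert a A)
  then have "(\<Oplus>\<^bsub>Q\<^esub>j\<in>insert a A. cls (f j)) = cls (f a) \<oplus>\<^bsub>Q\<^esub> (\<Oplus>\<^bsub>Q\<^esub>j\<in>A. cls (f j))"
    by (intro Q.finsum_insert) (auto intro: cls_in_carrier)
  then show ?case using insert by (simp add: cls_add Cauchy_sum)
qed (simp add: Q_zero)

lemma val_ge_cong:
  assumes "val_ge k (x - y)"
  shows "val_ge k x \<longleftrightarrow> val_ge k y"
proof
  assume "val_ge k x"
  then have "val_ge k (x - (x - y))" using assms by (rule val_ge_diff)
  then show "val_ge k y" by simp
next
  assume "val_ge k y"
  then have "val_ge k ((x - y) + y)" using assms by (intro val_ge_add)
  then show "val_ge k x" by simp
qed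

text \<open>Take a bound \<open>k\<close> that fails for arbitrarily late terms, and
  \<open>M\<close> from which on the terms differ by valuation at least \<open>k\<close>. A failing
  term beyond \<open>M\<close> has valuation \<open>w < k\<close>, and by the ultrametric inequality
  all terms from \<open>M\<close> on share it.\<close>

lemma Cauchy_not_null_val:
  assumes x: "x \<in> padic_Cauchy p" "x \<notin> padic_null p"
  shows "\<exists>w M. \<forall>i\<ge>M. rat_pval p (x i) = Fin w"
proof -
  obtain k where k: "\<And>M. \<exists>i\<ge>M. \<not> val_ge k (x i)" using x(2) unfolding null_iff by blast
  obtain M where M: "\<And>i j. i \<ge> M \<Longrightarrow> j \<ge> M \<Longrightarrow> val_ge k (x i - x j)"
    using x(1) unfolding Cauchy_iff by blast
  obtain m where m: "m \<ge> M" "\<not> val_ge k (x m)" using k by blast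
  then have "x m \<noteq> 0" by auto
  then obtain w where w: "rat_pval p (x m) = Fin w" by (cases "x m" rule: rat_pval_cases) auto
  then have wk: "w < k" using m(2) by (simp add: val_ge_def)
  have iff: "val_ge l (x i) \<longleftrightarrow> l \<le> w" if "i \<ge> M" "l \<le> k" for i l
  proof -
    have "val_ge l (x i - x m)" by (rule val_ge_mono[OF M[OF that(1) m(1)] that(2)])
    then have "val_ge l (x i) \<longleftrightarrow> val_ge l (x m)" by (rule val_ge_cong)
    then show ?thesis using w by (simp add: val_ge_def)
  qed
  \<comment> \<open>The bounds \<open>w\<close> and \<open>w + 1\<close> together pin down an
    integer valuation, and \<open>w + 1\<close> does not exceed \<open>k\<close>.\<close>
  have "rat_pval p (x i) = Fin w" if i: "i \<ge> M" for i
    using iff[OF i, of w] iff[OF i, of "w + 1"] wk val_ge_0[of "w + 1"]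
    by (cases "x i" rule: rat_pval_cases) (auto simp: val_ge_def)
  then show ?thesis by blast
qed

text \<open>The description in \<open>padic_val\<close> admits any representative. Two of them
  differ by a null sequence, whose terms eventually have valuation above \<open>w\<close> and so do
  not affect the value.\<close>

lemma padic_val_cls:
  assumes "x \<in> padic_Cauchy p" "x \<notin> padic_null p"
  shows "\<exists>w. padic_val p (cls x) = Fin w \<and> (\<exists>M. \<forall>i\<ge>M. rat_pval p (x i) = Fin w)"
proof -
  obtain w M where w: "\<And>i. i \<ge> M \<Longrightarrow> rat_pval p (x i) = Fin w"
    using Cauchy_not_null_val[OF assms] by blast
  have "(THE v. \<exists>y\<in>cls x. \<forall>\<^sub>F k in sequentially. rat_pval p (y k) = v) = Fin w"
  proof (rule the_equality)
    have "x \<in> cls x" by (simp add: mem_cls_iff null_zero)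
    moreover have "\<forall>\<^sub>F k in sequentially. rat_pval p (x k) = Fin w"
      using w by (auto simp: eventually_sequentially)
    ultimately show "\<exists>y\<in>cls x. \<forall>\<^sub>F k in sequentially. rat_pval p (y k) = Fin w" by blast
  next
    fix v assume "\<exists>y\<in>cls x. \<forall>\<^sub>F k in sequentially. rat_pval p (y k) = v"
    then obtain y where y: "y \<in> cls x" "\<forall>\<^sub>F k in sequentially. rat_pval p (y k) = v" by blast
    obtain L where L: "\<forall>i\<ge>L. rat_pval p (y i) = v"
      using y(2) unfolding eventually_sequentially by blast
    obtain L' where L': "\<And>i. i \<ge> L' \<Longrightarrow> val_ge (w + 1) (y i - x i)"
      using y(1) unfolding mem_cls_iff null_iff by blast
    define m where "m = max M (max L L')"
    have d: "val_ge (w + 1) (y m - x m)" by (rule L') (simp add: m_def)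
    have iff: "val_ge l (y m) \<longleftrightarrow> val_ge l (x m)" if "l \<le> w + 1" for l
      by (rule val_ge_cong[OF val_ge_mono[OF d that]])
    have xm: "rat_pval p (x m) = Fin w" by (rule w) (simp add: m_def)
    have "rat_pval p (y m) = Fin w"
      using iff[of w] iff[of "w + 1"] xm val_ge_0[of "w + 1"]
      by (cases "y m" rule: rat_pval_cases) (auto simp: val_ge_def)
    moreover have "rat_pval p (y m) = v" by (rule L[rule_format]) (simp add: m_def)
    ultimately show "v = Fin w" by simp
  qed
  then have "padic_val p (cls x) = Fin w"
    unfolding padic_val_def cls_eq_zero_iff using assms(2) by simp
  then show ?thesis using w by blast
qed

text \<open>A null sequence eventually meets every bound, in accordance with the infinite value of
  the zero class; for the others the valuations of the terms become constant.\<close>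

lemma padic_val_ge_iff:
  assumes "x \<in> padic_Cauchy p"
  shows "Fin k \<le> padic_val p (cls x) \<longleftrightarrow> (\<exists>M. \<forall>i\<ge>M. val_ge k (x i))"
proof (cases "x \<in> padic_null p")
  case True
  then show ?thesis unfolding padic_val_def cls_eq_zero_iff by (simp add: null_iff)
next
  case False
  obtain w M where w: "padic_val p (cls x) = Fin w" "\<And>i. i \<ge> M \<Longrightarrow> rat_pval p (x i) = Fin w"
    using padic_val_cls[OF assms False] by blast
  have "(\<exists>M. \<forall>i\<ge>M. val_ge k (x i)) \<longleftrightarrow> k \<le> w"
  proof
    assume "\<exists>M. \<forall>i\<ge>M. val_ge k (x i)"
    then obtain L where "\<forall>i\<ge>L. val_ge k (x i)" by blast
    then have "val_ge k (x (max L M))" by simp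
    then show "k \<le> w" using w(2)[of "max L M"] by (simp add: val_ge_def)
  next
    assume "k \<le> w"
    then show "\<exists>M. \<forall>i\<ge>M. val_ge k (x i)" using w(2) by (intro exI[of _ M]) (simp add: val_ge_def)
  qed
  then show ?thesis by (simp add: w(1))
qed

section \<open>Teichmueller sequences and the roots of unity\<close>

text \<open>A rational sequence whose p-adic limit is the Teichmueller representative of
  \<open>j\<close>.\<close>

definition tau :: "nat \<Rightarrow> nat \<Rightarrow> rat" where "tau j i = of_nat (j ^ (p ^ i))"

lemma pow_p_power_cong:
  assumes "M \<le> i"
  shows "[j ^ (p ^ i) = j ^ (p ^ M)] (mod p ^ Suc M)"
proof -
  obtain d where d: "i = d + M" using assms by (metis add.commute le_Suc_ex)
  have "[(j ^ (p ^ d)) ^ (p ^ M) = j ^ (p ^ M)] (mod p ^ Suc M)"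
    by (rule cong_pow_prime_power_nat[OF cong_pow_p_power_self[OF prime]])
  then show ?thesis unfolding d power_add[of p d M] by (simp only: power_mult)
qed

lemma val_ge_cong_nat:
  assumes "[a = b] (mod p ^ n)"
  shows "val_ge (int n) (of_nat a - of_nat b)"
proof -
  have "[int a = int b] (mod int (p ^ n))" using assms by (simp only: cong_int_iff)
  then have "int p ^ n dvd int a - int b" by (simp add: cong_iff_dvd_diff)
  then have "val_ge (int n) (of_int (int a - int b))" by (simp only: val_ge_of_int)
  then show ?thesis by simp
qed

lemma tau_Cauchy: "tau j \<in> padic_Cauchy p"
  unfolding Cauchy_iff
proof
  fix k
  define M where "M = nat k"
  have close: "val_ge k (tau j i - tau j M)" if "i \<ge> M" for i
    unfolding tau_def
    by (rule val_ge_mono[OF val_ge_cong_nat[OF pow_p_power_cong[OF that]]]) (simp add: M_def)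
  have "val_ge k (tau j i - tau j l)" if "i \<ge> M" "l \<ge> M" for i l
    using val_ge_diff[OF close[OF that(1)] close[OF that(2)]] by simp
  then show "\<exists>M. \<forall>i\<ge>M. \<forall>l\<ge>M. val_ge k (tau j i - tau j l)" by blast
qed

lemma sum_tau: "(\<Sum>j\<in>J. tau j i) = of_nat (\<Sum>j\<in>J. j ^ (p ^ i))"
  by (simp add: tau_def)

text \<open>From index \<open>m\<close> on the terms are constant modulo \<open>p ^ (m + 1)\<close>,
  so for \<open>n \<le> m + 1\<close> the bound on the limit can be read off at \<open>m\<close>.
  The choice \<open>m = n - 1\<close> serves both \<open>n\<close> and \<open>n - 1\<close>.\<close>

lemma padic_val_sum_tau_iff:
  assumes "finite J" "n \<le> Suc m"
  shows "Fin (int n) \<le> padic_val p (\<Oplus>\<^bsub>Q\<^esub>j\<in>J. cls (tau j)) \<longleftrightarrow> p ^ n dvd (\<Sum>j\<in>J. j ^ (p ^ m))"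
proof -
  have iff: "p ^ n dvd (\<Sum>j\<in>J. j ^ (p ^ i)) \<longleftrightarrow> p ^ n dvd (\<Sum>j\<in>J. j ^ (p ^ m))" if "i \<ge> m" for i
  proof -
    have "[(\<Sum>j\<in>J. j ^ (p ^ i)) = (\<Sum>j\<in>J. j ^ (p ^ m))] (mod p ^ Suc m)"
      by (intro cong_sum pow_p_power_cong that)
    then have "[(\<Sum>j\<in>J. j ^ (p ^ i)) = (\<Sum>j\<in>J. j ^ (p ^ m))] (mod p ^ n)"
      by (rule cong_dvd_modulus_nat) (rule le_imp_power_dvd[OF assms(2)])
    then show ?thesis by (rule cong_dvd_iff)
  qed
  have "Fin (int n) \<le> padic_val p (\<Oplus>\<^bsub>Q\<^esub>j\<in>J. cls (tau j)) \<longleftrightarrow>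
      (\<exists>M. \<forall>i\<ge>M. val_ge (int n) (\<Sum>j\<in>J. tau j i))"
    unfolding cls_finsum[OF assms(1) tau_Cauchy] by (rule padic_val_ge_iff[OF Cauchy_sum[OF tau_Cauchy]])
  also have "\<dots> \<longleftrightarrow> (\<exists>M. \<forall>i\<ge>M. p ^ n dvd (\<Sum>j\<in>J. j ^ (p ^ i)))"
    unfolding sum_tau val_ge_of_nat ..
  also have "\<dots> \<longleftrightarrow> p ^ n dvd (\<Sum>j\<in>J. j ^ (p ^ m))"
  proof
    assume "\<exists>M. \<forall>i\<ge>M. p ^ n dvd (\<Sum>j\<in>J. j ^ (p ^ i))"
    then obtain M where "\<forall>i\<ge>M. p ^ n dvd (\<Sum>j\<in>J. j ^ (p ^ i))" by blast
    moreover have "M \<le> max M m" by simp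
    ultimately have "p ^ n dvd (\<Sum>j\<in>J. j ^ (p ^ (max M m)))" by blast
    then show "p ^ n dvd (\<Sum>j\<in>J. j ^ (p ^ m))" unfolding iff[OF max.cobounded2] .
  next
    assume h: "p ^ n dvd (\<Sum>j\<in>J. j ^ (p ^ m))"
    show "\<exists>M. \<forall>i\<ge>M. p ^ n dvd (\<Sum>j\<in>J. j ^ (p ^ i))"
      by (intro exI[of _ m] allI impI) (simp only: iff h)
  qed
  finally show ?thesis .
qed

lemma tau_pow_null:
  assumes "\<not> p dvd j"
  shows "(\<lambda>i. tau j i ^ (p - 1) - 1) \<in> padic_null p"
  unfolding null_iff
proof
  fix k
  have "val_ge k (tau j i ^ (p - 1) - 1)" if "i \<ge> nat k" for i
  proof -
    have "[(j ^ (p - 1)) ^ (p ^ i) = 1 ^ (p ^ i)] (mod p ^ Suc i)"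
      by (rule cong_pow_prime_power_nat[OF fermat_theorem[OF prime assms]])
    then have "[(j ^ (p ^ i)) ^ (p - 1) = 1] (mod p ^ Suc i)"
      unfolding power_mult[symmetric] power_one by (simp only: mult.commute)
    then have "val_ge (int (Suc i)) (of_nat ((j ^ (p ^ i)) ^ (p - 1)) - of_nat 1)"
      by (rule val_ge_cong_nat)
    moreover have "k \<le> int (Suc i)" using that by simp
    ultimately show ?thesis unfolding tau_def of_nat_power of_nat_1 by (rule val_ge_mono)
  qed
  then show "\<exists>M. \<forall>i\<ge>M. val_ge k (tau j i ^ (p - 1) - 1)" by blast
qed

lemma val_ge_0_of_nat: "val_ge 0 (of_nat a)"
  using val_ge_of_nat[of 0 a] by simp

lemma val_ge_1_of_nat: "val_ge 1 (of_nat a) \<longleftrightarrow> p dvd a"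
  using val_ge_of_nat[of 1 a] by simp

text \<open>In lowest terms the denominator is prime to \<open>p\<close>, as otherwise
  \<open>p\<close> would divide the numerator too. So it is invertible modulo \<open>p\<close>, and
  \<open>j\<close> is the quotient of the residues.\<close>

lemma val_ge_residue:
  assumes "val_ge 0 x"
  shows "\<exists>j<p. val_ge 1 (x - of_nat j)"
proof -
  obtain a c where ac: "quotient_of x = (a, c)" by fastforce
  have x: "x = of_int a / of_int c" and c: "c > 0" and cop: "coprime a c"
    using quotient_of_div[OF ac] quotient_of_denom_pos[OF ac] quotient_of_coprime[OF ac] by blast+
  have c0: "c \<noteq> 0" using c by simp
  have pc: "\<not> int p dvd c"
  proof
    assume d: "int p dvd c"
    then have "multiplicity (int p) c \<ge> 1"
      using c0 p_gt_1 by (intro multiplicity_geI) auto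
    then have "int p dvd int p ^ multiplicity (int p) c" by (intro dvd_power) auto
    also have "\<dots> dvd a"
      using assms unfolding x val_ge_fraction[OF c0] by simp
    finally have "int p dvd 1" using cop d coprime_common_divisor by blast
    then show False using p_gt_1 by simp
  qed
  then have m0: "multiplicity (int p) c = 0" by (rule not_dvd_imp_multiplicity_0)
  have "coprime c (int p)"
    using prime_imp_coprime[of "int p" c] prime pc by (simp add: coprime_commute)
  then obtain u where u: "[c * u = 1] (mod int p)" using cong_solve_coprime_int by blast
  define j where "j = nat ((u * a) mod int p)"
  have j: "int j = (u * a) mod int p" "j < p"
    using p_gt_1 by (simp_all add: j_def nat_less_iff)
  have "[c * int j = c * (u * a)] (mod int p)" unfolding j(1) by (intro cong_mult cong_refl) (simp add: cong_def)
  also have "[c * (u * a) = 1 * a] (mod int p)"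
    unfolding mult.assoc[symmetric] by (intro cong_mult u cong_refl)
  finally have "[a = c * int j] (mod int p)" by (simp add: cong_sym_eq)
  then have "int p dvd a - c * int j" by (simp add: cong_iff_dvd_diff)
  then have "val_ge 1 (of_int (a - c * int j) / of_int c)"
    unfolding val_ge_fraction[OF c0] m0 by simp
  moreover have "of_int (a - c * int j) / of_int c = x - of_nat j"
    unfolding x using c0 by (simp add: diff_divide_distrib)
  ultimately show ?thesis using j(2) by auto
qed

lemma rat_pval_power: "rat_pval p x = Fin w \<Longrightarrow> rat_pval p (x ^ m) = Fin (int m * w)"
proof (induction m)
  case 0
  have "rat_pval p 1 = Fin 0" by (simp add: rat_pval_def)
  then show ?case by simp
next
  case (Suc m)
  then show ?case using rat_pval_mult[OF Suc.prems Suc.IH[OF Suc.prems]] by (simp add: algebra_simps)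
qed

lemma val_ge_0_if_power:
  assumes "val_ge 0 (x ^ m)" "m > 0"
  shows "val_ge 0 x"
proof (cases x rule: rat_pval_cases)
  case (2 w)
  then have "0 \<le> int m * w" using assms(1) rat_pval_power[of x w m] by (simp add: val_ge_def)
  then have "0 \<le> w" using assms(2) by (simp add: zero_le_mult_iff)
  then show ?thesis using 2 by (simp add: val_ge_def)
qed simp

lemma val_ge_power_diff:
  assumes "val_ge 0 x" "val_ge 0 y" "val_ge k (x - y)"
  shows "val_ge k (x ^ m - y ^ m)"
proof (induction m)
  case (Suc m)
  have "val_ge k (x * (x ^ m - y ^ m) + y ^ m * (x - y))"
    by (intro val_ge_add val_ge_0_mult val_ge_power assms Suc)
  then show ?case by (simp add: algebra_simps)
qed simp

lemma val_ge_mult_diff: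
  assumes "val_ge 0 x" "val_ge 0 w" "val_ge k (x - y)" "val_ge k (v - w)"
  shows "val_ge k (x * v - y * w)"
proof -
  have "val_ge k (x * (v - w) + w * (x - y))"
    by (intro val_ge_add val_ge_0_mult assms)
  then show ?thesis by (simp add: algebra_simps)
qed

text \<open>
  A root \<open>x\<close> of \<open>X ^ (p - 1) - 1\<close> and the Teichmueller representative \<open>t\<close> of its residue class
  satisfy \<open>x ^ (p - 1) - t ^ (p - 1) = (x - t) * s\<close> with \<open>s\<close> a unit, as \<open>s\<close> is congruent to
  \<open>(p - 1) * j ^ (p - 2)\<close> modulo \<open>p\<close>.
\<close>

lemma root_close_to_tau:
  assumes "p \<ge> 2" "\<not> p dvd j" and x: "val_ge 0 x" "val_ge 1 (x - of_nat j)"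
    and t: "val_ge 0 t" "val_ge 1 (t - of_nat j)" and k: "val_ge k (x ^ (p - 1) - t ^ (p - 1))"
  shows "val_ge k (x - t)"
proof -
  define s where "s = (\<Sum>i<p - 1. t ^ (p - 1 - Suc i) * x ^ i)"
  have s0: "val_ge 0 s" unfolding s_def by (intro val_ge_sum val_ge_0_mult val_ge_power x t)
  have "val_ge 1 (t ^ (p - 1 - Suc i) * x ^ i - of_nat j ^ (p - 1 - Suc i) * of_nat j ^ i)" for i
    by (intro val_ge_mult_diff val_ge_power val_ge_power_diff x t val_ge_0_of_nat)
  then have "val_ge 1 (s - (\<Sum>i<p - 1. of_nat j ^ (p - 1 - Suc i) * of_nat j ^ i))"
    unfolding s_def sum_subtractf[symmetric] by (intro val_ge_sum)
  moreover have "(\<Sum>i<p - 1. of_nat j ^ (p - 1 - Suc i) * of_nat j ^ i) = (of_nat ((p - 1) * j ^ (p - 2)) :: rat)"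
  proof -
    have "(\<Sum>i<p - 1. of_nat j ^ (p - 1 - Suc i) * of_nat j ^ i) = (\<Sum>i<p - 1. (of_nat j ^ (p - 2) :: rat))"
      by (rule sum.cong[OF refl]) (simp flip: power_add)
    then show ?thesis by simp
  qed
  ultimately have "val_ge 1 s \<longleftrightarrow> val_ge 1 (of_nat ((p - 1) * j ^ (p - 2)))"
    by (intro val_ge_cong) simp
  moreover have "\<not> p dvd (p - 1) * j ^ (p - 2)"
  proof
    assume "p dvd (p - 1) * j ^ (p - 2)"
    then have "p dvd p - 1 \<or> p dvd j ^ (p - 2)" by (simp only: prime_dvd_mult_iff[OF prime])
    moreover have "\<not> p dvd p - 1" using assms(1) by (auto dest: dvd_imp_le)
    moreover have "\<not> p dvd j ^ (p - 2)" using prime_dvd_power[OF prime, of j "p - 2"] assms(2) by blast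
    ultimately show False by blast
  qed
  ultimately have s1: "\<not> val_ge 1 s" unfolding val_ge_1_of_nat by blast
  have "x ^ (p - 1) - t ^ (p - 1) = (x - t) * s" unfolding s_def by (rule power_diff_sumr2)
  then show ?thesis using val_ge_unit_cancel[OF s0 s1] k by (simp only:)
qed

text \<open>The uniqueness part of Hensel's lemma, carried out on a representing Cauchy sequence:
  its terms are eventually p-integral with a common nonzero residue \<open>j\<close>, and then their
  difference from \<open>tau j\<close> is a null sequence.\<close>

lemma mu_roots_subset:
  assumes "\<xi> \<in> mu_roots p"
  shows "\<xi> \<in> (\<lambda>j. cls (tau j)) ` {1..p - 1}"
proof -
  have "\<xi> \<in> cls ` padic_Cauchy p" "\<xi> [^]\<^bsub>Q\<^esub> (p - 1) = \<one>\<^bsub>Q\<^esub>"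
    using assms unfolding mu_roots_def carrier_Q by blast+
  then obtain x where x: "x \<in> padic_Cauchy p" "\<xi> = cls x" by blast
  have null: "(\<lambda>i. x i ^ (p - 1) - 1) \<in> padic_null p"
    using \<open>\<xi> [^]\<^bsub>Q\<^esub> (p - 1) = \<one>\<^bsub>Q\<^esub>\<close> unfolding x(2) cls_pow[OF x(1)] Q_one cls_eq_iff .
  obtain M1 where M1: "\<forall>i\<ge>M1. val_ge 1 (x i ^ (p - 1) - 1)" using null unfolding null_iff by blast
  obtain M2 where M2: "\<forall>i\<ge>M2. \<forall>j\<ge>M2. val_ge 1 (x i - x j)" using x(1) unfolding Cauchy_iff by blast
  define M where "M = max M1 M2"
  have one: "val_ge 0 1" "\<not> val_ge 1 1"
    using val_ge_0_of_nat[of 1] val_ge_1_of_nat[of 1] p_gt_1 by simp_all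
  have pow1: "val_ge 1 (x i ^ (p - 1) - 1)" if "i \<ge> M" for i using M1 that by (simp add: M_def)
  have x0: "val_ge 0 (x i)" if "i \<ge> M" for i
  proof (rule val_ge_0_if_power)
    have "val_ge 0 ((x i ^ (p - 1) - 1) + 1)"
      by (intro val_ge_add one val_ge_mono[OF pow1[OF that]]) simp
    then show "val_ge 0 (x i ^ (p - 1))" by simp
  qed (use p_gt_1 in simp)
  obtain j where j: "j < p" "val_ge 1 (x M - of_nat j)" using val_ge_residue[OF x0[OF order_refl]] by blast
  have xj: "val_ge 1 (x i - of_nat j)" if "i \<ge> M" for i
  proof -
    have "val_ge 1 (x i - x M)" using M2 that by (simp add: M_def)
    then have "val_ge 1 ((x i - x M) + (x M - of_nat j))" using j(2) by (rule val_ge_add)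
    then show ?thesis by simp
  qed
  \<comment> \<open>With residue 0 the number \<open>x M ^ (p - 1)\<close> would be both divisible
    by \<open>p\<close> and congruent to 1.\<close>
  have "j \<noteq> 0"
  proof
    assume "j = 0"
    then have "val_ge 1 (x M ^ (p - 1) - 0 ^ (p - 1))"
      using j(2) by (intro val_ge_power_diff x0) simp_all
    moreover have "(0 :: rat) ^ (p - 1) = 0" by (rule zero_power) (use p_gt_1 in simp)
    ultimately have "val_ge 1 (x M ^ (p - 1))" by (simp only: diff_0_right)
    then have "val_ge 1 (x M ^ (p - 1) - (x M ^ (p - 1) - 1))"
      using pow1[OF order_refl] by (rule val_ge_diff)
    then show False using one(2) by simp
  qed
  then have jA: "j \<in> {1..p - 1}" using j(1) by simp
  have pj: "\<not> p dvd j" using \<open>j \<noteq> 0\<close> j(1) by (auto dest: dvd_imp_le)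
  have "(\<lambda>i. x i - tau j i) \<in> padic_null p"
    unfolding null_iff
  proof
    fix k
    obtain L1 where L1: "\<forall>i\<ge>L1. val_ge k (x i ^ (p - 1) - 1)" using null unfolding null_iff by blast
    obtain L2 where L2: "\<forall>i\<ge>L2. val_ge k (tau j i ^ (p - 1) - 1)"
      using tau_pow_null[OF pj] unfolding null_iff by blast
    have "val_ge k (x i - tau j i)" if i: "i \<ge> max M (max L1 L2)" for i
    proof (rule root_close_to_tau[OF _ pj])
      show "2 \<le> p" using p_gt_1 by simp
      show "val_ge 0 (x i)" "val_ge 1 (x i - of_nat j)" using i by (simp_all add: x0 xj)
      show "val_ge 0 (tau j i)" unfolding tau_def by (rule val_ge_0_of_nat)
      show "val_ge 1 (tau j i - of_nat j)"
        using val_ge_cong_nat[of "j ^ (p ^ i)" j 1] cong_pow_p_power_self[OF prime, of j i] by (simp add: tau_def)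
      have "val_ge k ((x i ^ (p - 1) - 1) - (tau j i ^ (p - 1) - 1))"
        by (rule val_ge_diff) (use i L1 L2 in simp_all)
      then show "val_ge k (x i ^ (p - 1) - tau j i ^ (p - 1))" by simp
    qed
    then show "\<exists>M. \<forall>i\<ge>M. val_ge k (x i - tau j i)" by blast
  qed
  then have "\<xi> = cls (tau j)" unfolding x(2) cls_eq_iff .
  then show ?thesis using jA by (rule image_eqI)
qed

lemma mu_roots_eq: "mu_roots p = (\<lambda>j. cls (tau j)) ` {1..p - 1}"
proof (rule equalityI)
  show "(\<lambda>j. cls (tau j)) ` {1..p - 1} \<subseteq> mu_roots p"
  proof (rule image_subsetI)
    fix j assume "j \<in> {1..p - 1}"
    then have "\<not> p dvd j" using p_gt_1 by (auto dest: dvd_imp_le)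
    then have "cls (tau j) [^]\<^bsub>Q\<^esub> (p - 1) = \<one>\<^bsub>Q\<^esub>"
      unfolding cls_pow[OF tau_Cauchy] Q_one cls_eq_iff by (rule tau_pow_null)
    then show "cls (tau j) \<in> mu_roots p"
      unfolding mu_roots_def using cls_in_carrier[OF tau_Cauchy] by blast
  qed
qed (rule subsetI, rule mu_roots_subset)

text \<open>All terms of \<open>tau j\<close> are congruent to \<open>j\<close> modulo
  \<open>p\<close>. Injectivity preserves the cardinalities of subsets and thus the signs in
  \<open>s_seq\<close>.\<close>

lemma inj_on_cls_tau: "inj_on (\<lambda>j. cls (tau j)) {1..p - 1}"
proof (rule inj_onI)
  fix i j assume ij: "i \<in> {1..p - 1}" "j \<in> {1..p - 1}" "cls (tau i) = cls (tau j)"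
  obtain M where "\<forall>l\<ge>M. val_ge 1 (tau i l - tau j l)"
    using ij(3) unfolding cls_eq_iff null_iff by blast
  then have "val_ge (int 1) (of_int (int (i ^ (p ^ M)) - int (j ^ (p ^ M))))" by (simp add: tau_def)
  then have "int p dvd int (i ^ (p ^ M)) - int (j ^ (p ^ M))" unfolding val_ge_of_int by simp
  then have "[i ^ (p ^ M) = j ^ (p ^ M)] (mod p)"
    unfolding cong_iff_dvd_diff[symmetric] by (simp only: cong_int_iff)
  moreover have "[i ^ (p ^ M) = i] (mod p)" "[j ^ (p ^ M) = j] (mod p)"
    by (rule cong_pow_p_power_self[OF prime])+
  ultimately have "[i = j] (mod p)" unfolding cong_def by simp
  moreover have "i < p" "j < p" using ij(1,2) p_gt_1 by auto
  ultimately show "i = j" by (simp add: cong_def)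
qed

definition root_sum :: "nat set \<Rightarrow> (nat \<Rightarrow> rat) set" where
  "root_sum J = (\<Oplus>\<^bsub>Q\<^esub>j\<in>J. cls (tau j))"

lemma finsum_roots:
  assumes "J \<subseteq> {1..p - 1}"
  shows "(\<Oplus>\<^bsub>Q\<^esub>\<xi>\<in>(\<lambda>j. cls (tau j)) ` J. \<xi>) = root_sum J"
  unfolding root_sum_def
  by (rule Q.finsum_reindex) (use cls_in_carrier[OF tau_Cauchy] inj_on_subset[OF inj_on_cls_tau assms] in auto)

lemma Pow_mu_roots: "Pow (mu_roots p) = (\<lambda>J. (\<lambda>j. cls (tau j)) ` J) ` Pow {1..p - 1}"
  unfolding mu_roots_eq by (rule image_Pow_surj[OF refl, symmetric])

lemma s_seq_eq:
  "s_seq p n = 1 / of_nat (p - 1) *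
     (\<Sum>J\<in>Pow {1..p - 1}. (- 1) ^ card J * of_bool (Fin (int n) \<le> padic_val p (root_sum J)))"
proof -
  have "(\<Sum>H\<in>Pow (mu_roots p). (- 1) ^ card H * of_bool (padic_val p (\<Oplus>\<^bsub>Q\<^esub>\<xi>\<in>H. \<xi>) \<ge> Fin (int n))) =
      (\<Sum>J\<in>Pow {1..p - 1}. (- 1) ^ card J * of_bool (Fin (int n) \<le> padic_val p (root_sum J)) :: rat)"
    unfolding Pow_mu_roots
  proof (subst sum.reindex[OF inj_on_image_Pow[OF inj_on_cls_tau]], rule sum.cong[OF refl])
    fix J assume "J \<in> Pow {1..p - 1}"
    then have J: "J \<subseteq> {1..p - 1}" by blast
    show "((\<lambda>H. (- 1) ^ card H * of_bool (padic_val p (\<Oplus>\<^bsub>Q\<^esub>\<xi>\<in>H. \<xi>) \<ge> Fin (int n))) \<circ> (\<lambda>J. (\<lambda>j. cls (tau j)) ` J)) J =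
        ((- 1) ^ card J * of_bool (Fin (int n) \<le> padic_val p (root_sum J)) :: rat)"
      unfolding o_def finsum_roots[OF J] card_image[OF inj_on_subset[OF inj_on_cls_tau J]] ..
  qed
  then show ?thesis unfolding s_seq_def by (simp only:)
qed

lemma root_sum_val_iff:
  assumes "J \<in> Pow {1..p - 1}" "n \<le> Suc m"
  shows "Fin (int n) \<le> padic_val p (root_sum J) \<longleftrightarrow> p ^ n dvd (\<Sum>j\<in>J. j ^ (p ^ m))"
  unfolding root_sum_def
  by (rule padic_val_sum_tau_iff) (use assms finite_subset[of J "{1..p - 1}"] in auto)

end

section \<open>The numbers s_n\<close>

text \<open>This is the expansion of a product of factors \<open>- 1 + 1\<close>.\<close>

lemma sum_Pow_alternating:
  assumes "finite A" "A \<noteq> {}"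
  shows "(\<Sum>J\<in>Pow A. (- 1) ^ card J) = (0 :: 'a :: comm_ring_1)"
proof -
  have "(\<Sum>J\<in>Pow A. (- 1) ^ card J) = (\<Sum>J\<in>Pow A. (\<Prod>x\<in>J. - 1 :: 'a) * (\<Prod>x\<in>A - J. 1))"
    by simp
  also have "\<dots> = (\<Prod>x\<in>A. - 1 + 1)" by (rule prod_add_Pow[OF assms(1), symmetric])
  also have "\<dots> = 0" using assms by (simp add: power_0_left card_0_eq)
  finally show ?thesis .
qed

context padic
begin

text \<open>Sums of roots of unity are p-integral, so for index 0 every subset is counted and the
  signs cancel.\<close>

lemma s_seq_0: "s_seq p 0 = 0"
proof -
  have "(\<Sum>J\<in>Pow {1..p - 1}. (- 1) ^ card J * of_bool (Fin (int 0) \<le> padic_val p (root_sum J))) =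
      (\<Sum>J\<in>Pow {1..p - 1}. (- 1) ^ card J :: rat)"
    by (intro sum.cong refl) (simp add: root_sum_val_iff[of _ 0 0, simplified])
  also have "\<dots> = 0" by (rule sum_Pow_alternating) (use p_gt_1 in auto)
  finally show ?thesis unfolding s_seq_eq by (simp only: mult_zero_right)
qed

lemma s_seq_mult_Ints: "of_nat (p - 1) * s_seq p n \<in> \<int>"
proof -
  have "of_nat (p - 1) * s_seq p n =
      (\<Sum>J\<in>Pow {1..p - 1}. (- 1) ^ card J * of_bool (Fin (int n) \<le> padic_val p (root_sum J)))"
    unfolding s_seq_eq using p_gt_1 by simp
  also have "\<dots> \<in> \<int>" by (intro Ints_sum Ints_mult Ints_power Ints_minus Ints_1) (simp add: of_bool_def)
  finally show ?thesis .
qed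

lemma root_sum_val:
  assumes J: "J \<in> Pow {1..p - 1}" and "root_sum J \<noteq> \<zero>\<^bsub>Q\<^esub>"
  shows "\<exists>w\<ge>0. padic_val p (root_sum J) = Fin w"
proof -
  have "finite J" using J finite_subset by auto
  then have eq: "root_sum J = cls (\<lambda>i. \<Sum>j\<in>J. tau j i)"
    unfolding root_sum_def by (rule cls_finsum[OF _ tau_Cauchy])
  have nn: "(\<lambda>i. \<Sum>j\<in>J. tau j i) \<notin> padic_null p"
    using assms(2) unfolding eq cls_eq_zero_iff .
  obtain w where w: "padic_val p (root_sum J) = Fin w"
    unfolding eq using padic_val_cls[OF Cauchy_sum[of J tau, OF tau_Cauchy] nn] by blast
  moreover have "Fin (int 0) \<le> padic_val p (root_sum J)"
    unfolding root_sum_val_iff[OF J le0[of "Suc 0"]] by simp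
  ultimately show ?thesis by simp
qed

lemma padic_val_zero: "padic_val p \<zero>\<^bsub>Q\<^esub> = \<infinity>" by (simp add: padic_val_def)

text \<open>Beyond the largest finite valuation of a subset sum only a vanishing sum can meet the
  bound. The resulting condition is independent of \<open>n\<close>, which makes \<open>s_n\<close>
  constant from \<open>m\<close> on.\<close>

lemma Nbound_eq:
  "\<exists>m. Nbound p = Fin (int m) \<and> (\<forall>n\<ge>m. \<forall>J\<in>Pow {1..p - 1}.
     Fin (int n) \<le> padic_val p (root_sum J) \<longleftrightarrow> root_sum J = \<zero>\<^bsub>Q\<^esub>)"
proof -
  define A where "A = {J \<in> Pow {1..p - 1}. root_sum J \<noteq> \<zero>\<^bsub>Q\<^esub>}"
  define V where "V = (\<lambda>J. padic_val p (root_sum J)) ` A"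
  have V: "{padic_val p (\<Oplus>\<^bsub>Q\<^esub>\<xi>\<in>H. \<xi>) | H. H \<subseteq> mu_roots p \<and> (\<Oplus>\<^bsub>Q\<^esub>\<xi>\<in>H. \<xi>) \<noteq> \<zero>\<^bsub>Q\<^esub>} = V"
    (is "?L = V")
  proof (intro equalityI subsetI)
    fix v assume "v \<in> ?L"
    then obtain H where H: "v = padic_val p (\<Oplus>\<^bsub>Q\<^esub>\<xi>\<in>H. \<xi>)" "H \<in> Pow (mu_roots p)" "(\<Oplus>\<^bsub>Q\<^esub>\<xi>\<in>H. \<xi>) \<noteq> \<zero>\<^bsub>Q\<^esub>"
      by blast
    then obtain J where J: "J \<in> Pow {1..p - 1}" "H = (\<lambda>j. cls (tau j)) ` J" unfolding Pow_mu_roots by blast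
    have "(\<Oplus>\<^bsub>Q\<^esub>\<xi>\<in>H. \<xi>) = root_sum J" unfolding J(2) by (rule finsum_roots[OF PowD[OF J(1)]])
    then show "v \<in> V" unfolding V_def A_def using H(1,3) J(1) by simp
  next
    fix v assume "v \<in> V"
    then obtain J where J: "J \<in> Pow {1..p - 1}" "root_sum J \<noteq> \<zero>\<^bsub>Q\<^esub>" "v = padic_val p (root_sum J)"
      unfolding V_def A_def by blast
    let ?H = "(\<lambda>j. cls (tau j)) ` J"
    have "?H \<in> Pow (mu_roots p)" unfolding Pow_mu_roots using J(1) by (rule imageI)
    then show "v \<in> ?L"
      using J(2,3) unfolding finsum_roots[OF PowD[OF J(1)], symmetric] by blast
  qed
  have "finite V" unfolding V_def A_def by simp
  moreover have "V \<noteq> {}"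
  proof -
    \<comment> \<open>\<open>Max\<close> needs a nonempty set; the sum over the single root
      \<open>tau 1\<close> is not divisible by \<open>p\<close> and hence nonzero.\<close>
    have J: "{1} \<in> Pow {1..p - 1}" using p_gt_1 by auto
    have "\<not> Fin (int 1) \<le> padic_val p (root_sum {1})"
      using root_sum_val_iff[OF J, of 1 0] p_gt_1 by simp
    then have "root_sum {1} \<noteq> \<zero>\<^bsub>Q\<^esub>" using padic_val_zero by auto
    then show ?thesis unfolding V_def A_def using J by blast
  qed
  ultimately have "Max V \<in> V" by (rule Max_in)
  then obtain J0 where "J0 \<in> A" "Max V = padic_val p (root_sum J0)" unfolding V_def by blast
  \<comment> \<open>Nonnegativity of \<open>w\<close> allows the integer \<open>w + 1\<close> to be
    used as a natural index.\<close>
  then obtain w where w: "w \<ge> 0" "Max V = Fin w" using root_sum_val[of J0] unfolding A_def by auto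
  show ?thesis
  proof (intro exI[of _ "nat (w + 1)"] conjI allI impI ballI)
    show "Nbound p = Fin (int (nat (w + 1)))" unfolding Nbound_def V w(2) one_extended_def using w(1) by simp
    fix n J assume "n \<ge> nat (w + 1)" and J: "J \<in> Pow {1..p - 1}"
    then have n: "int n \<ge> w + 1" by simp
    show "Fin (int n) \<le> padic_val p (root_sum J) \<longleftrightarrow> root_sum J = \<zero>\<^bsub>Q\<^esub>"
    proof
      assume h: "Fin (int n) \<le> padic_val p (root_sum J)"
      show "root_sum J = \<zero>\<^bsub>Q\<^esub>"
      proof (rule ccontr)
        assume "root_sum J \<noteq> \<zero>\<^bsub>Q\<^esub>"
        then have "padic_val p (root_sum J) \<in> V" unfolding V_def A_def using J by blast
        then have "padic_val p (root_sum J) \<le> Fin w" unfolding w(2)[symmetric] by (rule Max_ge[OF \<open>finite V\<close>])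
        then have "Fin (int n) \<le> Fin w" using h by (rule order_trans[rotated])
        then show False using n by simp
      qed
    next
      assume "root_sum J = \<zero>\<^bsub>Q\<^esub>"
      then show "Fin (int n) \<le> padic_val p (root_sum J)" by (simp add: padic_val_zero)
    qed
  qed
qed

lemma s_seq_stationary: "\<exists>m. Nbound p = Fin (int m) \<and> (\<forall>n\<ge>m. s_seq p n = s_seq p m)"
proof -
  obtain m where m: "Nbound p = Fin (int m)" "\<forall>n\<ge>m. \<forall>J\<in>Pow {1..p - 1}.
     Fin (int n) \<le> padic_val p (root_sum J) \<longleftrightarrow> root_sum J = \<zero>\<^bsub>Q\<^esub>"
    using Nbound_eq by blast
  have const: "s_seq p n = 1 / of_nat (p - 1) *
      (\<Sum>J\<in>Pow {1..p - 1}. (- 1) ^ card J * of_bool (root_sum J = \<zero>\<^bsub>Q\<^esub>))" if "n \<ge> m" for n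
  proof -
    have "Fin (int n) \<le> padic_val p (root_sum J) \<longleftrightarrow> root_sum J = \<zero>\<^bsub>Q\<^esub>" if "J \<in> Pow {1..p - 1}" for J
      using m(2) that \<open>n \<ge> m\<close> by blast
    then show ?thesis unfolding s_seq_eq by (simp only: cong: sum.cong)
  qed
  have "s_seq p n = s_seq p m" if "n \<ge> m" for n
    unfolding const[OF that] const[OF order_refl] ..
  then show ?thesis using m(1) by blast
qed

lemma trace_pi_elt_eq_s_seq:
  assumes "odd p" "n \<ge> 1" "primitive_root_of_unity (p ^ n) z"
  shows "field_trace CC \<rat> (E_field p z) (pi_elt p n z) =
      of_rat (of_nat p ^ n * s_seq p n - of_nat p ^ (n - 1) * s_seq p (n - 1))"
proof -
  interpret prime_power_root p n z by unfold_locales (use prime assms in auto)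
  let ?S = "\<lambda>J. \<Sum>j\<in>J. j ^ (p ^ (n - 1))"
  have val: "Fin (int n) \<le> padic_val p (root_sum J) \<longleftrightarrow> p ^ n dvd ?S J"
      "Fin (int (n - 1)) \<le> padic_val p (root_sum J) \<longleftrightarrow> p ^ (n - 1) dvd ?S J" if "J \<in> Pow {1..p - 1}" for J
    using root_sum_val_iff[OF that, of n "n - 1"] root_sum_val_iff[OF that, of "n - 1" "n - 1"] assms(2)
    by simp_all
  have s: "s_seq p n = 1 / of_nat (p - 1) * (\<Sum>J\<in>Pow {1..p - 1}. (- 1) ^ card J * of_bool (p ^ n dvd ?S J))"
      "s_seq p (n - 1) = 1 / of_nat (p - 1) * (\<Sum>J\<in>Pow {1..p - 1}. (- 1) ^ card J * of_bool (p ^ (n - 1) dvd ?S J))"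
    unfolding s_seq_eq by (simp_all only: val cong: sum.cong)
  have summands: "(\<Sum>J\<in>Pow {1..p - 1}. (- 1) ^ card J *
        (of_nat (p ^ n * of_bool (p ^ n dvd ?S J)) - of_nat (p ^ (n - 1) * of_bool (p ^ (n - 1) dvd ?S J)))) =
      (\<Sum>J\<in>Pow {1..p - 1}. of_nat p ^ n * ((- 1) ^ card J * of_bool (p ^ n dvd ?S J)) -
        of_nat p ^ (n - 1) * ((- 1) ^ card J * of_bool (p ^ (n - 1) dvd ?S J)) :: rat)"
    by (rule sum.cong[OF refl])
      (simp only: of_nat_mult of_nat_power of_nat_of_bool right_diff_distrib mult.left_commute)
  have frac: "c * (1 / q * x) - d * (1 / q * y) = (c * x - d * y) / q" for c d q x y :: rat
    by (simp add: diff_divide_distrib)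
  have "of_nat p ^ n * s_seq p n - of_nat p ^ (n - 1) * s_seq p (n - 1) =
      (\<Sum>J\<in>Pow {1..p - 1}. (- 1) ^ card J *
        (of_nat (p ^ n * of_bool (p ^ n dvd ?S J)) - of_nat (p ^ (n - 1) * of_bool (p ^ (n - 1) dvd ?S J)))) / of_nat (p - 1)"
    unfolding s frac summands by (simp only: sum_subtractf sum_distrib_left)
  then show ?thesis
    unfolding field_trace_pi_elt[OF assms(1)]
    by (simp only: of_rat_divide of_rat_sum of_rat_mult of_rat_diff of_rat_power of_rat_minus of_rat_1 of_rat_of_nat_eq)
qed

lemma s_seq_Ints:
  assumes "odd p" and z: "\<And>n. n \<ge> 1 \<Longrightarrow> primitive_root_of_unity (p ^ n) (z n)"
  shows "s_seq p n \<in> \<int>"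
proof (induction n)
  case 0
  show ?case by (simp add: s_seq_0)
next
  case (Suc n)
  interpret prime_power_root p "Suc n" "z (Suc n)" by unfold_locales (use prime z[of "Suc n"] in auto)
  let ?s = "s_seq p (Suc n)"
  have "(of_rat (of_nat p ^ Suc n * ?s - of_nat p ^ n * s_seq p n) :: complex) \<in> \<int>"
    using field_trace_pi_elt_Ints trace_pi_elt_eq_s_seq[OF assms(1) _ z[of "Suc n"]] by simp
  then obtain k where "(of_rat (of_nat p ^ Suc n * ?s - of_nat p ^ n * s_seq p n) :: complex) = of_rat (of_int k)"
    by (auto elim: Ints_cases)
  then have "of_nat p ^ Suc n * ?s - of_nat p ^ n * s_seq p n = of_int k" by (simp only: of_rat_eq_iff)
  then have "of_nat p ^ Suc n * ?s = of_int k + of_nat p ^ n * s_seq p n" by (simp only: diff_eq_eq)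
  moreover have "of_int k + of_nat p ^ n * s_seq p n \<in> \<int>"
    by (intro Ints_add Ints_of_int Ints_mult Ints_power Ints_of_nat Suc)
  ultimately have ps: "of_nat p ^ Suc n * ?s \<in> \<int>" by (simp only:)
  have "coprime p (p - 1)" using p_gt_1 by (intro coprime_diff_one_right_nat) simp
  then have "coprime (int p) (int (p - 1))" by (simp only: coprime_int_iff)
  then have cop: "coprime (int p ^ Suc n) (int (p - 1))" unfolding coprime_power_left_iff by blast
  \<comment> \<open>A Bezout combination recovers \<open>?s\<close> from its two integral multiples,
    by \<open>p ^ Suc n\<close> and by \<open>p - 1\<close>.\<close>
  obtain u v where uv: "u * int p ^ Suc n + v * int (p - 1) = gcd (int p ^ Suc n) (int (p - 1))"
    using bezout_int by blast
  have "of_int (u * int p ^ Suc n + v * int (p - 1)) = (1 :: rat)"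
    unfolding uv coprime_imp_gcd_eq_1[OF cop] by (rule of_int_1)
  then have one: "of_int u * of_nat p ^ Suc n + of_int v * of_nat (p - 1) = (1 :: rat)"
    by (simp only: of_int_add of_int_mult of_int_power of_int_of_nat_eq)
  have "(of_int u * of_nat p ^ Suc n + of_int v * of_nat (p - 1)) * ?s = ?s"
    unfolding one by (rule mult_1)
  then have "of_int u * (of_nat p ^ Suc n * ?s) + of_int v * (of_nat (p - 1) * ?s) = ?s"
    by (simp only: distrib_right mult.assoc)
  moreover have "of_int u * (of_nat p ^ Suc n * ?s) + of_int v * (of_nat (p - 1) * ?s) \<in> \<int>"
    by (intro Ints_add Ints_mult[OF Ints_of_int] ps s_seq_mult_Ints)
  ultimately show ?case by (simp only:)
qed

end

theorem proposition5p5: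
  fixes p :: nat and \<zeta> :: "nat \<Rightarrow> complex"
  assumes "prime p" and "p \<ge> 3"
    and "\<forall>n\<ge>1. primitive_root_of_unity (p ^ n) (\<zeta> n)"
    and "\<forall>n\<ge>1. \<zeta> (n + 1) ^ p = \<zeta> n"
  shows "(\<forall>n\<ge>1. field_trace CC \<rat> (E_field p (\<zeta> n)) (pi_elt p n (\<zeta> n))
                   = of_rat (of_nat p ^ n * s_seq p n - of_nat p ^ (n - 1) * s_seq p (n - 1)))
       \<and> s_seq p 0 = 0
       \<and> (\<forall>n. s_seq p n \<in> \<int>)
       \<and> (\<exists>N. \<forall>n\<ge>N. s_seq p n = s_seq p N)
       \<and> Fin (int (N0 p)) \<le> Nbound p"
proof -
  interpret padic p by unfold_locales (rule assms(1))
  have odd: "odd p" using prime_odd_nat[OF assms(1)] assms(2) by simp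
  have z: "primitive_root_of_unity (p ^ n) (\<zeta> n)" if "n \<ge> 1" for n using assms(3) that by blast
  obtain N where N: "Nbound p = Fin (int N)" "\<forall>n\<ge>N. s_seq p n = s_seq p N"
    using s_seq_stationary by blast
  have "N0 p \<le> N" unfolding N0_def using N(2) by (rule Least_le)
  then have "Fin (int (N0 p)) \<le> Nbound p" unfolding N(1) by simp
  moreover have "\<forall>n\<ge>1. field_trace CC \<rat> (E_field p (\<zeta> n)) (pi_elt p n (\<zeta> n))
      = of_rat (of_nat p ^ n * s_seq p n - of_nat p ^ (n - 1) * s_seq p (n - 1))"
    by (intro allI impI trace_pi_elt_eq_s_seq odd z)
  moreover have "\<forall>n. s_seq p n \<in> \<int>" by (intro allI s_seq_Ints[of \<zeta>] odd z)
  moreover have "\<exists>N. \<forall>n\<ge>N. s_seq p n = s_seq p N" using N(2) by (rule exI)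
  ultimately show ?thesis using s_seq_0 by (intro conjI)
qed

end
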